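(* Let $\Psi(T^n)$ be the total path length of a random split tree $T^n$ of cardinality $n$ with split vector $\mathcal V=(V_1,\ldots,V_b)$, where $\mathbf P(\exists i:V_i=1)<1$. Then, as $n\to\infty$, $$\mathbf E[\Psi(T^n)]=\mu^{-1}n\ln n+n\,\varpi(\ln n)+o(n),$$ where $\varpi$ is a continuous periodic function of period $d$. In particular, if $\ln V$ is not lattice, then $d=0$ and $\varpi$ is constant.
   Context: Split trees. Fix integers $b\ge 2$, $s\ge 0$, $s_0\ge0$, $s_1\ge 0$ with $0\le bs_1\le s+1-s_0$ and $(s,s_0)\ne(0,0)$, and a random vector $\mathcal V=(V_1,\ldots,V_b)$ with $V_i\ge 0$, $\sum_i V_i=1$ and $\mathbf P(\exists i: V_i=1)<1$. Let $\mathcal U=\bigcup_{k\ge0}\{1,\ldots,b\}^k$ be the nodes of the infinite rooted $b$-ary tree (root $\varnothing$, depth of $u$ denoted $|u|$). Each node $u\in\mathcal U$ receives an independent copy $\mathcal V_u$ of $\mathcal V$. The number $n_u$ of items in the subtree rooted at $u$ is defined by $n_\varnothing=n$ and recursively: if $n_v>s$, then given $n_v$ and $\mathcal V_v=(V_1,\ldots,V_b)$, the cardinalities $(n_{v_1},\ldots,n_{v_b})$ of the children of $v$ are distributed as $\mathrm{Mult}(n_v-s_0-bs_1;V_1,\ldots,V_b)+(s_1,\ldots,s_1)$, and $v$ itself stores $s_0$ items; if $n_v\le s$, then $v$ stores all its $n_v$ items and all its strict descendants $w$ have $n_w=0$. The split tree $T^n$ of cardinality $n$ is the set of nodes $u$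 with $n_u>0$. Total path length. $\Psi(T^n)$ is the sum over the $n$ items of the depth of the node storing the item; equivalently $\Psi(T^n)=\sum_{u\ne\varnothing}n_u$. Constants. $V$ denotes a uniformly random component of $\mathcal V$, $\mu:=b\,\mathbf E[-V\ln V]\in(0,\infty)$ (with $0\ln0=0$), and $d:=\sup\{a\ge0:\mathbf P(\ln V\in a\mathbb Z)=1\}$, where the value $\ln 0=-\infty$ is disregarded (i.e. counted as lying in $a\mathbb Z$) and $\sup\emptyset=0$. Thus $\ln V$ is lattice with span $d$ if $d>0$ and nonlattice if $d=0$. A periodic function of period $0$ means a constant function. *)

theory Defs
  imports
    "HOL-Probability.Probability"
    "HOL-Library.Landau_Symbols"
    "HOL-Library.Sublist"
begin

text \<open>
  The branching number is \<open>CARD('b)\<close>. The nodes of the infinite tree are the lists over \<open>'b\<close>: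
  \<open>[]\<close> is the root, the children of \<open>v\<close> are the nodes \<open>v @ [i]\<close>, the depth of a node is its
  length, and \<open>w\<close> is a strict descendant of \<open>v\<close> iff \<open>strict_prefix v w\<close>.
\<close>

definition multinomial_prob :: "nat \<Rightarrow> real ^ 'b::finite \<Rightarrow> ('b \<Rightarrow> nat) \<Rightarrow> real" where
  "multinomial_prob m p k =
     (if (\<Sum>i\<in>UNIV. k i) = m
      then fact m / (\<Prod>i\<in>UNIV. fact (k i)) * (\<Prod>i\<in>UNIV. (p $ i) ^ k i) else 0)"

text \<open>
  The information available when the items at \<open>v\<close> are split: all split vectors, and the
  cardinalities of all subtrees except those rooted strictly below \<open>v\<close>.
\<close>

definition split_history ::
  "'a measure \<Rightarrow> ('b::finite list \<Rightarrow> 'a \<Rightarrow> real ^ 'b) \<Rightarrow> ('b list \<Rightarrow> 'a \<Rightarrow> nat) \<Rightarrow> 'b list \<Rightarrow> 'a measure"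
  where
  "split_history M V N v = sigma (space M)
     ({V u -` B \<inter> space M | u B. B \<in> sets borel} \<union>
      {N w -` B \<inter> space M | w B. \<not> strict_prefix v w})"

text \<open>
  \<open>V u\<close> is the copy of the split vector \<open>\<V>\<close> (a random vector on \<open>P\<close>) at the node \<open>u\<close>, and
  \<open>N u\<close> is the number of items in the subtree rooted at \<open>u\<close>. The multinomial law of the
  cardinalities of the children of \<open>v\<close> is their conditional law given \<open>split_history M V N v\<close>;
  it depends on this history only through \<open>N v\<close> and \<open>V v\<close>. This expresses that different nodes
  split independently of each other given their cardinalities and split vectors.
\<close>

locale split_tree = prob_space M
  for M :: "'a measure" +
  fixes s s0 s1 :: nat
    and P :: "'p measure" and \<V> :: "'p \<Rightarrow> real ^ 'b::finite"
    and n :: nat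
    and V :: "'b list \<Rightarrow> 'a \<Rightarrow> real ^ 'b"
    and N :: "'b list \<Rightarrow> 'a \<Rightarrow> nat"
  assumes indep_V: "indep_vars (\<lambda>_. borel) V UNIV"
    and distr_V: "distr M borel (V u) = distr P borel \<V>"
    and measurable_N: "N u \<in> measurable M (count_space UNIV)"
    and root: "AE \<omega> in M. N [] \<omega> = n"
    and leaf: "AE \<omega> in M. N v \<omega> \<le> s \<longrightarrow> (\<forall>w. strict_prefix v w \<longrightarrow> N w \<omega> = 0)"
    and split: "AE \<omega> in M. N v \<omega> > s \<longrightarrow>
      real_cond_exp M (split_history M V N v)
        (indicator {\<omega> \<in> space M. \<forall>i. N (v @ [i]) \<omega> = k i + s1}) \<omega>
      = multinomial_prob (N v \<omega> - s0 - CARD('b) * s1) (V v \<omega>) k"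

definition tree_nodes :: "('b list \<Rightarrow> nat) \<Rightarrow> 'b list set" where
  "tree_nodes c = {u. c u > 0}"

definition stored_items :: "nat \<Rightarrow> nat \<Rightarrow> ('b list \<Rightarrow> nat) \<Rightarrow> 'b list \<Rightarrow> nat" where
  "stored_items s s0 c u = (if c u > s then s0 else c u)"

definition total_path_length :: "nat \<Rightarrow> nat \<Rightarrow> ('b list \<Rightarrow> nat) \<Rightarrow> ennreal" where
  "total_path_length s s0 c =
     (\<Sum>\<^sub>\<infinity>u\<in>tree_nodes c. of_nat (length u) * of_nat (stored_items s s0 c u))"

definition expected_path_length ::
  "nat \<Rightarrow> nat \<Rightarrow> 'a measure \<Rightarrow> ('b list \<Rightarrow> 'a \<Rightarrow> nat) \<Rightarrow> ennreal" where
  "expected_path_length s s0 M N = (\<integral>\<^sup>+ \<omega>. total_path_length s s0 (\<lambda>u. N u \<omega>) \<partial>M)"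

text \<open>The law of a uniformly random component of the split vector.\<close>

definition component_law :: "'p measure \<Rightarrow> ('p \<Rightarrow> real ^ 'b::finite) \<Rightarrow> real measure" where
  "component_law P \<V> =
     distr (P \<Otimes>\<^sub>M measure_pmf (pmf_of_set (UNIV :: 'b set))) borel (\<lambda>(\<omega>, i). \<V> \<omega> $ i)"

text \<open>Here \<open>ln 0 = 0\<close> in the library, so the convention \<open>0 ln 0 = 0\<close> holds.\<close>

definition split_mu :: "'p measure \<Rightarrow> ('p \<Rightarrow> real ^ 'b::finite) \<Rightarrow> real" where
  "split_mu P \<V> = real CARD('b) * (\<integral>x. - x * ln x \<partial>component_law P \<V>)"

text \<open>
  The supremum of the real set is written with an explicit case for the empty set, where the
  library leaves \<open>Sup\<close> unspecified. The disjunct \<open>x = 0\<close> disregards the value \<open>ln 0 = -\<infinity>\<close>.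
\<close>

definition log_spans :: "real measure \<Rightarrow> real set" where
  "log_spans L = {a. a \<ge> 0 \<and> \<P>(x in L. x = 0 \<or> (\<exists>k::int. ln x = a * of_int k)) = 1}"

definition log_span :: "real measure \<Rightarrow> real" where
  "log_span L = (if log_spans L = {} then 0 else Sup (log_spans L))"

definition log_lattice :: "real measure \<Rightarrow> bool" where
  "log_lattice L \<longleftrightarrow> log_span L > 0"

text \<open>Period \<open>0\<close> means constant.\<close>

definition has_period :: "(real \<Rightarrow> real) \<Rightarrow> real \<Rightarrow> bool" where
  "has_period f d \<longleftrightarrow>
     (if d = 0 then \<exists>c. \<forall>x. f x = c else \<forall>x. f (x + d) = f x)"

end

theory Submission
  imports Defs "HOL-Real_Asymp.Real_Asymp"
begin

text \<open>
  Put \<open>a n = \<psi> (n + 1) - \<psi> n\<close>, where \<open>\<psi> n\<close> is the expected path length. Since adding an item to a binomial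
  variable adds a Bernoulli variable, the recursion for \<open>\<psi>\<close> gives \<open>a n = 1 + E (a Y)\<close>, where \<open>Y\<close> is the
  cardinality of the child into which the additional item falls, that is, with the split probability
  replaced by its size-biased version \<open>W\<close>. Here \<open>E (ln (1 + Y)) = ln n - \<mu> + O(1/n)\<close>, and the operator
  \<open>f \<mapsto> E (f Y)\<close> strictly increases \<open>n powr (-1/2)\<close> because \<open>E (1 / sqrt W) > 1\<close>; a maximum principle then
  shows that \<open>a n - ln n / \<mu>\<close> is bounded. Hence \<open>S n = \<psi> n - ln (n!) / \<mu>\<close> is Lipschitz, and replacing the
  binomial variable by its mean costs only \<open>O(sqrt n)\<close>. So \<open>K t = S (exp t) / exp t\<close> is bounded,
  Lipschitz, and satisfies \<open>K t = E (K (t - X)) + O(exp (-t/2))\<close> with \<open>X = - ln W\<close>.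

  For such a \<open>K\<close>, an energy argument gives \<open>E ((K (t - X) - K t)^2) \<longlonglongrightarrow> 0\<close>, so every element of the
  closed group generated by the support of \<open>X\<close> is an asymptotic period of \<open>K\<close>. The averages of \<open>K\<close>
  over \<open>[t - X, t]\<close>, with respect to Lebesgue or to counting measure on the lattice, converge because
  they change only by the summable error; this identifies the limit.
\<close>

subsection \<open>A renewal theorem for approximate solutions\<close>

text \<open>\<open>K\<close> solves the renewal equation only for t \<ge> 0 and only up to an error,
  so the limit theorem is proved directly for bounded Lipschitz approximate solutions: the error
  enters through its finite integral or geometric sum, and the Lipschitz bound turns pointwise
  statements about shifts into uniform ones. Increments are used because the split operator on
  \<open>\<psi>\<close> has total weight b, whereas on increments it is an average over one
  size-biased child, to which a maximum principle applies. The power -1/2 is a choice: any power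
  strictly between -1 and 0 decays more slowly than the error O(1/n), so its strict gain dominates
  that error. Subtracting \<open>ln (n!) / \<mu>\<close> rather than \<open>n ln n / \<mu>\<close>
  gives the exact increments \<open>ln (n + 1) / \<mu>\<close>; Stirling's formula contributes
  \<open>- 1 / \<mu>\<close> to the limit function. The recursion itself is not given: the model
  prescribes only conditional laws given a history. One has to prove that the cardinality of a node
  is independent of its own split vector, that no item is passed on forever, and that the
  expectation is finite.\<close>

text \<open>\<open>Y\<close> is nonincreasing and bounded below, so its total decrease is finite; a
  Lipschitz \<open>F\<close> that kept returning to a level \<open>e\<close> would force an infinite
  decrease.\<close>

lemma Barbalat:
  fixes Y F :: "real \<Rightarrow> real"
  assumes deriv: "\<And>t. t \<ge> 0 \<Longrightarrow> (Y has_real_derivative Y' t) (at t)"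
    and le: "\<And>t. t \<ge> 0 \<Longrightarrow> Y' t \<le> - F t"
    and F0: "\<And>t. F t \<ge> 0"
    and lip: "\<And>t u. \<bar>F t - F u\<bar> \<le> m * \<bar>t - u\<bar>"
    and bdd: "\<And>t. t \<ge> 0 \<Longrightarrow> c \<le> Y t"
  shows "(F \<longlongrightarrow> 0) at_top"
proof (rule tendstoI)
  fix e :: real assume e: "e > 0"
  define m' where "m' = \<bar>m\<bar> + 1"
  have m': "m' > 0" "m \<le> m'" by (auto simp: m'_def)
  \<comment> \<open>Since \<open>m' * h = e / 4\<close>, a value \<open>F t \<ge> e\<close> keeps
    \<open>F\<close> above \<open>3 * e / 4\<close> on a window of length \<open>h\<close>, where
    \<open>Y\<close> drops by at least \<open>3 * h * e / 4\<close>; beyond \<open>T\<close> less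
    than \<open>h * e / 4\<close> is left to lose.\<close>
  define h where "h = e / (4 * m')"
  have h: "h > 0" using e m' by (simp add: h_def)
  have drop: "Y v \<le> Y u - (v - u) * (F u - m' * (v - u))" if "0 \<le> u" "u < v" for u v
  proof -
    have "\<exists>z>u. z < v \<and> Y v - Y u = (v - u) * Y' z"
      using that by (intro MVT2 deriv) auto
    then obtain z where z: "u < z" "z < v" "Y v - Y u = (v - u) * Y' z" by blast
    have "F u - F z \<le> m * (z - u)" using lip[of u z] z by auto
    also have "\<dots> \<le> m' * (v - u)" using z m' that by (intro mult_mono) auto
    finally have "Y' z \<le> - (F u - m' * (v - u))" using le[of z] z that by auto
    then have "(v - u) * Y' z \<le> (v - u) * - (F u - m' * (v - u))"
      using that by (intro mult_left_mono) auto
    then show ?thesis using z by (simp add: algebra_simps)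
  qed
  have anti: "Y v \<le> Y u" if "0 \<le> u" "u \<le> v" for u v
  proof (rule DERIV_nonpos_imp_nonincreasing[OF that(2)])
    fix x assume "u \<le> x"
    then have "x \<ge> 0" using that by simp
    then show "\<exists>y. (Y has_real_derivative y) (at x) \<and> y \<le> 0"
      using deriv[of x] le[of x] F0[of x] by (intro exI[of _ "Y' x"]) auto
  qed
  define I where "I = Inf (Y ` {0..})"
  have bb: "bdd_below (Y ` {0..})" using bdd by (auto intro!: bdd_belowI)
  have Ile: "I \<le> Y t" if "t \<ge> 0" for t
    unfolding I_def using bb that by (intro cInf_lower) auto
  have "\<exists>y\<in>Y ` {0..}. y < I + h * e / 4"
    unfolding I_def using bb h e by (intro cInf_lessD) auto
  then obtain T where T: "T \<ge> 0" "Y T < I + h * e / 4" by auto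
  have "dist (F t) 0 < e" if t: "t \<ge> T" for t
  proof (rule ccontr)
    assume "\<not> ?thesis"
    then have Ft: "F t \<ge> e" using F0[of t] by (simp add: dist_real_def)
    have "I \<le> Y (t + h)" using Ile T t h by auto
    also have "\<dots> \<le> Y t - h * (F t - m' * h)" using drop[of t "t + h"] T t h by simp
    also have "\<dots> \<le> Y t - h * (e - m' * h)" using Ft h by (intro diff_left_mono mult_left_mono) auto
    also have "\<dots> = Y t - h * (3 * e / 4)" using m' by (simp add: h_def field_simps)
    also have "\<dots> < I + h * e / 4 - h * (3 * e / 4)" using anti[of T t] T t by linarith
    finally have "h * e < 0" by (simp add: algebra_simps)
    then show False using h e by (auto simp: mult_less_0_iff)
  qed
  then show "\<forall>\<^sub>F t in at_top. dist (F t) 0 < e"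
    using eventually_at_top_linorder by blast
qed

lemma monotone_bounded_limit_at_top:
  fixes Y :: "real \<Rightarrow> real"
  assumes anti: "\<And>u v. \<lbrakk>0 \<le> u; u \<le> v\<rbrakk> \<Longrightarrow> Y v \<le> Y u"
    and bdd: "\<And>t. t \<ge> 0 \<Longrightarrow> c \<le> Y t"
  shows "\<exists>l. (Y \<longlongrightarrow> l) at_top"
proof -
  define I where "I = Inf (Y ` {0..})"
  have bb: "bdd_below (Y ` {0..})" using bdd by (auto intro!: bdd_belowI)
  have Ile: "I \<le> Y t" if "t \<ge> 0" for t
    unfolding I_def using bb that by (intro cInf_lower) auto
  have "(Y \<longlongrightarrow> I) at_top"
  proof (rule decreasing_tendsto)
    show "\<forall>\<^sub>F t in at_top. I \<le> Y t"
      using eventually_ge_at_top[of 0] by eventually_elim (rule Ile)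
    fix x assume "I < x"
    then have "\<exists>y\<in>Y ` {0..}. y < x"
      unfolding I_def using bb by (intro cInf_lessD) auto
    then obtain T where T: "T \<ge> 0" "Y T < x" by auto
    show "\<forall>\<^sub>F t in at_top. Y t < x"
      using eventually_ge_at_top[of T]
    proof eventually_elim
      case (elim t)
      then show ?case using anti[of T t] T by auto
    qed
  qed
  then show ?thesis by blast
qed

text \<open>If there are arbitrarily small positive elements, their multiples are dense. Otherwise
  distinct elements differ by at least some \<open>e\<close>, so the infimum of the positive ones is
  attained; the remainder after division by this least element \<open>g\<close> lies in
  \<open>S\<close> and below \<open>g\<close>, hence vanishes.\<close>

lemma real_subgroup_cases:
  fixes S :: "real set"
  assumes add: "\<And>x y. \<lbrakk>x \<in> S; y \<in> S\<rbrakk> \<Longrightarrow> x + y \<in> S"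
    and neg: "\<And>x. x \<in> S \<Longrightarrow> - x \<in> S"
    and nontrivial: "x0 \<in> S" "x0 \<noteq> 0"
  obtains (dense) "\<And>y e. e > 0 \<Longrightarrow> \<exists>x\<in>S. \<bar>x - y\<bar> < e"
  | (cyclic) g where "g > 0" "g \<in> S" "\<And>x. x \<in> S \<Longrightarrow> \<exists>k::int. x = g * k"
proof -
  have zero: "0 \<in> S" using add[OF nontrivial(1) neg[OF nontrivial(1)]] by simp
  have mulnat: "real n * x \<in> S" if "x \<in> S" for n x
    by (induction n) (use zero add that in \<open>auto simp: algebra_simps\<close>)
  have mul: "of_int k * x \<in> S" if "x \<in> S" for k :: int and x
  proof (cases "k \<ge> 0")
    case True then show ?thesis using mulnat[OF that, of "nat k"] by simp
  next
    case False then show ?thesis using neg[OF mulnat[OF that, of "nat (- k)"]] by simp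
  qed
  show thesis
  proof (cases "\<forall>e>0. \<exists>x\<in>S. 0 < x \<and> x < e")
    case True
    have "\<exists>x\<in>S. \<bar>x - y\<bar> < e" if "e > 0" for e y
    proof -
      obtain x where x: "x \<in> S" "0 < x" "x < e" using True \<open>e > 0\<close> by blast
      have "\<bar>of_int \<lfloor>y / x\<rfloor> * x - y\<bar> < e"
      proof -
        have "of_int \<lfloor>y / x\<rfloor> * x \<le> y" "y < (of_int \<lfloor>y / x\<rfloor> + 1) * x"
          using floor_divide_lower[OF x(2), of y] floor_divide_upper[OF x(2), of y] by auto
        then show ?thesis using x by (auto simp: algebra_simps)
      qed
      then show ?thesis using mul[OF x(1)] by blast
    qed
    then show thesis by (rule dense)
  next
    case False
    then obtain e where e: "e > 0" "\<And>x. \<lbrakk>x \<in> S; 0 < x\<rbrakk> \<Longrightarrow> e \<le> x" by force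
    define Q where "Q = {x\<in>S. 0 < x}"
    have ne: "Q \<noteq> {}"
      using nontrivial neg[OF nontrivial(1)] by (cases "x0 > 0") (auto simp: Q_def intro: exI[of _ "-x0"])
    have bb: "bdd_below Q" by (auto simp: Q_def intro!: bdd_belowI[of _ 0])
    have "\<exists>y\<in>Q. y < Inf Q + e" using ne bb e by (intro cInf_lessD) auto
    then obtain g where g: "g \<in> Q" "g < Inf Q + e" by auto
    have gpos: "g > 0" "g \<in> S" using g by (auto simp: Q_def)
    have least: "g \<le> y" if y: "y \<in> Q" for y
    proof (rule ccontr)
      assume "\<not> ?thesis"
      then have "g - y \<in> Q" using add[OF gpos(2) neg[of y]] y by (auto simp: Q_def)
      then have "e \<le> g - y" using e(2) by (auto simp: Q_def)
      moreover have "Inf Q \<le> y" using bb y by (intro cInf_lower)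
      ultimately show False using g by auto
    qed
    have "\<exists>k::int. x = g * k" if x: "x \<in> S" for x
    proof -
      define r where "r = x - of_int \<lfloor>x / g\<rfloor> * g"
      have "r \<in> S" using add[OF x neg[OF mul[OF gpos(2), of "\<lfloor>x / g\<rfloor>"]]] by (simp add: r_def)
      moreover have "0 \<le> r" "r < g"
        using floor_divide_lower[OF gpos(1), of x] floor_divide_upper[OF gpos(1), of x]
        by (auto simp: r_def algebra_simps)
      ultimately have "r = 0" using least[of r] by (force simp: Q_def)
      then show ?thesis by (intro exI[of _ "\<lfloor>x / g\<rfloor>"]) (simp add: r_def mult.commute)
    qed
    then show thesis using gpos cyclic by blast
  qed
qed

text \<open>\<open>D\<close> is the law of a nonnegative step. Boundedness and the Lipschitz
  condition are required on the whole line, since \<open>K (t - x)\<close> looks arbitrarily far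
  back, but the equation only for t \<ge> 0. The rate 1/2 is that of \<open>sqrt x / x\<close> at
  \<open>x = exp t\<close>.\<close>

locale renewal = prob_space D for D :: "real measure" +
  fixes K :: "real \<Rightarrow> real" and C l B :: real
  assumes sets_D[measurable_cong, simp]: "sets D = sets borel"
    and nonneg: "AE x in D. x \<ge> 0"
    and integrable_id[simp]: "integrable D (\<lambda>x. x)"
    and mean_pos: "(\<integral>x. x \<partial>D) > 0"
    and K_bound: "\<And>t. \<bar>K t\<bar> \<le> C"
    and K_lip: "\<And>t u. \<bar>K t - K u\<bar> \<le> l * \<bar>t - u\<bar>"
    and K_eq: "\<And>t. t \<ge> 0 \<Longrightarrow> \<bar>K t - (\<integral>x. K (t - x) \<partial>D)\<bar> \<le> B * exp (- t / 2)"
begin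

lemma space_D[simp]: "space D = UNIV"
  using sets_eq_imp_space_eq[OF sets_D] by simp

lemma prob_UNIV[simp]: "prob UNIV = 1"
  using prob_space by simp

lemma C_nonneg: "C \<ge> 0" using K_bound[of 0] by linarith

lemma l_nonneg: "l \<ge> 0" using K_lip[of 0 1] by simp

lemma B_nonneg: "B \<ge> 0" using K_eq[of 0] by simp

lemma K_cont: "continuous_on S K"
proof (rule continuous_on_subset[of UNIV])
  have "l-lipschitz_on UNIV K"
    using K_lip l_nonneg by (auto simp: lipschitz_on_def dist_real_def)
  then show "continuous_on UNIV K" by (rule lipschitz_on_continuous_on)
qed simp

lemma K_meas[measurable]: "K \<in> borel_measurable borel"
  by (intro borel_measurable_continuous_onI K_cont)

lemma integrable_bounded_comp:
  assumes [measurable]: "f \<in> borel_measurable borel" and "\<And>t. \<bar>f t\<bar> \<le> (A::real)"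
  shows "integrable D f"
  using assms by (intro integrable_const_bound[of _ A]) auto

lemma antiderivative_increment_bound:
  fixes F f :: "real \<Rightarrow> real"
  assumes "\<And>t. (F has_real_derivative f t) (at t)" "\<And>t. \<bar>f t\<bar> \<le> A"
  shows "\<bar>F t - F u\<bar> \<le> A * \<bar>t - u\<bar>"
  using field_differentiable_bound[of UNIV F f A t u] assms by (auto simp: has_field_derivative_at_within)

text \<open>The function differentiated here is the mean integral of \<open>f\<close> over
  [t - x, t]. The integrand is at most \<open>A * x\<close>, uniformly in \<open>t\<close>, so the
  first moment bounds it; the difference quotients of \<open>F\<close> are bounded by
  \<open>A\<close>, so dominated convergence gives the derivative.\<close>

lemma
  fixes F f :: "real \<Rightarrow> real"
  assumes dF: "\<And>t. (F has_real_derivative f t) (at t)" and fA: "\<And>t. \<bar>f t\<bar> \<le> A"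
    and cont: "continuous_on UNIV f"
  shows increment_integrable: "integrable D (\<lambda>x. F t - F (t - x))"
    and increment_deriv: "((\<lambda>t. \<integral>x. F t - F (t - x) \<partial>D) has_real_derivative
        f t - (\<integral>x. f (t - x) \<partial>D)) (at t)"
    and increment_bound: "\<bar>\<integral>x. F t - F (t - x) \<partial>D\<bar> \<le> A * (\<integral>x. x \<partial>D)"
proof -
  have [measurable]: "f \<in> borel_measurable borel" by (intro borel_measurable_continuous_onI cont)
  have "continuous_on UNIV F" using dF by (meson DERIV_isCont continuous_at_imp_continuous_on)
  then have [measurable]: "F \<in> borel_measurable borel" by (intro borel_measurable_continuous_onI)
  have bnd: "\<bar>F t - F u\<bar> \<le> A * \<bar>t - u\<bar>" for t u
    by (rule antiderivative_increment_bound[OF dF fA])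
  have int: "integrable D (\<lambda>x. F t - F (t - x))" for t
  proof (rule Bochner_Integration.integrable_bound[of D "\<lambda>x. A * x"])
    show "AE x in D. norm (F t - F (t - x)) \<le> norm (A * x)"
      using nonneg
    proof eventually_elim
      case (elim x)
      then show ?case using bnd[of t "t - x"] fA[of 0] by (auto simp: abs_mult)
    qed
  qed auto
  then show "integrable D (\<lambda>x. F t - F (t - x))" .
  have A0: "A \<ge> 0" using fA[of 0] by linarith
  show "\<bar>\<integral>x. F t - F (t - x) \<partial>D\<bar> \<le> A * (\<integral>x. x \<partial>D)"
  proof -
    have "\<bar>\<integral>x. F t - F (t - x) \<partial>D\<bar> \<le> (\<integral>x. A * x \<partial>D)"
    proof (rule integral_abs_bound[THEN order.trans], rule integral_mono_AE)
      show "AE x in D. \<bar>F t - F (t - x)\<bar> \<le> A * x"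
        using nonneg
      proof eventually_elim
        case (elim x)
        then show ?case using bnd[of t "t - x"] by auto
      qed
    qed (use int in auto)
    then show ?thesis by simp
  qed
  have intf: "integrable D (\<lambda>x. f (t - x))" for t
    using fA by (intro integrable_bounded_comp[of _ A]) auto
  show "((\<lambda>t. \<integral>x. F t - F (t - x) \<partial>D) has_real_derivative f t - (\<integral>x. f (t - x) \<partial>D)) (at t)"
    unfolding DERIV_def tendsto_at_iff_sequentially
  proof (intro allI impI)
    fix X :: "nat \<Rightarrow> real"
    assume X0: "\<forall>i. X i \<in> UNIV - {0}" and X: "X \<longlonglongrightarrow> 0"
    define q where "q i x = (F (t + X i) - F t) / X i - (F (t - x + X i) - F (t - x)) / X i" for i x
    have quot: "(\<lambda>i. (F (u + X i) - F u) / X i) \<longlonglongrightarrow> f u" for u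
      using dF[of u, unfolded DERIV_def tendsto_at_iff_sequentially] X0 X by (auto simp: o_def)
    have "(\<lambda>i. \<integral>x. q i x \<partial>D) \<longlonglongrightarrow> (\<integral>x. f t - f (t - x) \<partial>D)"
    proof (rule integral_dominated_convergence[where w = "\<lambda>_. 2 * A"])
      show "AE x in D. (\<lambda>i. q i x) \<longlonglongrightarrow> f t - f (t - x)"
        unfolding q_def by (intro AE_I2 tendsto_diff quot)
      have "\<bar>(F (u + X i) - F u) / X i\<bar> \<le> A" for u i
        using bnd[of "u + X i" u] X0 by (auto simp: field_simps abs_divide)
      then show "AE x in D. norm (q i x) \<le> 2 * A" for i
        unfolding q_def real_norm_def mult_2
        by (intro AE_I2 order.trans[OF abs_triangle_ineq4] add_mono)
    qed (auto simp: q_def)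
    also have "(\<integral>x. f t - f (t - x) \<partial>D) = f t - (\<integral>x. f (t - x) \<partial>D)"
      using intf by (simp add: prob_space)
    also have "(\<lambda>i. \<integral>x. q i x \<partial>D) =
        (\<lambda>h. ((\<integral>x. F (t + h) - F (t + h - x) \<partial>D) - (\<integral>x. F t - F (t - x) \<partial>D)) / h) \<circ> X"
    proof
      fix i
      have "((\<integral>x. F (t + X i) - F (t + X i - x) \<partial>D) - (\<integral>x. F t - F (t - x) \<partial>D)) / X i
        = (\<integral>x. ((F (t + X i) - F (t + X i - x)) - (F t - F (t - x))) / X i \<partial>D)"
        using int by simp
      also have "\<dots> = (\<integral>x. q i x \<partial>D)"
        by (intro Bochner_Integration.integral_cong) (auto simp: q_def diff_divide_distrib add_divide_distrib algebra_simps)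
      finally show "(\<integral>x. q i x \<partial>D) = ((\<lambda>h. ((\<integral>x. F (t + h) - F (t + h - x) \<partial>D) - (\<integral>x. F t - F (t - x) \<partial>D)) / h) \<circ> X) i"
        by simp
    qed
    finally show "((\<lambda>h. ((\<integral>x. F (t + h) - F (t + h - x) \<partial>D) - (\<integral>x. F t - F (t - x) \<partial>D)) / h) \<circ> X) \<longlonglongrightarrow> f t - (\<integral>x. f (t - x) \<partial>D)" .
  qed
qed

lemma antiderivative_exists:
  assumes "continuous_on UNIV (f :: real \<Rightarrow> real)"
  shows "\<exists>F. \<forall>t. (F has_real_derivative f t) (at t)"
  using einterval_antiderivative[of "-\<infinity>" "\<infinity>" f] assms
  by (auto simp: continuous_on_eq_continuous_at has_real_derivative_iff_has_vector_derivative)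

text \<open>
  \<open>E (\<integral> K\<^sup>2 over [t - X, t])\<close> is bounded, and its derivative \<open>(K t)\<^sup>2 - E ((K (t - X))\<^sup>2)\<close> is, up to
  an exponentially small term, \<open>- msd t\<close>.
\<close>

definition msd :: "real \<Rightarrow> real" where
  "msd t = (\<integral>x. (K (t - x) - K t)\<^sup>2 \<partial>D)"

lemma K_diff_bound: "\<bar>K t - K u\<bar> \<le> 2 * C"
  using K_bound[of t] K_bound[of u] by linarith

lemma msd_integrable: "integrable D (\<lambda>x. (K (t - x) - K u)\<^sup>2)"
proof (rule integrable_bounded_comp[of _ "(2 * C)\<^sup>2"])
  show "\<bar>(K (t - x) - K u)\<^sup>2\<bar> \<le> (2 * C)\<^sup>2" for x
    using power_mono[OF K_diff_bound[of "t - x" u], of 2] by simp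
qed auto

lemma msd_tendsto_0: "(msd \<longlongrightarrow> 0) at_top"
proof -
  have "continuous_on UNIV (\<lambda>t. (K t)\<^sup>2)" by (intro continuous_intros K_cont)
  then obtain F where F: "\<And>t. (F has_real_derivative (K t)\<^sup>2) (at t)"
    using antiderivative_exists by blast
  have K2: "\<bar>(K t)\<^sup>2\<bar> \<le> C\<^sup>2" for t
    using power_mono[OF K_bound[of t], of 2] by simp
  define J where "J t = (\<integral>x. F t - F (t - x) \<partial>D)" for t
  have J': "(J has_real_derivative (K t)\<^sup>2 - (\<integral>x. (K (t - x))\<^sup>2 \<partial>D)) (at t)" for t
    unfolding J_def using increment_deriv[OF F K2] by (auto intro!: continuous_intros K_cont)
  have Jb: "\<bar>J t\<bar> \<le> C\<^sup>2 * (\<integral>x. x \<partial>D)" for t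
    unfolding J_def using increment_bound[OF F K2] by (auto intro!: continuous_intros K_cont)
  define \<epsilon> where "\<epsilon> t = K t - (\<integral>x. K (t - x) \<partial>D)" for t
  have intK: "integrable D (\<lambda>x. K (t - x))" for t
    using K_bound by (intro integrable_bounded_comp[of _ C]) auto
  have intK2: "integrable D (\<lambda>x. (K (t - x))\<^sup>2)" for t
    using K2 by (intro integrable_bounded_comp[of _ "C\<^sup>2"]) auto
  have msd_eq: "msd t = (\<integral>x. (K (t - x))\<^sup>2 \<partial>D) - (K t)\<^sup>2 + 2 * K t * \<epsilon> t" for t
  proof -
    have "msd t = (\<integral>x. (K (t - x))\<^sup>2 - 2 * K t * K (t - x) + (K t)\<^sup>2 \<partial>D)"
      unfolding msd_def by (intro Bochner_Integration.integral_cong) (auto simp: power2_eq_square algebra_simps)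
    also have "\<dots> = (\<integral>x. (K (t - x))\<^sup>2 \<partial>D) - 2 * K t * (\<integral>x. K (t - x) \<partial>D) + (K t)\<^sup>2"
      using intK intK2 prob_space by simp
    finally show ?thesis by (simp add: \<epsilon>_def power2_eq_square algebra_simps)
  qed
  have msd0: "msd t \<ge> 0" for t unfolding msd_def by simp
  have msd_lip: "\<bar>msd t - msd u\<bar> \<le> (8 * C * l) * \<bar>t - u\<bar>" for t u
  proof -
    have "msd t - msd u = (\<integral>x. (K (t - x) - K t)\<^sup>2 - (K (u - x) - K u)\<^sup>2 \<partial>D)"
      unfolding msd_def using msd_integrable by simp
    also have "\<bar>\<dots>\<bar> \<le> (\<integral>x. (8 * C * l) * \<bar>t - u\<bar> \<partial>D)"
    proof (rule integral_abs_bound[THEN order.trans], rule integral_mono)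
      fix x
      define p q where "p = K (t - x) - K t" and "q = K (u - x) - K u"
      have "\<bar>p\<^sup>2 - q\<^sup>2\<bar> = \<bar>p + q\<bar> * \<bar>p - q\<bar>"
        by (simp add: abs_mult[symmetric] power2_eq_square algebra_simps)
      also have "\<dots> \<le> (4 * C) * (2 * l * \<bar>t - u\<bar>)"
      proof (intro mult_mono)
        show "\<bar>p + q\<bar> \<le> 4 * C"
          using K_diff_bound[of "t - x" t] K_diff_bound[of "u - x" u] by (simp add: p_def q_def)
        show "\<bar>p - q\<bar> \<le> 2 * l * \<bar>t - u\<bar>"
          using K_lip[of "t - x" "u - x"] K_lip[of t u] by (simp add: p_def q_def)
      qed (use C_nonneg in auto)
      finally show "\<bar>(K (t - x) - K t)\<^sup>2 - (K (u - x) - K u)\<^sup>2\<bar> \<le> (8 * C * l) * \<bar>t - u\<bar>"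
        by (simp add: p_def q_def)
    qed (use msd_integrable in auto)
    also have "\<dots> = (8 * C * l) * \<bar>t - u\<bar>" by (simp add: prob_space)
    finally show ?thesis .
  qed
  show ?thesis
  \<comment> \<open>The correction has derivative \<open>- 2 * C * B * exp (- t / 2)\<close>, which
    outweighs the term \<open>2 * K t * \<epsilon> t\<close> left over in the derivative of
    \<open>J\<close>.\<close>
  proof (rule Barbalat[where Y = "\<lambda>t. J t + 4 * C * B * exp (- t / 2)" and m = "8 * C * l"
        and c = "- (C\<^sup>2 * (\<integral>x. x \<partial>D))"
        and Y' = "\<lambda>t. (K t)\<^sup>2 - (\<integral>x. (K (t - x))\<^sup>2 \<partial>D) + 4 * C * B * (exp (- t / 2) * (- 1 / 2))"])
    fix t :: real
    show "((\<lambda>t. J t + 4 * C * B * exp (- t / 2)) has_real_derivative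
        (K t)\<^sup>2 - (\<integral>x. (K (t - x))\<^sup>2 \<partial>D) + 4 * C * B * (exp (- t / 2) * (- 1 / 2))) (at t)"
      by (rule derivative_eq_intros J' refl | simp)+
    assume t: "t \<ge> 0"
    have "\<bar>K t * \<epsilon> t\<bar> \<le> C * (B * exp (- t / 2))"
      unfolding abs_mult using K_bound K_eq[OF t] C_nonneg unfolding \<epsilon>_def by (intro mult_mono) auto
    then have "2 * (K t * \<epsilon> t) \<le> 2 * (C * (B * exp (- t / 2)))" by linarith
    then show "(K t)\<^sup>2 - (\<integral>x. (K (t - x))\<^sup>2 \<partial>D) + 4 * C * B * (exp (- t / 2) * (- 1 / 2)) \<le> - msd t"
      unfolding msd_eq by (simp only: mult.assoc)
    show "- (C\<^sup>2 * (\<integral>x. x \<partial>D)) \<le> J t + 4 * C * B * exp (- t / 2)"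
    proof -
      have "0 \<le> 4 * C * B * exp (- t / 2)" using C_nonneg B_nonneg by simp
      then show ?thesis using Jb[of t] by linarith
    qed
  qed (rule msd0 msd_lip)+
qed

section \<open>Support of the step law and asymptotic periods\<close>

definition supp :: "real set" where
  "supp = {y. \<forall>\<delta>>0. measure D {y-\<delta><..<y+\<delta>} > 0}"

definition asymp_periods :: "real set" where
  "asymp_periods = {y. ((\<lambda>t. K (t - y) - K t) \<longlongrightarrow> 0) at_top}"

text \<open>A shift difference of size \<open>e\<close> at \<open>y\<close> persists, by the
  Lipschitz bound, at size \<open>e / 2\<close> for all steps within \<open>\<delta>\<close> of
  \<open>y\<close>. These steps have positive mass \<open>p\<close>, so \<open>msd t\<close> would
  be at least \<open>p * (e / 2)\<^sup>2\<close>.\<close>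

lemma supp_asymp_period:
  assumes y: "y \<in> supp"
  shows "y \<in> asymp_periods"
  unfolding asymp_periods_def mem_Collect_eq
proof (rule tendstoI)
  fix e :: real assume e: "e > 0"
  \<comment> \<open>Using \<open>l + 1\<close> instead of \<open>l\<close> covers the case of a
    constant \<open>K\<close>.\<close>
  define \<delta> where "\<delta> = e / (2 * (l + 1))"
  have d: "\<delta> > 0" using e l_nonneg by (simp add: \<delta>_def)
  define I where "I = {y-\<delta><..<y+\<delta>}"
  define p where "p = measure D I"
  have p: "p > 0" using y d by (auto simp: supp_def p_def I_def)
  have "\<forall>\<^sub>F t in at_top. msd t < p * (e / 2)\<^sup>2"
    using msd_tendsto_0 p e by (intro order_tendstoD(2)) auto
  then show "\<forall>\<^sub>F t in at_top. dist (K (t - y) - K t) 0 < e"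
  proof eventually_elim
    case (elim t)
    show ?case
    proof (rule ccontr)
      assume "\<not> ?thesis"
      then have ge: "\<bar>K (t - y) - K t\<bar> \<ge> e" by (simp add: dist_real_def)
      have "(e / 2)\<^sup>2 * indicator I x \<le> (K (t - x) - K t)\<^sup>2" for x
      proof (cases "x \<in> I")
        case True
        then have "\<bar>(t - y) - (t - x)\<bar> \<le> \<delta>" by (auto simp: I_def)
        then have "\<bar>K (t - y) - K (t - x)\<bar> \<le> l * \<delta>"
          using K_lip[of "t - y" "t - x"] l_nonneg by (meson mult_left_mono order.trans)
        also have "l * \<delta> \<le> e / 2" using e l_nonneg by (simp add: \<delta>_def field_simps)
        finally have "e / 2 \<le> \<bar>K (t - x) - K t\<bar>" using ge by linarith
        then show ?thesis using e True power_mono[of "e/2" "\<bar>K (t - x) - K t\<bar>" 2] by auto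
      qed auto
      then have "(\<integral>x. (e / 2)\<^sup>2 * indicator I x \<partial>D) \<le> msd t"
        unfolding msd_def by (intro integral_mono msd_integrable integrable_mult_right)
          (auto simp: I_def intro!: integrable_const_bound[of _ 1])
      then show False using elim by (simp add: p_def I_def mult.commute)
    qed
  qed
qed

text \<open>The complement of the support is covered by the open null intervals with rational
  endpoints, of which there are countably many.\<close>

lemma AE_supp: "AE x in D. x \<in> supp"
proof -
  define Z where "Z = {(q, r) :: real \<times> real | q r. q \<in> \<rat> \<and> r \<in> \<rat> \<and> measure D {q<..<r} = 0}"
  have "countable (\<rat> \<times> \<rat> :: (real \<times> real) set)" by (intro countable_SIGMA countable_rat)
  then have cZ: "countable Z" by (rule countable_subset[rotated]) (auto simp: Z_def)
  have "AE x in D. x \<notin> {fst z<..<snd z}" if "z \<in> Z" for z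
  proof -
    have "{fst z<..<snd z} \<in> null_sets D"
      using that by (auto simp: Z_def null_sets_def emeasure_eq_measure)
    then show ?thesis by (rule AE_not_in)
  qed
  then have "AE x in D. \<forall>z\<in>Z. x \<notin> {fst z<..<snd z}"
    using cZ by (simp add: AE_ball_countable)
  then show ?thesis
  proof eventually_elim
    case (elim x)
    show ?case unfolding supp_def
    proof (intro CollectI allI impI, rule ccontr)
      fix \<delta> :: real assume d: "\<delta> > 0" and "\<not> 0 < measure D {x-\<delta><..<x+\<delta>}"
      then have z: "measure D {x-\<delta><..<x+\<delta>} = 0" using measure_nonneg[of D "{x-\<delta><..<x+\<delta>}"] by linarith
      obtain q where q: "q \<in> \<rat>" "x - \<delta> < q" "q < x" using Rats_dense_in_real[of "x-\<delta>" x] d by auto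
      obtain r where r: "r \<in> \<rat>" "x < r" "r < x + \<delta>" using Rats_dense_in_real[of x "x+\<delta>"] d by auto
      have "measure D {q<..<r} \<le> measure D {x-\<delta><..<x+\<delta>}"
        using q r by (intro finite_measure_mono) auto
      then have "measure D {q<..<r} = 0" using z measure_nonneg[of D "{q<..<r}"] by linarith
      then have "(q, r) \<in> Z" using q r by (auto simp: Z_def)
      then show False using elim q r by auto
    qed
  qed
qed

text \<open>A point off the lattice has positive distance \<open>\<delta>\<close> to its two
  neighbouring lattice points, so an interval around it carries no mass.\<close>

lemma supp_lattice:
  fixes a :: real
  assumes "AE x in D. \<exists>k::int. x = a * k" "y \<in> supp" "a > 0"
  shows "\<exists>k::int. y = a * k"
proof (rule ccontr)
  assume no: "\<not> ?thesis"
  define k where "k = \<lfloor>y / a\<rfloor>"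
  have k: "a * k < y" "y < a * (k + 1)"
  proof -
    have "of_int k \<le> y / a" "y / a < of_int k + 1" by (auto simp: k_def)
    then have "a * k \<le> y" "y < a * (k + 1)" using assms(3) by (auto simp: field_simps)
    then show "a * k < y" "y < a * (k + 1)" using no by (metis order.not_eq_order_implies_strict)+
  qed
  define \<delta> where "\<delta> = min (y - a * k) (a * (k + 1) - y)"
  have d: "\<delta> > 0" using k by (auto simp: \<delta>_def)
  have "AE x in D. x \<notin> {y-\<delta><..<y+\<delta>}"
    using assms(1)
  proof eventually_elim
    case (elim x)
    then obtain j :: int where j: "x = a * j" by blast
    show ?case
    proof
      assume "x \<in> {y-\<delta><..<y+\<delta>}"
      then have "a * k < a * j" "a * j < a * (k + 1)" using j by (auto simp: \<delta>_def)
      then have "k < j" "real_of_int j < real_of_int (k + 1)" using assms(3) by auto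
      then show False by linarith
    qed
  qed
  then have "measure D {y-\<delta><..<y+\<delta>} = 0"
    by (subst (asm) AE_iff_measurable[OF _ refl])
      (auto simp: measure_def greaterThanLessThan_def greaterThan_def lessThan_def Int_def)
  then show False using assms(2) d by (force simp: supp_def)
qed

lemma asymp_periods_add:
  assumes "x \<in> asymp_periods" "y \<in> asymp_periods"
  shows "x + y \<in> asymp_periods"
proof -
  have x: "((\<lambda>t. K (t - x) - K t) \<longlongrightarrow> 0) at_top" and y: "((\<lambda>t. K (t - y) - K t) \<longlongrightarrow> 0) at_top"
    using assms by (auto simp: asymp_periods_def)
  have "filterlim (\<lambda>t. t - y) at_top at_top" for y :: real by real_asymp
  from filterlim_compose[OF x this]
  have "((\<lambda>t. (K (t - y - x) - K (t - y)) + (K (t - y) - K t)) \<longlongrightarrow> 0 + 0) at_top"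
    by (intro tendsto_add y)
  then show ?thesis by (simp add: asymp_periods_def algebra_simps)
qed

lemma asymp_periods_uminus:
  assumes "x \<in> asymp_periods"
  shows "- x \<in> asymp_periods"
proof -
  have x: "((\<lambda>t. K (t - x) - K t) \<longlongrightarrow> 0) at_top"
    using assms by (auto simp: asymp_periods_def)
  have "filterlim (\<lambda>t. t + x) at_top at_top" by real_asymp
  from tendsto_minus[OF filterlim_compose[OF x this]]
  show ?thesis by (simp add: asymp_periods_def)
qed

lemma asymp_periods_closed:
  assumes "\<And>e. e > 0 \<Longrightarrow> \<exists>x\<in>asymp_periods. \<bar>x - y\<bar> < e"
  shows "y \<in> asymp_periods"
  unfolding asymp_periods_def mem_Collect_eq
proof (rule tendstoI)
  fix e :: real assume e: "e > 0"
  define \<delta> where "\<delta> = e / (2 * (l + 1))"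
  have d: "\<delta> > 0" using e l_nonneg by (simp add: \<delta>_def)
  obtain x where x: "x \<in> asymp_periods" "\<bar>x - y\<bar> < \<delta>" using assms d by blast
  have "\<forall>\<^sub>F t in at_top. dist (K (t - x) - K t) 0 < e / 2"
    using tendstoD[of "\<lambda>t. K (t - x) - K t" 0 at_top "e/2"] x(1) e by (simp add: asymp_periods_def)
  then show "\<forall>\<^sub>F t in at_top. dist (K (t - y) - K t) 0 < e"
  proof eventually_elim
    case (elim t)
    have "\<bar>K (t - y) - K (t - x)\<bar> \<le> l * \<bar>(t - y) - (t - x)\<bar>" by (rule K_lip)
    also have "\<dots> \<le> l * \<delta>" using x l_nonneg by (intro mult_left_mono) auto
    also have "l * \<delta> \<le> e / 2" using e l_nonneg by (simp add: \<delta>_def field_simps)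
    finally show ?case using elim unfolding dist_real_def by linarith
  qed
qed

text \<open>The group is generated by the support instead of being taken as
  \<open>asymp_periods\<close>: a particular \<open>K\<close> can have more asymptotic periods than
  \<open>D\<close> prescribes (a constant has all of them), and the span of the lattice must be read
  off from \<open>D\<close>.\<close>

inductive_set supp_group :: "real set" where
  zero: "0 \<in> supp_group"
| add: "\<lbrakk>x \<in> supp_group; y \<in> supp\<rbrakk> \<Longrightarrow> x + y \<in> supp_group"
| diff: "\<lbrakk>x \<in> supp_group; y \<in> supp\<rbrakk> \<Longrightarrow> x - y \<in> supp_group"

lemma supp_subset_group: "y \<in> supp \<Longrightarrow> y \<in> supp_group"
  using supp_group.add[OF supp_group.zero] by simp

lemma supp_group_add: "\<lbrakk>x \<in> supp_group; y \<in> supp_group\<rbrakk> \<Longrightarrow> x + y \<in> supp_group"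
  by (rotate_tac, induction y rule: supp_group.induct)
    (auto simp: add.assoc[symmetric] add_diff_eq intro: supp_group.intros)

lemma supp_group_uminus: "x \<in> supp_group \<Longrightarrow> - x \<in> supp_group"
  by (induction x rule: supp_group.induct)
    (auto intro: supp_group.zero dest: supp_group.add supp_group.diff simp: algebra_simps)

lemma supp_group_asymp_period: "y \<in> supp_group \<Longrightarrow> y \<in> asymp_periods"
proof (induction y rule: supp_group.induct)
  case zero
  then show ?case by (simp add: asymp_periods_def)
next
  case (add x y)
  then show ?case using asymp_periods_add supp_asymp_period by blast
next
  case (diff x y)
  then show ?case using asymp_periods_add[of x "-y"] asymp_periods_uminus supp_asymp_period by simp
qed

lemma supp_group_nontrivial: "\<exists>x\<in>supp_group. x \<noteq> 0"
proof (rule ccontr)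
  assume "\<not> ?thesis"
  then have "x = 0" if "x \<in> supp" for x using that supp_subset_group by blast
  then have "AE x in D. x = 0" using AE_supp by auto
  then have "(\<integral>x. x \<partial>D) = (\<integral>x. 0 \<partial>D)" by (intro integral_cong_AE) auto
  then show False using mean_pos by simp
qed

section \<open>Convergence in the nonlattice and in the lattice case\<close>

text \<open>Asymptotic periods give convergence for each shift separately; finitely many grid points
  \<open>j * \<delta>\<close> suffice for a whole interval because the Lipschitz bound controls the
  shifts in between.\<close>

lemma uniform_asymp_period:
  assumes all: "\<And>y. y \<in> asymp_periods" and e: "e > 0" and x: "x \<ge> 0"
  shows "\<forall>\<^sub>F t in at_top. \<forall>y\<in>{0..x}. \<bar>K (t - y) - K t\<bar> < e"
proof -
  define \<delta> where "\<delta> = e / (2 * (l + 1))"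
  have d: "\<delta> > 0" using e l_nonneg by (simp add: \<delta>_def)
  have "\<forall>\<^sub>F t in at_top. \<forall>j\<in>{..nat \<lceil>x / \<delta>\<rceil>}. \<bar>K (t - j * \<delta>) - K t\<bar> < e / 2"
  proof (intro eventually_ball_finite ballI)
    fix j :: nat
    have "((\<lambda>t. K (t - j * \<delta>) - K t) \<longlongrightarrow> 0) at_top" using all[of "j * \<delta>"] by (simp add: asymp_periods_def)
    then show "\<forall>\<^sub>F t in at_top. \<bar>K (t - j * \<delta>) - K t\<bar> < e / 2"
      using tendstoD[of "\<lambda>t. K (t - j * \<delta>) - K t" 0 at_top "e/2"] e by (simp add: dist_real_def)
  qed auto
  then show ?thesis
  proof eventually_elim
    case (elim t)
    show ?case
    proof
      fix y assume y: "y \<in> {0..x}"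
      define j where "j = nat \<lfloor>y / \<delta>\<rfloor>"
      have f0: "\<lfloor>y / \<delta>\<rfloor> \<ge> 0" using y d by simp
      have "j \<le> nat \<lceil>x / \<delta>\<rceil>"
      proof -
        have "\<lfloor>y / \<delta>\<rfloor> \<le> \<lfloor>x / \<delta>\<rfloor>" using y d by (intro floor_mono divide_right_mono) auto
        also have "\<dots> \<le> \<lceil>x / \<delta>\<rceil>" by (rule floor_le_ceiling)
        finally show ?thesis by (simp add: j_def)
      qed
      then have 1: "\<bar>K (t - j * \<delta>) - K t\<bar> < e / 2" using elim by auto
      have "real j \<le> y / \<delta>" "y / \<delta> < real j + 1" using f0 by (auto simp: j_def)
      then have jj: "j * \<delta> \<le> y" "y < (j + 1) * \<delta>" using d by (auto simp: field_simps)
      have "\<bar>K (t - y) - K (t - j * \<delta>)\<bar> \<le> l * \<bar>(t - y) - (t - j * \<delta>)\<bar>" by (rule K_lip)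
      also have "\<dots> \<le> l * \<delta>" using jj l_nonneg by (intro mult_left_mono) (auto simp: algebra_simps)
      also have "l * \<delta> \<le> e / 2" using e l_nonneg by (simp add: \<delta>_def field_simps)
      finally show "\<bar>K (t - y) - K t\<bar> < e" using 1 by linarith
    qed
  qed
qed

text \<open>Two facts about the mean integral \<open>J\<close> are combined: \<open>J\<close> has a
  limit, and \<open>J t - \<mu> * K t\<close> tends to 0 because \<open>K\<close> is asymptotically
  constant on bounded windows. The second passes to the expectation by dominated convergence with
  the integrable bound \<open>2 * C * \<bar>x\<bar>\<close>.\<close>

lemma nonlattice_limit:
  assumes all: "\<And>y. y \<in> asymp_periods"
  shows "\<exists>c. (K \<longlongrightarrow> c) at_top"
proof -
  obtain F where F: "\<And>t. (F has_real_derivative K t) (at t)"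
    using antiderivative_exists[OF K_cont] by blast
  define \<mu> where "\<mu> = (\<integral>x. x \<partial>D)"
  define J where "J t = (\<integral>x. F t - F (t - x) \<partial>D)" for t
  have J': "(J has_real_derivative K t - (\<integral>x. K (t - x) \<partial>D)) (at t)" for t
    unfolding J_def by (rule increment_deriv[OF F K_bound K_cont])
  have Jb: "\<bar>J t\<bar> \<le> C * \<mu>" for t
    unfolding J_def \<mu>_def by (rule increment_bound[OF F K_bound K_cont])
  \<comment> \<open>The derivative \<open>- B * exp (- t / 2)\<close> of the added term absorbs the
    defect of the renewal equation, so \<open>Y\<close> is nonincreasing on t \<ge> 0.\<close>
  define Y where "Y t = J t + 2 * B * exp (- t / 2)" for t
  have Y': "(Y has_real_derivative K t - (\<integral>x. K (t - x) \<partial>D) + 2 * B * (exp (- t / 2) * (- 1 / 2))) (at t)" for t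
    unfolding Y_def by (rule derivative_eq_intros J' refl | simp)+
  have anti: "Y v \<le> Y u" if "0 \<le> u" "u \<le> v" for u v
  proof (rule DERIV_nonpos_imp_nonincreasing[OF that(2)])
    fix x assume "u \<le> x" "x \<le> v"
    then have "x \<ge> 0" using that by auto
    then show "\<exists>y. (Y has_real_derivative y) (at x) \<and> y \<le> 0"
      using Y'[of x] K_eq[of x] by (intro exI conjI[OF Y']) (auto simp: abs_le_iff)
  qed
  have "\<exists>c. (Y \<longlongrightarrow> c) at_top"
  proof (rule monotone_bounded_limit_at_top[OF anti])
    fix t :: real
    show "- (C * \<mu>) \<le> Y t"
    proof -
      have "0 \<le> 2 * B * exp (- t / 2)" using B_nonneg by simp
      then show ?thesis using Jb[of t] unfolding Y_def by linarith
    qed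
  qed
  then obtain c where c: "(Y \<longlongrightarrow> c) at_top" by blast
  have "((\<lambda>t. Y t - 2 * B * exp (- t / 2)) \<longlongrightarrow> c - 2 * B * 0) at_top"
    by (intro tendsto_intros c) real_asymp
  then have Jc: "(J \<longlongrightarrow> c) at_top" by (simp add: Y_def)
  have "((\<lambda>t. \<integral>x. F t - F (t - x) - x * K t \<partial>D) \<longlongrightarrow> (\<integral>x. 0 \<partial>D)) at_top"
  proof (rule integral_dominated_convergence_at_top[where w = "\<lambda>x. 2 * C * \<bar>x\<bar>"])
    have "continuous_on UNIV F" using F by (meson DERIV_isCont continuous_at_imp_continuous_on)
    then have [measurable]: "F \<in> borel_measurable borel" by (intro borel_measurable_continuous_onI)
    show "(\<lambda>x. F t - F (t - x) - x * K t) \<in> borel_measurable D" for t by simp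
    show "\<forall>\<^sub>F t in at_top. AE x in D. norm (F t - F (t - x) - x * K t) \<le> 2 * C * \<bar>x\<bar>"
    proof (intro always_eventually allI AE_I2)
      fix t x
      have "\<bar>F t - F (t - x)\<bar> \<le> C * \<bar>t - (t - x)\<bar>"
        by (rule antiderivative_increment_bound[OF F K_bound])
      moreover have "\<bar>x * K t\<bar> \<le> \<bar>x\<bar> * C" unfolding abs_mult using K_bound by (intro mult_left_mono) auto
      ultimately show "norm (F t - F (t - x) - x * K t) \<le> 2 * C * \<bar>x\<bar>" by (simp add: algebra_simps)
    qed
    show "AE x in D. ((\<lambda>t. F t - F (t - x) - x * K t) \<longlongrightarrow> 0) at_top"
      using nonneg
    proof eventually_elim
      case (elim x)
      show ?case
      proof (rule tendstoI)
        fix e :: real assume e: "e > 0"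
        have "\<forall>\<^sub>F t in at_top. \<forall>y\<in>{0..x}. \<bar>K (t - y) - K t\<bar> < e / (x + 1)"
          using e elim by (intro uniform_asymp_period all) auto
        then show "\<forall>\<^sub>F t in at_top. dist (F t - F (t - x) - x * K t) 0 < e"
        proof eventually_elim
          case e2: (elim t)
          show ?case
          proof (cases "x = 0")
            case False
            then have x: "x > 0" using elim by auto
            then obtain z where z: "t - x < z" "z < t" "F t - F (t - x) = (t - (t - x)) * K z"
              using MVT2[of "t - x" t F K] F by auto
            have "\<bar>K (t - (t - z)) - K t\<bar> < e / (x + 1)" using e2 z by (intro bspec[OF e2]) auto
            then have "x * \<bar>K z - K t\<bar> \<le> x * (e / (x + 1))" using x by (intro mult_left_mono) auto
            also have "\<dots> < e" using x e by (simp add: field_simps)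
            finally show ?thesis using z x by (simp add: dist_real_def abs_mult right_diff_distrib[symmetric])
          qed (use e in simp)
        qed
      qed
    qed
  qed (auto intro!: integrable_mult_right)
  moreover have "(\<integral>x. F t - F (t - x) - x * K t \<partial>D) = J t - \<mu> * K t" for t
    unfolding J_def \<mu>_def using increment_integrable[OF F K_bound K_cont]
    by (subst Bochner_Integration.integral_diff) (auto intro!: integrable_mult_left)
  ultimately have "((\<lambda>t. J t - \<mu> * K t) \<longlongrightarrow> 0) at_top" by simp
  from tendsto_diff[OF Jc this] have "((\<lambda>t. \<mu> * K t) \<longlongrightarrow> c) at_top" by simp
  then have "((\<lambda>t. \<mu> * K t / \<mu>) \<longlongrightarrow> c / \<mu>) at_top"
    using mean_pos by (intro tendsto_divide) (auto simp: \<mu>_def)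
  then show ?thesis using mean_pos by (auto simp: \<mu>_def)
qed

text \<open>\<open>Q\<close> sums \<open>K\<close> over the points of t + g Z in (t - X, t] instead
  of integrating. Convergence along each progression would not yet control \<open>K - \<phi>\<close>
  for real t; the geometric tail bound, with a constant that does not depend on the starting point,
  does.\<close>

lemma lattice_limit:
  assumes g: "g > 0" "g \<in> asymp_periods" and lattice: "AE x in D. \<exists>k::int. x = g * k"
  shows "\<exists>\<phi>. continuous_on UNIV \<phi> \<and> (\<forall>t. \<phi> (t + g) = \<phi> t) \<and> ((\<lambda>t. K t - \<phi> t) \<longlongrightarrow> 0) at_top"
proof -
  define \<mu> where "\<mu> = (\<integral>x. x \<partial>D)"
  have mu: "\<mu> > 0" using mean_pos by (simp add: \<mu>_def)
  \<comment> \<open>The number of lattice steps in \<open>x\<close>; the floor defines it measurably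
    for all real \<open>x\<close>, and it is exact almost surely.\<close>
  define n where "n x = nat \<lfloor>x / g\<rfloor>" for x
  have n_meas[measurable]: "n \<in> measurable borel (count_space UNIV)" unfolding n_def by measurable
  have n_eq: "AE x in D. g * real (n x) = x"
    using lattice nonneg
  proof eventually_elim
    case (elim x)
    then obtain k :: int where k: "x = g * k" by blast
    then have "k \<ge> 0" using elim g by (auto simp: zero_le_mult_iff)
    then show ?case using k g by (simp add: n_def)
  qed
  define h where "h t m = (\<Sum>j<m. K (t - real j * g))" for t m
  have h_meas[measurable]: "(\<lambda>x. h t (n x)) \<in> borel_measurable borel" for t
    by (rule measurable_compose[OF n_meas]) auto
  have n_real_meas[measurable]: "(\<lambda>x. real (n x)) \<in> borel_measurable borel"
    by (rule measurable_compose[OF n_meas]) auto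
  have hb: "\<bar>h t m\<bar> \<le> C * real m" for t m
  proof -
    have "\<bar>h t m\<bar> \<le> (\<Sum>j<m. \<bar>K (t - real j * g)\<bar>)" unfolding h_def by (rule sum_abs)
    also have "\<dots> \<le> real (card {..<m}) * C" using K_bound by (intro sum_bounded_above)
    finally show ?thesis by (simp add: mult.commute)
  qed
  have n_int: "integrable D (\<lambda>x. real (n x))"
  proof (rule Bochner_Integration.integrable_bound[of D "\<lambda>x. x / g"])
    show "AE x in D. norm (real (n x)) \<le> norm (x / g)"
      using n_eq nonneg by eventually_elim (use g in \<open>auto simp: field_simps\<close>)
  qed auto
  have n_mean: "(\<integral>x. real (n x) \<partial>D) = \<mu> / g"
  proof -
    have "(\<integral>x. g * real (n x) \<partial>D) = \<mu>"
      unfolding \<mu>_def using n_eq by (intro integral_cong_AE) auto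
    then show ?thesis using g by (simp add: field_simps)
  qed
  have h_int: "integrable D (\<lambda>x. h t (n x))" for t
    by (rule Bochner_Integration.integrable_bound[of D "\<lambda>x. C * real (n x)"])
      (use n_int hb C_nonneg in \<open>auto\<close>)
  define Q where "Q t = (\<integral>x. h t (n x) \<partial>D)" for t
  have Q_diff: "\<bar>Q t - Q (t - g)\<bar> \<le> B * exp (- t / 2)" if "t \<ge> 0" for t
  proof -
    have tele: "h t m - h (t - g) m = K t - K (t - real m * g)" for m
      by (induction m) (auto simp: h_def algebra_simps)
    have intK: "integrable D (\<lambda>x. K (t - x))"
      using K_bound by (intro integrable_bounded_comp[of _ C]) auto
    have "Q t - Q (t - g) = (\<integral>x. h t (n x) - h (t - g) (n x) \<partial>D)"
      unfolding Q_def using h_int by simp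
    also have "\<dots> = (\<integral>x. K t - K (t - x) \<partial>D)"
    proof (rule integral_cong_AE)
      show "AE x in D. h t (n x) - h (t - g) (n x) = K t - K (t - x)"
        using n_eq by eventually_elim (simp add: tele mult.commute)
    qed auto
    also have "\<dots> = K t - (\<integral>x. K (t - x) \<partial>D)" using intK by simp
    finally show ?thesis using K_eq[OF that] by simp
  qed
  define R where "R t = Q t - \<mu> / g * K t" for t
  have R0: "(R \<longlongrightarrow> 0) at_top"
  proof -
    have "((\<lambda>t. \<integral>x. h t (n x) - real (n x) * K t \<partial>D) \<longlongrightarrow> (\<integral>x. 0 \<partial>D)) at_top"
    proof (rule integral_dominated_convergence_at_top[where w = "\<lambda>x. 2 * C * real (n x)"])
      show "\<forall>\<^sub>F t in at_top. AE x in D. norm (h t (n x) - real (n x) * K t) \<le> 2 * C * real (n x)"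
      proof (intro always_eventually allI AE_I2)
        fix t x
        have "\<bar>real (n x) * K t\<bar> \<le> real (n x) * C" unfolding abs_mult using K_bound by (intro mult_mono) auto
        then show "norm (h t (n x) - real (n x) * K t) \<le> 2 * C * real (n x)"
          using hb[of t "n x"] by (simp add: algebra_simps)
      qed
      have per: "((\<lambda>t. K (t - real j * g) - K t) \<longlongrightarrow> 0) at_top" for j
      proof -
        have "real j * g \<in> asymp_periods"
        proof (induction j)
          case 0
          then show ?case by (simp add: asymp_periods_def)
        next
          case (Suc j)
          then show ?case using asymp_periods_add[OF Suc g(2)] by (simp add: algebra_simps)
        qed
        then show ?thesis by (simp add: asymp_periods_def)
      qed
      have "((\<lambda>t. \<Sum>j<m. K (t - real j * g) - K t) \<longlongrightarrow> (\<Sum>j<m. 0)) at_top" for m :: nat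
        by (intro tendsto_sum per)
      then show "AE x in D. ((\<lambda>t. h t (n x) - real (n x) * K t) \<longlongrightarrow> 0) at_top"
        by (intro AE_I2) (simp add: h_def sum_subtractf)
    qed (use n_int in auto)
    moreover have "(\<integral>x. h t (n x) - real (n x) * K t \<partial>D) = R t" for t
      using h_int n_int n_mean by (simp add: R_def Q_def)
    ultimately show ?thesis by simp
  qed
  define r where "r = exp (- g / 2)"
  have r: "0 < r" "r < 1" using g by (auto simp: r_def)
  have ex_q: "\<exists>q. (\<lambda>k. Q (t + real k * g)) \<longlonglongrightarrow> q \<and> \<bar>Q t - q\<bar> \<le> B / (1 - r) * exp (- t / 2)" if t: "t \<ge> 0" for t
  proof -
    define d where "d i = Q (t + real (Suc i) * g) - Q (t + real i * g)" for i
    have d: "\<bar>d i\<bar> \<le> B * exp (- t / 2) * r ^ i" for i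
    proof -
      have "\<bar>d i\<bar> \<le> B * exp (- (t + real (Suc i) * g) / 2)"
        using Q_diff[of "t + real (Suc i) * g"] t g by (simp add: d_def algebra_simps)
      also have "\<dots> \<le> B * exp (- (t + real i * g) / 2)"
        using B_nonneg g by (intro mult_left_mono) auto
      also have "exp (- (t + real i * g) / 2) = exp (- t / 2) * r ^ i"
        unfolding r_def exp_of_nat_mult[symmetric] mult_exp_exp by (simp add: field_simps)
      finally show ?thesis by simp
    qed
    have geo: "(\<lambda>i. B * exp (- t / 2) * r ^ i) sums (B * exp (- t / 2) * (1 / (1 - r)))"
      using r by (intro sums_mult geometric_sums) auto
    have "summable (\<lambda>i. \<bar>d i\<bar>)"
      using d by (intro summable_comparison_test'[OF sums_summable[OF geo]]) auto
    then have sd: "summable d" by (rule summable_rabs_cancel)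
    have ps: "(\<Sum>i<k. d i) = Q (t + real k * g) - Q t" for k
      unfolding d_def by (subst sum_lessThan_telescope) auto
    have "(\<lambda>k. (Q (t + real k * g) - Q t) + Q t) \<longlonglongrightarrow> suminf d + Q t"
      using summable_LIMSEQ[OF sd] unfolding ps by (intro tendsto_intros)
    moreover have "\<bar>suminf d\<bar> \<le> B * exp (- t / 2) * (1 / (1 - r))"
      using summable_rabs[OF \<open>summable (\<lambda>i. \<bar>d i\<bar>)\<close>]
        suminf_le[OF d \<open>summable (\<lambda>i. \<bar>d i\<bar>)\<close> sums_summable[OF geo]] sums_unique[OF geo] by linarith
    ultimately show ?thesis by (intro exI[of _ "suminf d + Q t"]) (simp add: mult.commute)
  qed
  then obtain q where q: "\<And>t. t \<ge> 0 \<Longrightarrow> (\<lambda>k. Q (t + real k * g)) \<longlonglongrightarrow> q t"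
    "\<And>t. t \<ge> 0 \<Longrightarrow> \<bar>Q t - q t\<bar> \<le> B / (1 - r) * exp (- t / 2)" by metis
  have shift: "filterlim (\<lambda>k. t + real k * g) at_top sequentially" for t
    using g(1) by real_asymp
  have Klim: "(\<lambda>k. K (t + real k * g)) \<longlonglongrightarrow> g / \<mu> * q t" if "t \<ge> 0" for t
  proof -
    have "(\<lambda>k. g / \<mu> * (Q (t + real k * g) - R (t + real k * g))) \<longlonglongrightarrow> g / \<mu> * (q t - 0)"
      by (intro tendsto_intros q that filterlim_compose[OF R0 shift])
    then show ?thesis using g mu by (simp add: R_def)
  qed
  define \<phi> where "\<phi> t = lim (\<lambda>k. K (t + real k * g))" for t
  have Kphi: "(\<lambda>k. K (t + real k * g)) \<longlonglongrightarrow> \<phi> t" for t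
  proof -
    \<comment> \<open>For negative \<open>t\<close> the progression is entered after
      \<open>j\<close> steps, where its points have become nonnegative and the error bound is
      available.\<close>
    obtain j :: nat where j: "- t / g < real j" using reals_Archimedean2 by blast
    then have "t + real j * g \<ge> 0" using g by (simp add: field_simps)
    from Klim[OF this] have "(\<lambda>k. K (t + real (k + j) * g)) \<longlonglongrightarrow> g / \<mu> * q (t + real j * g)"
      by (simp add: algebra_simps)
    then have "(\<lambda>k. K (t + real k * g)) \<longlonglongrightarrow> g / \<mu> * q (t + real j * g)"
      by (rule LIMSEQ_offset)
    then show ?thesis unfolding \<phi>_def by (simp add: limI)
  qed
  have phi_q: "\<phi> t = g / \<mu> * q t" if "t \<ge> 0" for t
    using LIMSEQ_unique[OF Kphi Klim[OF that]] .
  have "\<phi> (t + g) = \<phi> t" for t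
  proof (rule LIMSEQ_unique[OF Kphi])
    have "(\<lambda>k. K (t + real (Suc k) * g)) \<longlonglongrightarrow> \<phi> t" using Kphi by (rule LIMSEQ_Suc)
    then show "(\<lambda>k. K (t + g + real k * g)) \<longlonglongrightarrow> \<phi> t" by (simp add: algebra_simps)
  qed
  moreover have "continuous_on UNIV \<phi>"
  proof (rule lipschitz_on_continuous_on[of l], rule lipschitz_onI[OF _ l_nonneg])
    fix t u
    have "(\<lambda>k. \<bar>K (t + real k * g) - K (u + real k * g)\<bar>) \<longlonglongrightarrow> \<bar>\<phi> t - \<phi> u\<bar>"
      by (intro tendsto_intros Kphi)
    then show "dist (\<phi> t) (\<phi> u) \<le> l * dist t u"
      unfolding dist_real_def
    proof (rule LIMSEQ_le_const2)
      show "\<exists>N. \<forall>k\<ge>N. \<bar>K (t + real k * g) - K (u + real k * g)\<bar> \<le> l * \<bar>t - u\<bar>"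
        using K_lip[of "t + real k * g" "u + real k * g" for k] by simp
    qed
  qed
  moreover have "((\<lambda>t. K t - \<phi> t) \<longlongrightarrow> 0) at_top"
  proof -
    have Qq: "((\<lambda>t. Q t - q t) \<longlongrightarrow> 0) at_top"
    proof (rule Lim_null_comparison[of _ "\<lambda>t. B / (1 - r) * exp (- t / 2)"])
      show "\<forall>\<^sub>F t in at_top. norm (Q t - q t) \<le> B / (1 - r) * exp (- t / 2)"
        using eventually_ge_at_top[of 0] by eventually_elim (use q(2) in simp)
      have "((\<lambda>t::real. exp (- t / 2)) \<longlongrightarrow> 0) at_top" by real_asymp
      then show "((\<lambda>t. B / (1 - r) * exp (- t / 2)) \<longlongrightarrow> 0) at_top" by (rule tendsto_mult_right_zero)
    qed
    have "((\<lambda>t. g / \<mu> * ((Q t - q t) - R t)) \<longlongrightarrow> g / \<mu> * (0 - 0)) at_top"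
      by (intro tendsto_intros R0 Qq)
    moreover have "\<forall>\<^sub>F t in at_top. g / \<mu> * ((Q t - q t) - R t) = K t - \<phi> t"
      using eventually_ge_at_top[of 0]
      by eventually_elim (use g mu in \<open>simp add: phi_q R_def field_simps\<close>)
    ultimately show ?thesis by (simp add: tendsto_cong)
  qed
  ultimately show ?thesis by blast
qed

lemma supp_group_lattice:
  fixes a :: real
  assumes "x \<in> supp_group" "a > 0" "AE x in D. \<exists>k::int. x = a * k"
  shows "\<exists>k::int. x = a * k"
  using assms(1)
proof (induction x rule: supp_group.induct)
  case zero
  show ?case by (intro exI[of _ 0]) simp
next
  case (add x y)
  then obtain i j :: int where "x = a * i" "y = a * j" using supp_lattice[OF assms(3) _ assms(2)] by blast
  then show ?case by (intro exI[of _ "i + j"]) (simp add: algebra_simps)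
next
  case (diff x y)
  then obtain i j :: int where "x = a * i" "y = a * j" using supp_lattice[OF assms(3) _ assms(2)] by blast
  then show ?case by (intro exI[of _ "i - j"]) (simp add: algebra_simps)
qed

text \<open>A fixed nonzero element of the support group is an integer multiple of every span, so it
  bounds all spans. This keeps the supremum of the spans meaningful in both cases of the limit
  theorem.\<close>

lemma lattice_spans_bounded:
  "\<exists>m. \<forall>a::real. a > 0 \<longrightarrow> (AE x in D. \<exists>k::int. x = a * k) \<longrightarrow> a \<le> m"
proof -
  obtain x where x: "x \<in> supp_group" "x \<noteq> 0" using supp_group_nontrivial by blast
  have "a \<le> \<bar>x\<bar>" if a: "a > 0" "AE x in D. \<exists>k::int. x = a * k" for a :: real
  proof -
    obtain k :: int where k: "x = a * k" using supp_group_lattice[OF x(1) a] by blast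
    then have "1 \<le> \<bar>real_of_int k\<bar>" using x by auto
    then show ?thesis using k a mult_left_mono[of 1 "\<bar>real_of_int k\<bar>" a] by (simp add: abs_mult)
  qed
  then show ?thesis by blast
qed

text \<open>In the cyclic case the generator \<open>g\<close> lies in the group generated by the
  support, so it is an integer multiple of every span of \<open>D\<close>. Hence \<open>g\<close> is
  the largest span, which allows its identification with \<open>log_span\<close> later.\<close>

theorem renewal_limit:
  obtains (nonlattice) c where "(K \<longlongrightarrow> c) at_top"
  | (lattice) g :: real and \<phi> where "g > 0" "AE x in D. \<exists>k::int. x = g * k"
      "\<And>a::real. \<lbrakk>a > 0; AE x in D. \<exists>k::int. x = a * k\<rbrakk> \<Longrightarrow> a \<le> g"
      "continuous_on UNIV \<phi>" "\<And>t. \<phi> (t + g) = \<phi> t" "((\<lambda>t. K t - \<phi> t) \<longlongrightarrow> 0) at_top"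
proof -
  obtain x0 where x0: "x0 \<in> supp_group" "x0 \<noteq> 0" using supp_group_nontrivial by blast
  show thesis
  proof (rule real_subgroup_cases[OF supp_group_add supp_group_uminus x0])
    assume dense: "\<And>y e :: real. e > 0 \<Longrightarrow> \<exists>x\<in>supp_group. \<bar>x - y\<bar> < e"
    have "y \<in> asymp_periods" for y
      using dense supp_group_asymp_period by (intro asymp_periods_closed) blast
    then show thesis using nonlattice_limit nonlattice by blast
  next
    fix g assume cyclic: "g > 0" "g \<in> supp_group" "\<And>x. x \<in> supp_group \<Longrightarrow> \<exists>k::int. x = g * k"
    have AE: "AE x in D. \<exists>k::int. x = g * k"
      using AE_supp by eventually_elim (use cyclic supp_subset_group in blast)
    have max: "a \<le> g" if a: "a > 0" "AE x in D. \<exists>k::int. x = a * k" for a :: real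
    proof -
      obtain k :: int where k: "g = a * k" using supp_group_lattice[OF cyclic(2) a] by blast
      then have "k \<ge> 1" using a cyclic by (simp add: zero_less_mult_iff)
      then show ?thesis using k a by simp
    qed
    show thesis
      using lattice_limit[OF cyclic(1) supp_group_asymp_period[OF cyclic(2)] AE] lattice[OF cyclic(1) AE max]
      by blast
  qed
qed

end

subsection \<open>Binomial averages\<close>

text \<open>\<open>Bernstein k j p\<close> is the binomial probability of j successes in k trials,
  so this is the expectation of \<open>f\<close> at a binomial variable. As a polynomial in
  \<open>p\<close> it makes sense, and is measurable, on the whole real line.\<close>

definition bin_exp :: "nat \<Rightarrow> (nat \<Rightarrow> real) \<Rightarrow> real \<Rightarrow> real" where
  "bin_exp k f p = (\<Sum>j\<le>k. Bernstein k j p * f j)"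

lemma bin_exp_meas[measurable]: "bin_exp k f \<in> borel_measurable borel"
  unfolding bin_exp_def Bernstein_def by measurable

lemma bin_exp_add: "bin_exp k (\<lambda>j. f j + g j) p = bin_exp k f p + bin_exp k g p"
  by (simp add: bin_exp_def sum.distrib distrib_left)

lemma bin_exp_diff: "bin_exp k (\<lambda>j. f j - g j) p = bin_exp k f p - bin_exp k g p"
  by (simp add: bin_exp_def sum_subtractf right_diff_distrib)

lemma bin_exp_cmult: "bin_exp k (\<lambda>j. c * f j) p = c * bin_exp k f p"
  by (simp add: bin_exp_def sum_distrib_left mult.left_commute)

lemma bin_exp_const[simp]: "bin_exp k (\<lambda>j. c) p = c"
  by (simp add: bin_exp_def flip: sum_distrib_right)

lemma bin_exp_id[simp]: "bin_exp k real p = real k * p"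
  using sum_k_Bernstein[of k p] by (simp add: bin_exp_def mult.commute)

lemma bin_exp_affine: "bin_exp k (\<lambda>j. \<alpha> + \<beta> * real j) p = \<alpha> + \<beta> * (real k * p)"
  using bin_exp_cmult[of k \<beta> real p] by (simp add: bin_exp_add)

lemma bin_exp_mono:
  assumes "0 \<le> p" "p \<le> 1" "\<And>j. j \<le> k \<Longrightarrow> f j \<le> g j"
  shows "bin_exp k f p \<le> bin_exp k g p"
  unfolding bin_exp_def using assms by (intro sum_mono mult_left_mono Bernstein_nonneg) auto

lemma bin_exp_abs_le:
  assumes "0 \<le> p" "p \<le> 1"
  shows "\<bar>bin_exp k f p\<bar> \<le> bin_exp k (\<lambda>j. \<bar>f j\<bar>) p"
  unfolding bin_exp_def using assms
  by (intro sum_abs[THEN order.trans] sum_mono) (simp add: abs_mult Bernstein_nonneg)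

lemma bin_exp_bounded:
  assumes "0 \<le> p" "p \<le> 1"
  shows "\<bar>bin_exp k f p\<bar> \<le> (\<Sum>j\<le>k. \<bar>f j\<bar>)"
proof -
  have "\<bar>bin_exp k f p\<bar> \<le> bin_exp k (\<lambda>_. \<Sum>j\<le>k. \<bar>f j\<bar>) p"
    using assms by (intro bin_exp_abs_le[THEN order.trans] bin_exp_mono member_le_sum) auto
  then show ?thesis by simp
qed

text \<open>Condition on the last trial, which succeeds with probability \<open>p\<close>. The
  algebraic form of this is Pascal's rule, stated as \<open>B0\<close> and
  \<open>BS\<close>.\<close>

lemma bin_exp_Suc:
  "bin_exp (Suc k) f p = bin_exp k f p + p * bin_exp k (\<lambda>j. f (Suc j) - f j) p"
proof -
  have B0: "Bernstein (Suc k) 0 p = (1 - p) * Bernstein k 0 p"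
    by (simp add: Bernstein_def)
  have BS: "Bernstein (Suc k) (Suc j) p = (1 - p) * Bernstein k (Suc j) p + p * Bernstein k j p" if "j \<le> k" for j
  proof (cases "j = k")
    case False
    then have "k - j = Suc (k - Suc j)" using that by simp
    then show ?thesis by (simp add: Bernstein_def algebra_simps)
  qed (simp add: Bernstein_def)
  have "bin_exp (Suc k) f p = Bernstein (Suc k) 0 p * f 0 + (\<Sum>j\<le>k. Bernstein (Suc k) (Suc j) p * f (Suc j))"
    unfolding bin_exp_def by (rule sum.atMost_Suc_shift)
  also have "\<dots> = (1 - p) * (Bernstein k 0 p * f 0 + (\<Sum>j\<le>k. Bernstein k (Suc j) p * f (Suc j)))
      + p * (\<Sum>j\<le>k. Bernstein k j p * f (Suc j))"
  proof -
    have "(\<Sum>j\<le>k. Bernstein (Suc k) (Suc j) p * f (Suc j))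
      = (\<Sum>j\<le>k. ((1 - p) * Bernstein k (Suc j) p + p * Bernstein k j p) * f (Suc j))"
      by (intro sum.cong) (simp_all add: BS)
    also have "\<dots> = (1 - p) * (\<Sum>j\<le>k. Bernstein k (Suc j) p * f (Suc j)) + p * (\<Sum>j\<le>k. Bernstein k j p * f (Suc j))"
      by (simp only: distrib_right sum.distrib sum_distrib_left mult.assoc)
    finally show ?thesis unfolding B0 by (simp only: distrib_left mult.assoc add.assoc)
  qed
  also have "Bernstein k 0 p * f 0 + (\<Sum>j\<le>k. Bernstein k (Suc j) p * f (Suc j)) = (\<Sum>j\<le>Suc k. Bernstein k j p * f j)"
    by (rule sum.atMost_Suc_shift[symmetric])
  also have "\<dots> = bin_exp k f p" by (simp add: bin_exp_def Bernstein_def)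
  finally show ?thesis
    by (simp add: bin_exp_def sum_subtractf algebra_simps)
qed

text \<open>The absorption identity
  \<open>Suc k * (k choose j) = (Suc k choose Suc j) * Suc j\<close> turns the left-hand side into
  the probability of at least one success in \<open>Suc k\<close> trials.\<close>

lemma bin_exp_inverse_Suc:
  assumes p: "0 \<le> p" "p \<le> 1"
  shows "real (Suc k) * p * bin_exp k (\<lambda>j. 1 / real (Suc j)) p \<le> 1"
proof -
  have "real (Suc k) * p * (Bernstein k j p * (1 / real (Suc j))) = Bernstein (Suc k) (Suc j) p" for j
  proof -
    have "real (Suc k) * real (k choose j) = real (Suc k choose Suc j) * real (Suc j)"
      by (metis Suc_times_binomial_eq of_nat_mult)
    then have "real (Suc k) * real (k choose j) / real (Suc j) = real (Suc k choose Suc j)"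
      by (simp add: field_simps del: of_nat_Suc)
    then show ?thesis unfolding Bernstein_def
      by (simp add: field_simps del: of_nat_Suc binomial_Suc_Suc)
  qed
  then have "real (Suc k) * p * bin_exp k (\<lambda>j. 1 / real (Suc j)) p = (\<Sum>j\<le>k. Bernstein (Suc k) (Suc j) p)"
    by (simp add: bin_exp_def sum_distrib_left)
  also have "\<dots> \<le> Bernstein (Suc k) 0 p + (\<Sum>j\<le>k. Bernstein (Suc k) (Suc j) p)"
    using Bernstein_nonneg[OF p] by simp
  also have "\<dots> = (\<Sum>j\<le>Suc k. Bernstein (Suc k) j p)" by (rule sum.atMost_Suc_shift[symmetric])
  also have "\<dots> = 1" by simp
  finally show ?thesis .
qed

lemma ln_tangent_le: "ln (x::real) \<le> ln y + (x - y) / y" if "x > 0" "y > 0"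
proof -
  have "ln (x / y) \<le> x / y - 1" using that by (intro ln_le_minus_one) auto
  then show ?thesis using that by (simp add: ln_div diff_divide_distrib)
qed

lemma inverse_sqrt_tangent_le:
  fixes u y :: real
  assumes "u > 0" "y > 0"
  shows "1 / sqrt y - (u - y) / (2 * y * sqrt y) \<le> 1 / sqrt u"
proof -
  define a d where "a = sqrt u" and "d = sqrt y"
  have ad: "a > 0" "d > 0" "u = a * a" "y = d * d" using assms by (auto simp: a_def d_def)
  \<comment> \<open>The gap between \<open>1 / sqrt u\<close> and its tangent at \<open>y\<close>,
    written in the square roots \<open>a\<close> and \<open>d\<close>, has a double root at
    \<open>a = d\<close>.\<close>
  have "0 \<le> (a - d)\<^sup>2 * (a + 2 * d) / (2 * d * d * d * a)" using ad by (intro divide_nonneg_pos mult_nonneg_nonneg) auto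
  also have "\<dots> = 1 / a - (1 / d - (a * a - d * d) / (2 * (d * d) * d))"
    using ad by (simp add: field_simps power2_eq_square)
  finally show ?thesis using assms by (simp add: a_def d_def)
qed

lemma bin_exp_ln_le:
  assumes "0 \<le> p" "p \<le> 1" "c > 0"
  shows "bin_exp k (\<lambda>j. ln (c + real j)) p \<le> ln (c + real k * p)"
proof -
  define y where "y = c + real k * p"
  have y: "y > 0" using assms by (simp add: y_def add_pos_nonneg)
  have "bin_exp k (\<lambda>j. ln (c + real j)) p \<le> bin_exp k (\<lambda>j. (ln y + (c - y) / y) + 1 / y * real j) p"
  proof (intro bin_exp_mono assms)
    fix j
    have "ln (c + real j) \<le> ln y + (c + real j - y) / y" using assms y by (intro ln_tangent_le) auto
    then show "ln (c + real j) \<le> (ln y + (c - y) / y) + 1 / y * real j" by (simp add: add_divide_distrib diff_divide_distrib)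
  qed
  also have "\<dots> = ln y + (c + real k * p - y) / y"
    unfolding bin_exp_affine by (simp add: add_divide_distrib diff_divide_distrib)
  finally show ?thesis by (simp add: y_def)
qed

text \<open>Jensen's inequality bounds the expected logarithm only from above. Here the tangent is
  taken at \<open>1 + j\<close> and evaluated at \<open>y\<close>; this replaces the logarithm by an
  inverse first moment, for which \<open>bin_exp_inverse_Suc\<close> is available.\<close>

lemma bin_exp_ln_ge:
  assumes p: "0 < p" "p \<le> 1"
  shows "ln (real (Suc k) * p) \<le> bin_exp k (\<lambda>j. ln (1 + real j)) p"
proof -
  define y where "y = real (Suc k) * p"
  have y: "y > 0" using assms by (simp add: y_def)
  have "ln y \<le> (ln y + 1) - y * bin_exp k (\<lambda>j. 1 / real (Suc j)) p"
    using bin_exp_inverse_Suc[of p k] p unfolding y_def by simp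
  also have "\<dots> = bin_exp k (\<lambda>j. (ln y + 1) - y * (1 / real (Suc j))) p"
    unfolding bin_exp_diff bin_exp_cmult by simp
  also have "\<dots> \<le> bin_exp k (\<lambda>j. ln (1 + real j)) p"
  proof (rule bin_exp_mono)
    fix j
    have "ln y \<le> ln (1 + real j) + (y - (1 + real j)) / (1 + real j)" using y by (intro ln_tangent_le) auto
    also have "(y - (1 + real j)) / (1 + real j) = y * (1 / real (Suc j)) - 1"
      by (simp add: field_simps)
    finally show "(ln y + 1) - y * (1 / real (Suc j)) \<le> ln (1 + real j)" by linarith
  qed (use p in auto)
  finally show ?thesis by (simp add: y_def)
qed

lemma bin_exp_inverse_sqrt_ge:
  assumes "0 \<le> p" "p \<le> 1" "c > 0"
  shows "1 / sqrt (c + real k * p) \<le> bin_exp k (\<lambda>j. 1 / sqrt (c + real j)) p"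
proof -
  define y where "y = c + real k * p"
  have y: "y > 0" using assms by (simp add: y_def add_pos_nonneg)
  define z where "z = 1 / (2 * y * sqrt y)"
  have "1 / sqrt y = 1 / sqrt y - (c - y) * z + (- z) * (real k * p)"
    by (simp add: y_def algebra_simps)
  also have "\<dots> = bin_exp k (\<lambda>j. 1 / sqrt y - (c - y) * z + (- z) * real j) p"
    unfolding bin_exp_affine ..
  also have "\<dots> \<le> bin_exp k (\<lambda>j. 1 / sqrt (c + real j)) p"
  proof (intro bin_exp_mono assms)
    fix j
    have "1 / sqrt y - (c + real j - y) / (2 * y * sqrt y) \<le> 1 / sqrt (c + real j)"
      using assms y by (intro inverse_sqrt_tangent_le) auto
    then show "1 / sqrt y - (c - y) * z + (- z) * real j \<le> 1 / sqrt (c + real j)"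
      by (simp add: z_def add_divide_distrib diff_divide_distrib)
  qed
  finally show ?thesis by (simp add: y_def)
qed

text \<open>By \<open>\<bar>d\<bar> \<le> q / 2 + d\<^sup>2 / (2 * q)\<close> the absolute deviation
  is controlled by the variance, which is at most \<open>k\<close>. The choice
  \<open>q = sqrt (k + 1)\<close> balances both terms and stays positive for
  \<open>k = 0\<close>.\<close>

lemma bin_exp_abs_dev:
  assumes p: "0 \<le> p" "p \<le> 1"
  shows "bin_exp k (\<lambda>j. \<bar>real j - real k * p\<bar>) p \<le> sqrt (real k + 1)"
proof -
  define q where "q = sqrt (real k + 1)"
  have q: "q > 0" "q * q = real k + 1" by (auto simp: q_def)
  define x where "x = real k * p"
  have sq: "bin_exp k (\<lambda>j. (real j - x)\<^sup>2) p = x * (1 - p)"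
  proof -
    have "bin_exp k (\<lambda>j. (real j - x)\<^sup>2) p
      = bin_exp k (\<lambda>j. real j * (real j - 1) + (x\<^sup>2 + (1 - 2 * x) * real j)) p"
      by (intro arg_cong2[where f = "bin_exp k"] ext refl) (simp add: power2_eq_square algebra_simps)
    also have "\<dots> = bin_exp k (\<lambda>j. real j * (real j - 1)) p + (x\<^sup>2 + (1 - 2 * x) * x)"
      unfolding bin_exp_add[of k "\<lambda>j. real j * (real j - 1)"] bin_exp_affine x_def ..
    also have "bin_exp k (\<lambda>j. real j * (real j - 1)) p = real k * (real k - 1) * p\<^sup>2"
      using sum_kk_Bernstein[of k p] by (simp add: bin_exp_def mult_ac)
    finally show ?thesis by (simp add: x_def power2_eq_square algebra_simps)
  qed
  have "bin_exp k (\<lambda>j. \<bar>real j - x\<bar>) p \<le> bin_exp k (\<lambda>j. q / 2 + 1 / (2 * q) * (real j - x)\<^sup>2) p"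
  proof (intro bin_exp_mono p)
    fix j
    have "0 \<le> (\<bar>real j - x\<bar> - q)\<^sup>2 / (2 * q)" using q by simp
    also have "\<dots> = q / 2 + 1 / (2 * q) * (real j - x)\<^sup>2 - \<bar>real j - x\<bar>"
      using q by (simp add: power2_diff field_simps) (simp add: power2_eq_square)
    finally show "\<bar>real j - x\<bar> \<le> q / 2 + 1 / (2 * q) * (real j - x)\<^sup>2" by simp
  qed
  also have "\<dots> = q / 2 + 1 / (2 * q) * (x * (1 - p))"
    unfolding bin_exp_add bin_exp_cmult sq by simp
  also have "\<dots> \<le> q / 2 + 1 / (2 * q) * (q * q)"
  proof -
    have "x * (1 - p) \<le> real k * 1" unfolding x_def mult.assoc using p
      by (intro mult_left_mono mult_le_one) auto
    then show ?thesis using q by (intro add_left_mono mult_left_mono) auto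
  qed
  also have "\<dots> = q" using q(1) by simp
  finally show ?thesis by (simp add: q_def x_def)
qed

text \<open>The extension is the infimum of the cones
  \<open>S k + c * \<bar>x - real k\<bar>\<close>, hence of c-Lipschitz functions. It lets a
  sequence be evaluated at real points such as \<open>n * p\<close> without losing the
  constant.\<close>

lemma McShane_extension:
  fixes S :: "nat \<Rightarrow> real"
  assumes lip: "\<And>j k. \<bar>S j - S k\<bar> \<le> c * \<bar>real j - real k\<bar>"
  shows "\<exists>T :: real \<Rightarrow> real. (\<forall>k. T (real k) = S k) \<and> (\<forall>x y. \<bar>T x - T y\<bar> \<le> c * \<bar>x - y\<bar>)"
proof -
  have c: "c \<ge> 0" using lip[of 0 1] by simp
  define T where "T x = (INF k. S k + c * \<bar>x - real k\<bar>)" for x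
  have bdd: "bdd_below (range (\<lambda>k. S k + c * \<bar>x - real k\<bar>))" for x
  proof (intro bdd_belowI2[of _ "S 0 - c * \<bar>x\<bar>"])
    fix k
    have "S 0 - c * real k \<le> S k" using lip[of 0 k] by (simp add: abs_le_iff)
    moreover have "c * (real k - \<bar>x\<bar>) \<le> c * \<bar>x - real k\<bar>" using c by (intro mult_left_mono) auto
    ultimately show "S 0 - c * \<bar>x\<bar> \<le> S k + c * \<bar>x - real k\<bar>" by (simp add: algebra_simps)
  qed
  have "T (real k) = S k" for k
  proof (rule antisym)
    have "T (real k) \<le> S k + c * \<bar>real k - real k\<bar>"
      unfolding T_def by (intro cINF_lower bdd) auto
    then show "T (real k) \<le> S k" by simp
    show "S k \<le> T (real k)"
      unfolding T_def
    proof (intro cINF_greatest)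
      fix j
      show "S k \<le> S j + c * \<bar>real k - real j\<bar>" using lip[of k j] by linarith
    qed auto
  qed
  moreover have one: "T x \<le> T y + c * \<bar>x - y\<bar>" for x y
  proof -
    have "T x - c * \<bar>x - y\<bar> \<le> T y"
      unfolding T_def[of y]
    proof (intro cINF_greatest)
      fix k
      have "T x \<le> S k + c * \<bar>x - real k\<bar>" unfolding T_def by (intro cINF_lower bdd) auto
      also have "c * \<bar>x - real k\<bar> \<le> c * (\<bar>x - y\<bar> + \<bar>y - real k\<bar>)" using c by (intro mult_left_mono) auto
      finally show "T x - c * \<bar>x - y\<bar> \<le> S k + c * \<bar>y - real k\<bar>" by (simp add: algebra_simps)
    qed auto
    then show ?thesis by simp
  qed
  have "\<bar>T x - T y\<bar> \<le> c * \<bar>x - y\<bar>" for x y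
    using one[of x y] one[of y x] by (simp add: abs_le_iff abs_minus_commute)
  ultimately show ?thesis by blast
qed

section \<open>Expected splitting as an operator on sequences\<close>

text \<open>Expectations see the split vector only through the law \<open>L\<close> of a uniformly
  chosen component; \<open>mean\<close> and \<open>nondegenerate\<close> are what the simplex
  condition and the condition on components equal to 1 become for \<open>L\<close>.\<close>

locale split_law = prob_space L for L :: "real measure" +
  fixes b s s0 s1 :: nat
  assumes sets_L[measurable_cong, simp]: "sets L = sets borel"
    and AE_unit: "AE p in L. 0 \<le> p \<and> p \<le> 1"
    and b_ge2: "b \<ge> 2"
    and mean: "real b * (\<integral>p. p \<partial>L) = 1"
    and nondegenerate: "\<not> (AE p in L. p = 0 \<or> p = 1)"
    and capacity: "b * s1 + s0 \<le> s + 1"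
    and not_both_zero: "(s, s0) \<noteq> (0, 0)"
begin

lemma space_L[simp]: "space L = UNIV"
  using sets_eq_imp_space_eq[OF sets_L] by simp

lemma prob_UNIV[simp]: "prob UNIV = 1"
  using prob_space by simp

lemma integrable_unit:
  assumes [measurable]: "f \<in> borel_measurable borel"
    and "\<And>p. \<lbrakk>0 \<le> p; p \<le> 1\<rbrakk> \<Longrightarrow> \<bar>f p\<bar> \<le> (A::real)"
  shows "integrable L f"
proof (rule integrable_const_bound[of _ A])
  show "AE p in L. norm (f p) \<le> A" using AE_unit by eventually_elim (use assms in auto)
qed simp

lemma integrable_id: "integrable L (\<lambda>p. p)"
  by (rule integrable_unit[of _ 1]) auto

lemma integrable_bin_exp: "integrable L (bin_exp k f)"
  by (rule integrable_unit[of _ "\<Sum>j\<le>k. \<bar>f j\<bar>"]) (auto intro: bin_exp_bounded)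

lemma integrable_times_bin_exp: "integrable L (\<lambda>p. p * bin_exp k f p)"
proof (rule integrable_unit[of _ "\<Sum>j\<le>k. \<bar>f j\<bar>"])
  fix p :: real assume p: "0 \<le> p" "p \<le> 1"
  have "\<bar>p * bin_exp k f p\<bar> \<le> 1 * (\<Sum>j\<le>k. \<bar>f j\<bar>)"
    unfolding abs_mult using p bin_exp_bounded[OF p] by (intro mult_mono) auto
  then show "\<bar>p * bin_exp k f p\<bar> \<le> (\<Sum>j\<le>k. \<bar>f j\<bar>)" by simp
qed simp

lemma integral_unit_mono:
  assumes "integrable L f" "integrable L g" "\<And>p. \<lbrakk>0 \<le> p; p \<le> 1\<rbrakk> \<Longrightarrow> f p \<le> (g p :: real)"
  shows "(\<integral>p. f p \<partial>L) \<le> (\<integral>p. g p \<partial>L)"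
  using assms(1,2)
proof (rule integral_mono_AE)
  show "AE p in L. f p \<le> g p" using AE_unit by eventually_elim (use assms in auto)
qed

text \<open>Equality of the integrals would force \<open>f = g\<close> almost everywhere, so
  \<open>L\<close> would be carried by {0, 1}, which \<open>nondegenerate\<close> excludes.\<close>

lemma integral_unit_less:
  assumes f: "integrable L f" and g: "integrable L g"
    and le: "\<And>p. \<lbrakk>0 \<le> p; p \<le> 1\<rbrakk> \<Longrightarrow> f p \<le> (g p :: real)"
    and less: "\<And>p. \<lbrakk>0 < p; p < 1\<rbrakk> \<Longrightarrow> f p < g p"
  shows "(\<integral>p. f p \<partial>L) < (\<integral>p. g p \<partial>L)"
proof (rule ccontr)
  assume "\<not> ?thesis"
  then have "(\<integral>p. g p - f p \<partial>L) = 0"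
    using integral_unit_mono[OF f g le] f g by simp
  moreover have "AE p in L. 0 \<le> g p - f p" using AE_unit by eventually_elim (use le in auto)
  ultimately have "AE p in L. g p - f p = 0"
    using f g by (subst (asm) integral_nonneg_eq_0_iff_AE) auto
  with AE_unit have "AE p in L. p = 0 \<or> p = 1"
  proof eventually_elim
    case (elim p)
    then show ?case using less[of p] by force
  qed
  then show False using nondegenerate by simp
qed

text \<open>
  \<open>split_op f n\<close> is the expected sum of \<open>f\<close> over the cardinalities of the children of a node of
  cardinality \<open>n\<close>. In \<open>sized_op\<close> the split probability is size-biased, which makes it a Markov operator.
\<close>

definition rest :: "nat \<Rightarrow> nat" where
  "rest n = n - s0 - b * s1"

definition split_op :: "(nat \<Rightarrow> real) \<Rightarrow> nat \<Rightarrow> real" where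
  "split_op f n = real b * (\<integral>p. bin_exp (rest n) (\<lambda>j. f (s1 + j)) p \<partial>L)"

definition sized_op :: "(nat \<Rightarrow> real) \<Rightarrow> nat \<Rightarrow> real" where
  "sized_op f n = real b * (\<integral>p. p * bin_exp (rest n) (\<lambda>j. f (s1 + j)) p \<partial>L)"

definition mu :: real where
  "mu = real b * (\<integral>p. - p * ln p \<partial>L)"

text \<open>For \<open>n > s\<close> the capacity condition gives
  \<open>s0 + b * s1 \<le> s + 1 \<le> n\<close>, so the truncated subtraction in
  \<open>rest\<close> is exact.\<close>

lemma rest_Suc: "n > s \<Longrightarrow> rest (Suc n) = Suc (rest n)"
  using capacity by (auto simp: rest_def)

lemma rest_plus: "n > s \<Longrightarrow> rest n + (s0 + b * s1) = n"
  using capacity by (auto simp: rest_def)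

lemma split_op_Suc:
  assumes "n > s"
  shows "split_op f (Suc n) - split_op f n = sized_op (\<lambda>j. f (Suc j) - f j) n"
  unfolding split_op_def sized_op_def rest_Suc[OF assms] bin_exp_Suc
  using integrable_bin_exp integrable_times_bin_exp
  by (subst Bochner_Integration.integral_add) (auto simp: algebra_simps)

lemma sized_op_diff: "sized_op (\<lambda>j. f j - g j) n = sized_op f n - sized_op g n"
  unfolding sized_op_def bin_exp_diff right_diff_distrib
  using integrable_times_bin_exp by (subst Bochner_Integration.integral_diff) (auto simp: algebra_simps)

lemma sized_op_cmult: "sized_op (\<lambda>j. c * f j) n = c * sized_op f n"
  unfolding sized_op_def bin_exp_cmult by (simp add: mult.left_commute[of _ c])

lemma sized_op_const[simp]: "sized_op (\<lambda>j. c) n = c"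
  using mean by (simp add: sized_op_def mult.commute)

lemma self_loop: "real b * (\<integral>p. p * p ^ n \<partial>L) < 1" if "n \<ge> 1"
proof -
  have int: "integrable L (\<lambda>p. p * p ^ n)"
    by (rule integrable_unit[of _ 1]) (auto simp: abs_mult power_le_one mult_le_one)
  have "(\<integral>p. p * p ^ n \<partial>L) < (\<integral>p. p \<partial>L)"
  proof (rule integral_unit_less[OF int integrable_id])
    fix p :: real
    show "p * p ^ n \<le> p" if "0 \<le> p" "p \<le> 1"
      using mult_left_mono[of "p ^ n" 1 p] that by (simp add: power_le_one)
    show "p * p ^ n < p" if p: "0 < p" "p < 1"
    proof -
      have "p ^ n < 1" using p \<open>n \<ge> 1\<close> by (simp add: power_less_one_iff)
      then show ?thesis using p by simp
    qed
  qed
  then have "real b * (\<integral>p. p * p ^ n \<partial>L) < real b * (\<integral>p. p \<partial>L)"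
    using b_ge2 by (intro mult_strict_left_mono) auto
  then show ?thesis using mean by simp
qed

text \<open>
  A node may pass all its items to a single child, so the recursion refers back to \<open>n\<close> itself; the
  coefficient of this self-reference is less than \<open>1\<close>.
\<close>

lemma maximum_principle:
  assumes n0: "n0 > s"
    and small: "\<And>n. n < n0 \<Longrightarrow> f n \<le> 0"
    and sub: "\<And>n. n \<ge> n0 \<Longrightarrow> f n \<le> sized_op f n"
  shows "f n \<le> 0"
proof (induction n rule: less_induct)
  case (less n)
  show ?case
  proof (cases "n < n0")
    case False
    then have ns: "n > s" "n \<ge> n0" using n0 by auto
    have ns1: "n \<ge> 1" using ns by auto
    have rn: "s1 + rest n \<le> n" using rest_plus[OF ns(1)] mult_le_mono1[of 1 b s1] b_ge2 by linarith
    show ?thesis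
    proof (cases "s1 + rest n = n")
      case True
      \<comment> \<open>A child can take over all items only if nothing stays behind or goes to a
        sibling: with \<open>b \<ge> 2\<close> this equation forces both parameters to be 0.\<close>
      then have "s1 = s0 + b * s1" using rest_plus[OF ns(1)] by linarith
      moreover have "2 * s1 \<le> b * s1" using b_ge2 by (rule mult_le_mono1)
      ultimately have z: "s1 = 0" "s0 = 0" by linarith+
      then have r: "rest n = n" using True by simp
      \<comment> \<open>The terms with \<open>j < n\<close> are nonpositive by induction, so only
        the term with all items in one child remains.\<close>
      have "bin_exp n f p \<le> p ^ n * f n" if p: "0 \<le> p" "p \<le> 1" for p
      proof -
        have "(\<Sum>j<n. Bernstein n j p * f j) \<le> 0"
          using less p by (intro sum_nonpos mult_nonneg_nonpos Bernstein_nonneg) auto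
        then show ?thesis by (simp add: bin_exp_def lessThan_Suc_atMost[symmetric] Bernstein_def)
      qed
      then have "(\<integral>p. p * bin_exp n f p \<partial>L) \<le> (\<integral>p. (p * p ^ n) * f n \<partial>L)"
      proof (intro integral_unit_mono integrable_times_bin_exp integrable_mult_left)
        show "integrable L (\<lambda>p. p * p ^ n)"
          by (rule integrable_unit[of _ 1]) (auto simp: abs_mult power_le_one mult_le_one)
      qed (auto simp: mult.assoc intro: mult_left_mono)
      then have "real b * (\<integral>p. p * bin_exp n f p \<partial>L) \<le> real b * ((\<integral>p. p * p ^ n \<partial>L) * f n)"
        by (intro mult_left_mono) auto
      moreover have "sized_op f n = real b * (\<integral>p. p * bin_exp n f p \<partial>L)"
        unfolding sized_op_def r unfolding z by simp
      ultimately have "sized_op f n \<le> real b * (\<integral>p. p * p ^ n \<partial>L) * f n" by simp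
      then have "f n \<le> real b * (\<integral>p. p * p ^ n \<partial>L) * f n" using sub[OF ns(2)] by linarith
      then have "(1 - real b * (\<integral>p. p * p ^ n \<partial>L)) * f n \<le> 0" by (simp add: algebra_simps)
      then show ?thesis using self_loop[OF ns1] by (simp add: mult_le_0_iff)
    next
      case False
      have "(\<integral>p. p * bin_exp (rest n) (\<lambda>j. f (s1 + j)) p \<partial>L) \<le> (\<integral>p. 0 \<partial>L)"
      proof (intro integral_unit_mono integrable_times_bin_exp)
        fix p :: real assume p: "0 \<le> p" "p \<le> 1"
        have "bin_exp (rest n) (\<lambda>j. f (s1 + j)) p \<le> bin_exp (rest n) (\<lambda>_. 0) p"
          using False rn by (intro bin_exp_mono p less) auto
        then show "p * bin_exp (rest n) (\<lambda>j. f (s1 + j)) p \<le> 0"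
          using p by (simp add: mult_nonneg_nonpos)
      qed auto
      then have "sized_op f n \<le> 0" by (simp add: sized_op_def mult_nonneg_nonpos)
      then show ?thesis using sub[OF ns(2)] by linarith
    qed
  qed (use small in auto)
qed

section \<open>The size-biased operator on logarithms and inverse square roots\<close>

lemma integrable_p_ln_p: "integrable L (\<lambda>p. p * ln p)"
proof (rule integrable_unit[of _ 1])
  fix p :: real assume p: "0 \<le> p" "p \<le> 1"
  show "\<bar>p * ln p\<bar> \<le> 1"
  proof (cases "p = 0")
    case False
    then have p0: "p > 0" using p by simp
    have "p * ln (1 / p) \<le> p * (1 / p - 1)" using p0 by (intro mult_left_mono ln_le_minus_one) auto
    also have "\<dots> \<le> 1" using p0 by (simp add: field_simps)
    finally have "- (p * ln p) \<le> 1" using p0 by (simp add: ln_div)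
    moreover have "p * ln p \<le> 0" using p0 p by (intro mult_nonneg_nonpos) auto
    ultimately show ?thesis by simp
  qed simp
qed simp

lemma integral_affine_entropy:
  "integrable L (\<lambda>p. \<alpha> * p + p * ln p + \<beta>)"
  "real b * (\<integral>p. \<alpha> * p + p * ln p + \<beta> \<partial>L) = \<alpha> - mu + real b * \<beta>"
proof -
  show int: "integrable L (\<lambda>p. \<alpha> * p + p * ln p + \<beta>)"
    using integrable_id integrable_p_ln_p by auto
  have "(\<integral>p. \<alpha> * p + p * ln p + \<beta> \<partial>L) = \<alpha> * (\<integral>p. p \<partial>L) + (\<integral>p. p * ln p \<partial>L) + \<beta>"
    using integrable_id integrable_p_ln_p by simp
  moreover have "real b * (\<alpha> * (\<integral>p. p \<partial>L)) = \<alpha>"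
    using mean by (simp add: mult.left_commute)
  ultimately show "real b * (\<integral>p. \<alpha> * p + p * ln p + \<beta> \<partial>L) = \<alpha> - mu + real b * \<beta>"
    by (simp add: mu_def distrib_left)
qed

lemma mu_pos: "mu > 0"
proof -
  have "(\<integral>p. p * ln p \<partial>L) < (\<integral>p. 0 \<partial>L)"
  proof (rule integral_unit_less[OF integrable_p_ln_p])
    fix p :: real
    show "p * ln p \<le> 0" if "0 \<le> p" "p \<le> 1"
      using that by (cases "p = 0") (auto intro: mult_nonneg_nonpos)
    show "p * ln p < 0" if "0 < p" "p < 1"
      using that by (intro mult_pos_neg) auto
  qed simp
  then show ?thesis using b_ge2 by (simp add: mu_def mult_pos_neg)
qed

text \<open>The tangent at \<open>x * p\<close> produces an error \<open>c / (x * p)\<close>,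
  singular for small \<open>p\<close>; the size-bias factor \<open>p\<close> cancels the singularity
  and leaves \<open>c / x\<close>. The lower bound comes from \<open>bin_exp_ln_ge\<close>, where
  \<open>Suc k\<close> equals \<open>x - c0\<close>.\<close>

lemma sized_op_ln:
  assumes n: "n > s"
  defines "c0 \<equiv> real (s0 + b * s1)"
  shows "\<bar>sized_op (\<lambda>j. ln (1 + real j)) n - (ln (1 + real n) - mu)\<bar>
    \<le> (real b * (1 + real s1) + c0 * (c0 + 1)) / (1 + real n)"
proof -
  define x where "x = 1 + real n"
  define c where "c = 1 + real s1"
  define k where "k = rest n"
  have x: "x \<ge> 1" by (simp add: x_def)
  have c: "c \<ge> 1" by (simp add: c_def)
  have c0: "c0 \<ge> 0" by (simp add: c0_def)
  have kx: "real (Suc k) = x - c0"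
    using rest_plus[OF n] unfolding x_def c0_def k_def by linarith
  have k1: "real (Suc k) \<ge> 1" by simp
  have op: "sized_op (\<lambda>j. ln (1 + real j)) n = real b * (\<integral>p. p * bin_exp k (\<lambda>j. ln (c + real j)) p \<partial>L)"
    by (simp add: sized_op_def k_def c_def add.assoc)
  have int: "integrable L (\<lambda>p. p * bin_exp k (\<lambda>j. ln (c + real j)) p)" by (rule integrable_times_bin_exp)
  have "(\<integral>p. p * bin_exp k (\<lambda>j. ln (c + real j)) p \<partial>L) \<le> (\<integral>p. ln x * p + p * ln p + c / x \<partial>L)"
  proof (intro integral_unit_mono int integral_affine_entropy(1))
    fix p :: real assume p: "0 \<le> p" "p \<le> 1"
    show "p * bin_exp k (\<lambda>j. ln (c + real j)) p \<le> ln x * p + p * ln p + c / x"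
    proof (cases "p = 0")
      case True
      then show ?thesis using x c by simp
    next
      case False
      then have p0: "p > 0" using p by simp
      have "bin_exp k (\<lambda>j. ln (c + real j)) p \<le> ln (c + real k * p)" using p c by (intro bin_exp_ln_le) auto
      also have "\<dots> \<le> ln (c + x * p)"
      proof -
        have "real k * p \<le> x * p" using kx c0 p by (intro mult_right_mono) auto
        moreover have "c + real k * p > 0" using c p by (intro add_pos_nonneg) auto
        ultimately show ?thesis by simp
      qed
      also have "\<dots> \<le> ln (x * p) + (c + x * p - x * p) / (x * p)"
        using x p0 c by (intro ln_tangent_le add_pos_pos) auto
      also have "\<dots> = ln x + ln p + c / (x * p)" using x p0 by (simp add: ln_mult)
      finally have "p * bin_exp k (\<lambda>j. ln (c + real j)) p \<le> p * (ln x + ln p + c / (x * p))"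
        using p by (intro mult_left_mono)
      also have "\<dots> = ln x * p + p * ln p + c / x" using p0 x by (simp add: field_simps)
      finally show ?thesis .
    qed
  qed
  then have "real b * (\<integral>p. p * bin_exp k (\<lambda>j. ln (c + real j)) p \<partial>L) \<le> real b * (\<integral>p. ln x * p + p * ln p + c / x \<partial>L)"
    by (intro mult_left_mono) auto
  then have upper: "sized_op (\<lambda>j. ln (1 + real j)) n \<le> ln x - mu + real b * (c / x)"
    unfolding integral_affine_entropy(2) op .
  \<comment> \<open>The term \<open>c0 * (c0 + 1) / x\<close> bounds the loss
    \<open>c0 / (x - c0)\<close> in replacing \<open>x\<close> by \<open>Suc k\<close>, because
    \<open>Suc k \<ge> 1\<close> gives \<open>x \<le> (c0 + 1) * Suc k\<close>.\<close>
  define \<gamma> where "\<gamma> = ln x - c0 * (c0 + 1) / x"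
  have "(\<integral>p. \<gamma> * p + p * ln p + 0 \<partial>L) \<le> (\<integral>p. p * bin_exp k (\<lambda>j. ln (c + real j)) p \<partial>L)"
  proof (intro integral_unit_mono int integral_affine_entropy(1))
    fix p :: real assume p: "0 \<le> p" "p \<le> 1"
    show "\<gamma> * p + p * ln p + 0 \<le> p * bin_exp k (\<lambda>j. ln (c + real j)) p"
    proof (cases "p = 0")
      case False
      then have p0: "p > 0" using p by simp
      have "ln x \<le> ln (real (Suc k)) + (x - real (Suc k)) / real (Suc k)"
        using x by (intro ln_tangent_le) auto
      moreover have "(x - real (Suc k)) / real (Suc k) \<le> c0 * (c0 + 1) / x"
      proof -
        have "x \<le> (c0 + 1) * real (Suc k)"
          using mult_left_mono[OF k1 c0] kx by (simp add: algebra_simps)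
        then have "c0 * x \<le> c0 * ((c0 + 1) * real (Suc k))" using c0 by (intro mult_left_mono)
        moreover have "x - real (Suc k) = c0" using kx by simp
        ultimately show ?thesis using x k1 by (simp add: field_simps del: of_nat_Suc)
      qed
      ultimately have "\<gamma> \<le> ln (real (Suc k))" by (simp add: \<gamma>_def del: of_nat_Suc)
      then have "\<gamma> + ln p \<le> ln (real (Suc k) * p)" using p0 by (simp add: ln_mult del: of_nat_Suc)
      also have "\<dots> \<le> bin_exp k (\<lambda>j. ln (1 + real j)) p" using p0 p by (intro bin_exp_ln_ge) auto
      also have "\<dots> \<le> bin_exp k (\<lambda>j. ln (c + real j)) p" using p c by (intro bin_exp_mono) auto
      finally have "p * (\<gamma> + ln p) \<le> p * bin_exp k (\<lambda>j. ln (c + real j)) p"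
        using p by (intro mult_left_mono)
      then show ?thesis by (simp add: algebra_simps)
    qed simp
  qed
  then have "real b * (\<integral>p. \<gamma> * p + p * ln p + 0 \<partial>L) \<le> real b * (\<integral>p. p * bin_exp k (\<lambda>j. ln (c + real j)) p \<partial>L)"
    by (intro mult_left_mono) auto
  then have lower: "\<gamma> - mu \<le> sized_op (\<lambda>j. ln (1 + real j)) n"
    unfolding integral_affine_entropy(2) op by simp
  have "0 \<le> real b * c / x" "0 \<le> c0 * (c0 + 1) / x" using x c c0 by auto
  then have "\<bar>sized_op (\<lambda>j. ln (1 + real j)) n - (ln x - mu)\<bar> \<le> real b * c / x + c0 * (c0 + 1) / x"
    using upper lower by (simp add: \<gamma>_def abs_le_iff)
  then show ?thesis by (simp add: x_def c_def add_divide_distrib)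
qed

text \<open>This is the expectation of \<open>1 / sqrt W\<close> for the size-biased component
  \<open>W\<close>, since the weight \<open>b * p\<close> times \<open>1 / sqrt p\<close> is
  \<open>b * sqrt p\<close>.\<close>

definition kappa :: real where
  "kappa = real b * (\<integral>p. sqrt p \<partial>L)"

lemma integrable_sqrt: "integrable L sqrt"
  by (rule integrable_unit[of _ 1]) auto

lemma kappa_gt_1: "kappa > 1"
proof -
  have "(\<integral>p. p \<partial>L) < (\<integral>p. sqrt p \<partial>L)"
  proof (rule integral_unit_less[OF integrable_id integrable_sqrt])
    fix p :: real
    show "p \<le> sqrt p" if "0 \<le> p" "p \<le> 1"
      using that by (intro real_le_rsqrt) (auto simp: power2_eq_square mult_left_le)
    show "p < sqrt p" if "0 < p" "p < 1"
      using that by (intro real_less_rsqrt) (auto simp: power2_eq_square)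
  qed
  then have "real b * (\<integral>p. p \<partial>L) < real b * (\<integral>p. sqrt p \<partial>L)"
    using b_ge2 by (intro mult_strict_left_mono) auto
  then show ?thesis using mean by (simp add: kappa_def)
qed

text \<open>Convexity moves the expectation inside, and
  \<open>sqrt (c + x * p) \<le> sqrt c + sqrt (x * p)\<close> separates \<open>p\<close> from
  \<open>x\<close>. As for the logarithm, the factor \<open>p\<close> makes the remainder uniform in
  \<open>p\<close>.\<close>

lemma sized_op_inverse_sqrt:
  assumes n: "n > s"
  shows "kappa / sqrt (1 + real n) - real b * sqrt (1 + real s1) / (1 + real n)
    \<le> sized_op (\<lambda>j. 1 / sqrt (1 + real j)) n"
proof -
  define x where "x = 1 + real n"
  define c where "c = 1 + real s1"
  define k where "k = rest n"
  have x: "x \<ge> 1" by (simp add: x_def)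
  have c: "c \<ge> 1" by (simp add: c_def)
  have kx: "real k \<le> x" using rest_plus[OF n] unfolding x_def k_def by linarith
  have "(\<integral>p. sqrt p / sqrt x - sqrt c / x \<partial>L) \<le> (\<integral>p. p * bin_exp k (\<lambda>j. 1 / sqrt (c + real j)) p \<partial>L)"
  proof (intro integral_unit_mono integrable_times_bin_exp)
    show "integrable L (\<lambda>p. sqrt p / sqrt x - sqrt c / x)" using integrable_sqrt by auto
    fix p :: real assume p: "0 \<le> p" "p \<le> 1"
    show "sqrt p / sqrt x - sqrt c / x \<le> p * bin_exp k (\<lambda>j. 1 / sqrt (c + real j)) p"
    proof (cases "p = 0")
      case True
      then show ?thesis using x c by simp
    next
      case False
      define q y d where "q = sqrt p" and "y = sqrt x" and "d = sqrt c"
      have q: "q > 0" "y > 0" "d > 0" "p = q * q" "x = y * y"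
        using False p x c by (auto simp: q_def y_def d_def)
      have "sqrt (c + real k * p) \<le> sqrt (c + x * p)" using kx p by (auto intro: mult_right_mono)
      also have "\<dots> \<le> d + y * q"
        unfolding d_def q_def y_def real_sqrt_mult[symmetric] using c x p by (intro sqrt_add_le_add_sqrt) auto
      finally have le: "sqrt (c + real k * p) \<le> d + y * q" .
      have pos: "0 < sqrt (c + real k * p)" using c p by (auto intro: add_pos_nonneg)
      \<comment> \<open>This is the exact slack in replacing \<open>p / (d + y * q)\<close> by
        \<open>q / y - d / (y * y)\<close>.\<close>
      have "0 \<le> d * d / (y * y * (d + y * q))"
        using q by (intro divide_nonneg_pos mult_pos_pos add_pos_pos) auto
      also have "\<dots> = p * (1 / (d + y * q)) - (q / y - d / (y * y))"
      proof -
        have "d + y * q \<noteq> 0" using q by (metis add_pos_pos less_irrefl mult_pos_pos)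
        then show ?thesis using q(1-3) unfolding q(4) by (simp add: divide_simps) (simp add: algebra_simps)
      qed
      finally have "sqrt p / sqrt x - sqrt c / x \<le> p * (1 / (d + y * q))"
        unfolding q_def[symmetric] y_def[symmetric] d_def[symmetric] q(5)[symmetric] by simp
      also have "\<dots> \<le> p * (1 / sqrt (c + real k * p))"
        using p le pos q by (intro mult_left_mono divide_left_mono mult_pos_pos add_pos_pos) auto
      also have "\<dots> \<le> p * bin_exp k (\<lambda>j. 1 / sqrt (c + real j)) p"
        using p c by (intro mult_left_mono bin_exp_inverse_sqrt_ge) auto
      finally show ?thesis .
    qed
  qed
  then have "real b * (\<integral>p. sqrt p / sqrt x - sqrt c / x \<partial>L)
      \<le> real b * (\<integral>p. p * bin_exp k (\<lambda>j. 1 / sqrt (c + real j)) p \<partial>L)"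
    by (intro mult_left_mono) auto
  moreover have "(\<integral>p. sqrt p / sqrt x - sqrt c / x \<partial>L) = (\<integral>p. sqrt p \<partial>L) / sqrt x - sqrt c / x"
    using integrable_sqrt by simp
  ultimately show ?thesis
    by (simp add: sized_op_def kappa_def x_def c_def k_def add.assoc right_diff_distrib)
qed

text \<open>\<open>\<Phi>\<close> is a barrier: the operator lowers it by at least about
  \<open>(kappa - 1) / sqrt n\<close>, which exceeds the perturbation \<open>c / n\<close> once
  \<open>n \<ge> n0\<close>. The maximum principle then compares \<open>w\<close> with
  \<open>\<Phi> \<le> A\<close>.\<close>

lemma sized_op_perturbed_bounded_above:
  assumes w: "\<And>n. n > s \<Longrightarrow> w n \<le> c / (1 + real n) + sized_op w n"
  shows "\<exists>A. \<forall>n. w n \<le> A"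
proof -
  define d where "d = real b * sqrt (1 + real s1)"
  \<comment> \<open>Chosen so that \<open>sqrt x * (kappa - 1) \<ge> \<bar>c\<bar> + d\<close> from
    \<open>N\<close> on: the gain beats both the perturbation and the error \<open>d / x\<close> of
    the inverse square root.\<close>
  obtain N :: nat where N: "((\<bar>c\<bar> + d) / (kappa - 1))\<^sup>2 < real N" using reals_Archimedean2 by blast
  define n0 where "n0 = max (Suc s) N"
  \<comment> \<open>The summand 1 compensates for \<open>1 / sqrt (1 + real n) \<le> 1\<close>, so
    that \<open>w\<close> lies below the barrier for \<open>n < n0\<close>.\<close>
  define A where "A = 1 + (\<Sum>j<n0. \<bar>w j\<bar>)"
  define \<Phi> where "\<Phi> n = A - 1 / sqrt (1 + real n)" for n :: nat
  have "w n - \<Phi> n \<le> 0" for n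
  proof (rule maximum_principle[of n0])
    show "n0 > s" by (simp add: n0_def)
    fix n
    show "w n - \<Phi> n \<le> 0" if n: "n < n0"
    proof -
      have "\<bar>w n\<bar> \<le> (\<Sum>j<n0. \<bar>w j\<bar>)" using n by (intro member_le_sum) auto
      moreover have "1 / sqrt (1 + real n) \<le> 1" by simp
      ultimately show ?thesis unfolding \<Phi>_def A_def by linarith
    qed
    assume n: "n \<ge> n0"
    then have ns: "n > s" by (simp add: n0_def)
    define x where "x = 1 + real n"
    have x: "x \<ge> 1" by (simp add: x_def)
    have "(\<bar>c\<bar> + d) / (kappa - 1) \<le> sqrt x"
      using N n by (intro real_le_rsqrt) (simp add: x_def n0_def)
    then have le: "\<bar>c\<bar> + d \<le> sqrt x * (kappa - 1)" using kappa_gt_1 by (simp add: field_simps)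
    have "sized_op \<Phi> n = A - sized_op (\<lambda>j. 1 / sqrt (1 + real j)) n"
      unfolding \<Phi>_def sized_op_diff by simp
    also have "\<dots> \<le> A - (kappa / sqrt x - d / x)"
      using sized_op_inverse_sqrt[OF ns] by (simp add: x_def d_def)
    also have "\<dots> = \<Phi> n - (sqrt x * (kappa - 1) - d) / x"
    proof -
      have "1 / sqrt x = sqrt x / x" using x by (simp add: real_div_sqrt field_simps)
      then have "kappa * (1 / sqrt x) = kappa * (sqrt x / x)" by (rule arg_cong)
      then have "kappa / sqrt x = sqrt x * kappa / x" by (simp add: mult.commute)
      then show ?thesis using \<open>1 / sqrt x = sqrt x / x\<close>
        by (simp add: \<Phi>_def x_def[symmetric] diff_divide_distrib right_diff_distrib)
    qed
    also have "\<dots> \<le> \<Phi> n - c / x" using le x by (intro diff_left_mono divide_right_mono) auto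
    finally have "c / x + sized_op \<Phi> n \<le> \<Phi> n" by simp
    then show "w n - \<Phi> n \<le> sized_op (\<lambda>n. w n - \<Phi> n) n"
      unfolding sized_op_diff using w[OF ns] by (simp add: x_def)
  qed
  then have "w n \<le> A" for n by (smt (verit) \<Phi>_def divide_nonneg_nonneg of_nat_0_le_iff real_sqrt_ge_zero)
  then show ?thesis by blast
qed

lemma sized_op_perturbed_bounded:
  assumes w: "\<And>n. n > s \<Longrightarrow> \<bar>w n - sized_op w n\<bar> \<le> c / (1 + real n)"
  shows "\<exists>A. \<forall>n. \<bar>w n\<bar> \<le> A"
proof -
  obtain A where A: "\<And>n. w n \<le> A"
    using sized_op_perturbed_bounded_above[of w c] w by (force simp: abs_le_iff)
  have "sized_op (\<lambda>n. - w n) n = - sized_op w n" for n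
    using sized_op_cmult[of "-1" w n] by simp
  then obtain B where B: "\<And>n. - w n \<le> B"
    using sized_op_perturbed_bounded_above[of "\<lambda>n. - w n" c] w by (force simp: abs_le_iff)
  have "\<bar>w n\<bar> \<le> max A B" for n using A[of n] B[of n] by (auto simp: abs_le_iff)
  then show ?thesis by blast
qed

section \<open>From the integer recursion to an approximate equation in a real variable\<close>

text \<open>The constants are arranged so that one bound \<open>C * sqrt x\<close> holds for all
  \<open>x \<ge> 1\<close>, including small \<open>x\<close> where the recursion does not apply;
  dividing by \<open>x = exp t\<close> later gives the error \<open>exp (- t / 2)\<close>.\<close>

lemma path_recursion_interpolation:
  fixes e :: "nat \<Rightarrow> real"
  assumes e0: "\<And>n. n \<le> s \<Longrightarrow> e n = 0"
    and eS: "\<And>n. n > s \<Longrightarrow> e n = real n - real s0 + split_op e n"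
  obtains T :: "real \<Rightarrow> real" and c C where
    "\<And>n. e n = T (real n) + ln (fact n) / mu" "T 0 = 0"
    "\<And>x y. \<bar>T x - T y\<bar> \<le> c * \<bar>x - y\<bar>"
    "\<And>x. x \<ge> 1 \<Longrightarrow> \<bar>T x - real b * (\<integral>p. T (x * p) \<partial>L)\<bar> \<le> C * sqrt x"
proof -
  define a where "a n = e (Suc n) - e n" for n
  define w where "w n = a n - ln (1 + real n) / mu" for n
  define \<epsilon> where "\<epsilon> n = w n - sized_op w n" for n
  define c0 where "c0 = real (s0 + b * s1)"
  define c1 where "c1 = (real b * (1 + real s1) + c0 * (c0 + 1)) / mu"
  have c1: "c1 \<ge> 0" using mu_pos by (simp add: c1_def c0_def)
  \<comment> \<open>The 1 is the increment of the toll \<open>n - s0\<close>.\<close>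
  have a_rec: "a n = 1 + sized_op a n" if n: "n > s" for n
    using split_op_Suc[OF n, of e] eS[of n] eS[of "Suc n"] n unfolding a_def by simp
  have \<epsilon>: "\<bar>\<epsilon> n\<bar> \<le> c1 / (1 + real n)" if n: "n > s" for n
  proof -
    have "w = (\<lambda>n. a n - 1 / mu * ln (1 + real n))" by (simp add: w_def fun_eq_iff)
    then have "sized_op w n = sized_op a n - 1 / mu * sized_op (\<lambda>j. ln (1 + real j)) n"
      by (simp only: sized_op_diff sized_op_cmult)
    then have "\<epsilon> n = 1 - ln (1 + real n) / mu + 1 / mu * sized_op (\<lambda>j. ln (1 + real j)) n"
      using a_rec[OF n] by (simp add: \<epsilon>_def w_def)
    also have "\<dots> = (sized_op (\<lambda>j. ln (1 + real j)) n - (ln (1 + real n) - mu)) / mu"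
      using mu_pos by (simp add: field_simps)
    finally have "\<bar>\<epsilon> n\<bar> = \<bar>sized_op (\<lambda>j. ln (1 + real j)) n - (ln (1 + real n) - mu)\<bar> / mu"
      using mu_pos by simp
    also have "\<dots> \<le> (real b * (1 + real s1) + c0 * (c0 + 1)) / (1 + real n) / mu"
      using mu_pos sized_op_ln[OF n] unfolding c0_def by (intro divide_right_mono) auto
    also have "\<dots> = c1 / (1 + real n)" by (simp add: c1_def)
    finally show ?thesis .
  qed
  then obtain c where w_bound: "\<And>n. \<bar>w n\<bar> \<le> c"
    using sized_op_perturbed_bounded[of w c1] unfolding \<epsilon>_def by blast
  have c_nonneg: "c \<ge> 0" using w_bound[of 0] by linarith
  define S where "S n = e n - ln (fact n) / mu" for n
  have S_Suc: "S (Suc n) - S n = w n" for n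
    by (simp add: S_def w_def a_def ln_mult add_divide_distrib)
  have S_mono: "\<bar>S (j + i) - S j\<bar> \<le> c * real i" for i j
  proof (induction i)
    case (Suc i)
    then show ?case using S_Suc[of "j + i"] w_bound[of "j + i"] by (simp add: algebra_simps abs_le_iff)
  qed simp
  have S_lip: "\<bar>S j - S k\<bar> \<le> c * \<bar>real j - real k\<bar>" for j k
    using S_mono[of j "k - j"] S_mono[of k "j - k"] by (cases "j \<le> k") (auto simp: of_nat_diff abs_minus_commute)
  obtain T where T: "\<And>k. T (real k) = S k" and T_lip: "\<And>x y. \<bar>T x - T y\<bar> \<le> c * \<bar>x - y\<bar>"
    using McShane_extension[OF S_lip] by blast
  have T0: "T 0 = 0" using T[of 0] e0[of 0] by (simp add: S_def)
  have T_cont: "continuous_on UNIV T"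
    by (rule lipschitz_on_continuous_on[of c]) (use T_lip c_nonneg in \<open>auto simp: lipschitz_on_def dist_real_def\<close>)
  have [measurable]: "T \<in> borel_measurable borel"
    by (intro borel_measurable_continuous_onI T_cont)
  have T_int: "integrable L (\<lambda>p. T (x * p))" for x
  proof (rule integrable_unit[of _ "c * \<bar>x\<bar>"])
    fix p :: real assume p: "0 \<le> p" "p \<le> 1"
    have "\<bar>T (x * p)\<bar> \<le> c * \<bar>x * p\<bar>" using T_lip[of "x * p" 0] T0 by simp
    also have "\<dots> \<le> c * \<bar>x\<bar>" using p c_nonneg by (intro mult_left_mono) (auto simp: abs_mult mult_left_le)
    finally show "\<bar>T (x * p)\<bar> \<le> c * \<bar>x\<bar>" .
  qed simp
  have b_int: "\<bar>real b * (\<integral>p. f p \<partial>L) - real b * (\<integral>p. g p \<partial>L)\<bar> \<le> real b * A"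
    if f: "integrable L f" and g: "integrable L g" and fg: "\<And>p. \<lbrakk>0 \<le> p; p \<le> 1\<rbrakk> \<Longrightarrow> \<bar>f p - g p\<bar> \<le> A"
    for f g :: "real \<Rightarrow> real" and A
  proof -
    have "\<bar>(\<integral>p. f p \<partial>L) - (\<integral>p. g p \<partial>L)\<bar> = \<bar>\<integral>p. f p - g p \<partial>L\<bar>"
      using f g by simp
    also have "\<dots> \<le> (\<integral>p. \<bar>f p - g p\<bar> \<partial>L)" by (rule integral_abs_bound)
    also have "\<dots> \<le> (\<integral>p. A \<partial>L)" using f g fg by (intro integral_unit_mono) auto
    finally have "\<bar>(\<integral>p. f p \<partial>L) - (\<integral>p. g p \<partial>L)\<bar> \<le> A" by simp
    then have "real b * \<bar>(\<integral>p. f p \<partial>L) - (\<integral>p. g p \<partial>L)\<bar> \<le> real b * A" by (intro mult_left_mono) auto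
    then show ?thesis by (simp add: right_diff_distrib[symmetric] abs_mult)
  qed
  \<comment> \<open>\<open>U\<close> is the defect of \<open>S\<close> in the recursion without
    toll. Its increments are the \<open>\<epsilon> n\<close>, so it grows at most like the sum of
    \<open>c1 / (1 + n)\<close>; the cruder bound by \<open>sqrt n\<close> suffices, since the
    binomial fluctuations are of that order.\<close>
  define U where "U n = S n - split_op S n" for n
  define c2 where "c2 = \<bar>U (Suc s)\<bar> + 2 * c1"
  have U_bound: "\<bar>U n\<bar> \<le> \<bar>U (Suc s)\<bar> + 2 * c1 * sqrt (real n)" if "n \<ge> Suc s" for n
    using that
  proof (induction n rule: dec_induct)
    case base
    then show ?case using c1 by simp
  next
    case (step n)
    then have n: "n > s" by simp
    have "split_op S (Suc n) - split_op S n = sized_op w n"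
      using split_op_Suc[OF n, of S] by (simp add: S_Suc)
    then have "U (Suc n) - U n = \<epsilon> n"
      using S_Suc[of n] unfolding U_def \<epsilon>_def by linarith
    then have "\<bar>U (Suc n)\<bar> \<le> \<bar>U n\<bar> + c1 * (1 / (1 + real n))" using \<epsilon>[OF n] by simp
    \<comment> \<open>The right-hand side telescopes; the inequality rests on
      \<open>(p - q) * (p + q) = 1\<close> for consecutive square roots.\<close>
    also have "1 / (1 + real n) \<le> 2 * (sqrt (1 + real n) - sqrt (real n))"
    proof -
      define p q where "p = sqrt (1 + real n)" and "q = sqrt (real n)"
      have pq: "p \<ge> 1" "q \<ge> 0" "q \<le> p" "p * p = 1 + real n" "q * q = real n" by (auto simp: p_def q_def)
      have "(p - q) * (p + q) = 1" using pq by (simp add: algebra_simps)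
      then have "1 \<le> (p - q) * (2 * p)" using pq mult_left_mono[of "p + q" "2 * p" "p - q"] by simp
      also have "\<dots> \<le> (p - q) * (2 * (p * p))"
        using pq mult_left_mono[of 1 p p] by (intro mult_left_mono) auto
      finally show ?thesis unfolding p_def[symmetric] q_def[symmetric] pq(4)[symmetric] using pq(1)
        by (simp add: field_simps)
    qed
    then have "c1 * (1 / (1 + real n)) \<le> c1 * (2 * (sqrt (1 + real n) - sqrt (real n)))"
      using c1 by (intro mult_left_mono)
    finally show ?case using step.IH by (simp add: algebra_simps)
  qed
  have U_bound': "\<bar>U n\<bar> \<le> c2 * sqrt (real n)" if "n > s" for n
  proof -
    have "1 \<le> sqrt (real n)" using that by simp
    then have "\<bar>U (Suc s)\<bar> * 1 \<le> \<bar>U (Suc s)\<bar> * sqrt (real n)" by (intro mult_left_mono) auto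
    then show ?thesis using U_bound[of n] that by (simp add: c2_def algebra_simps)
  qed
  \<comment> \<open>A child cardinality \<open>s1 + j\<close> differs from \<open>n * p\<close> by
    at most the shift \<open>s1\<close>, the \<open>c0\<close> items outside the multinomial draw,
    and the binomial deviation \<open>\<bar>j - k * p\<bar>\<close>.\<close>
  define c3 where "c3 = c * (real s1 + c0 + 1)"
  have c3: "c3 \<ge> 0" using c_nonneg by (simp add: c3_def c0_def)
  have op_T: "\<bar>split_op S n - real b * (\<integral>p. T (real n * p) \<partial>L)\<bar> \<le> real b * (c3 * sqrt (1 + real n))" if n: "n > s" for n
    unfolding split_op_def
  proof (intro b_int integrable_bin_exp T_int)
    fix p :: real assume p: "0 \<le> p" "p \<le> 1"
    define k where "k = rest n"
    have nk: "real n = real k + c0" using rest_plus[OF n] unfolding k_def c0_def by linarith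
    have "bin_exp k (\<lambda>j. S (s1 + j)) p - T (real n * p) = bin_exp k (\<lambda>j. S (s1 + j) - T (real n * p)) p"
      by (simp add: bin_exp_diff)
    also have "\<bar>\<dots>\<bar> \<le> bin_exp k (\<lambda>j. \<bar>S (s1 + j) - T (real n * p)\<bar>) p" by (intro bin_exp_abs_le p)
    also have "\<dots> \<le> bin_exp k (\<lambda>j. c * (real s1 + c0) + c * \<bar>real j - real k * p\<bar>) p"
    proof (intro bin_exp_mono p)
      fix j
      have "\<bar>S (s1 + j) - T (real n * p)\<bar> \<le> c * \<bar>real (s1 + j) - real n * p\<bar>"
        unfolding T[symmetric] by (rule T_lip)
      also have "\<dots> \<le> c * (real s1 + c0 + \<bar>real j - real k * p\<bar>)"
      proof (intro mult_left_mono c_nonneg)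
        have "c0 \<ge> 0" by (simp add: c0_def)
        then have "0 \<le> c0 * p" "c0 * p \<le> c0" using p by (auto simp: mult_left_le)
        then show "\<bar>real (s1 + j) - real n * p\<bar> \<le> real s1 + c0 + \<bar>real j - real k * p\<bar>"
          unfolding nk by (simp add: distrib_right)
      qed
      finally show "\<bar>S (s1 + j) - T (real n * p)\<bar> \<le> c * (real s1 + c0) + c * \<bar>real j - real k * p\<bar>"
        by (simp add: distrib_left)
    qed
    also have "\<dots> = c * (real s1 + c0) + c * bin_exp k (\<lambda>j. \<bar>real j - real k * p\<bar>) p"
      unfolding bin_exp_add bin_exp_cmult by simp
    also have "\<dots> \<le> c * (real s1 + c0) * sqrt (1 + real n) + c * sqrt (1 + real n)"
    proof (intro add_mono mult_left_mono c_nonneg)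
      have "c * (real s1 + c0) * 1 \<le> c * (real s1 + c0) * sqrt (1 + real n)"
        using c_nonneg by (intro mult_left_mono) (auto simp: c0_def)
      then show "c * (real s1 + c0) \<le> c * (real s1 + c0) * sqrt (1 + real n)" by simp
      have "bin_exp k (\<lambda>j. \<bar>real j - real k * p\<bar>) p \<le> sqrt (real k + 1)" by (rule bin_exp_abs_dev[OF p])
      also have "\<dots> \<le> sqrt (1 + real n)" using nk by (simp add: c0_def)
      finally show "bin_exp k (\<lambda>j. \<bar>real j - real k * p\<bar>) p \<le> sqrt (1 + real n)" .
    qed
    finally show "\<bar>bin_exp (rest n) (\<lambda>j. S (s1 + j)) p - T (real n * p)\<bar> \<le> c3 * sqrt (1 + real n)"
      by (simp add: k_def c3_def algebra_simps)
  qed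
  \<comment> \<open>The bracket collects the defect \<open>U\<close>, the binomial fluctuations and
    the rounding of \<open>x\<close> to \<open>n\<close> on both sides of the equation. The last
    summand serves \<open>x < s + 1\<close>, where
    \<open>x \<le> sqrt (s + 1) * sqrt x\<close>.\<close>
  define C where "C = (c2 + real b * c3 * 2 + c + real b * c) + 2 * c * sqrt (real s + 1)"
  have c2: "c2 \<ge> 0" using c1 by (simp add: c2_def)
  have main: "\<bar>T x - real b * (\<integral>p. T (x * p) \<partial>L)\<bar> \<le> C * sqrt x" if x: "x \<ge> 1" for x
  proof (cases "x < real s + 1")
    case True
    have Tx: "\<bar>T y\<bar> \<le> c * \<bar>y\<bar>" for y using T_lip[of y 0] T0 by simp
    have "\<bar>\<integral>p. T (x * p) \<partial>L\<bar> \<le> (\<integral>p. \<bar>T (x * p)\<bar> \<partial>L)" by (rule integral_abs_bound)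
    also have "\<dots> \<le> (\<integral>p. c * x * p \<partial>L)"
      using x Tx T_int by (intro integral_unit_mono) (auto simp: integrable_id abs_mult intro: order.trans[OF Tx])
    also have "\<dots> = c * x * (\<integral>p. p \<partial>L)" by simp
    finally have "real b * \<bar>\<integral>p. T (x * p) \<partial>L\<bar> \<le> real b * (c * x * (\<integral>p. p \<partial>L))" by (intro mult_left_mono) auto
    also have "\<dots> = c * x" using mean by (simp add: mult.left_commute)
    finally have "\<bar>real b * (\<integral>p. T (x * p) \<partial>L)\<bar> \<le> c * x" by (simp add: abs_mult)
    then have "\<bar>T x - real b * (\<integral>p. T (x * p) \<partial>L)\<bar> \<le> 2 * c * x" using Tx[of x] x by simp
    also have "\<dots> = 2 * c * (sqrt x * sqrt x)" using x by simp
    also have "\<dots> \<le> 2 * c * (sqrt (real s + 1) * sqrt x)"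
      using True x c_nonneg by (intro mult_left_mono mult_right_mono) auto
    also have "\<dots> \<le> C * sqrt x"
      using x c2 c3 c_nonneg by (auto simp: C_def mult.assoc[symmetric] intro!: mult_right_mono)
    finally show ?thesis .
  next
    case False
    define n where "n = nat \<lfloor>x\<rfloor>"
    have nx: "real n \<le> x" "x < real n + 1" using x by (auto simp: n_def)
    have n: "n > s" using False nx by simp
    have "\<bar>T x - T (real n)\<bar> \<le> c * \<bar>x - real n\<bar>" by (rule T_lip)
    also have "\<dots> \<le> c * 1" using nx c_nonneg by (intro mult_left_mono) auto
    finally have 1: "\<bar>T x - S n\<bar> \<le> c" by (simp add: T)
    have 2: "\<bar>S n - split_op S n\<bar> \<le> c2 * sqrt x"
      using U_bound'[OF n] mult_left_mono[of "sqrt (real n)" "sqrt x" c2] nx c2 by (simp add: U_def)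
    have "sqrt (1 + real n) \<le> sqrt (4 * x)" using nx x by (intro real_sqrt_le_mono) simp
    then have "real b * (c3 * sqrt (1 + real n)) \<le> real b * (c3 * (2 * sqrt x))"
      using c3 by (intro mult_left_mono) (auto simp: real_sqrt_mult)
    then have 3: "\<bar>split_op S n - real b * (\<integral>p. T (real n * p) \<partial>L)\<bar> \<le> real b * c3 * 2 * sqrt x"
      using op_T[OF n] by simp
    have 4: "\<bar>real b * (\<integral>p. T (real n * p) \<partial>L) - real b * (\<integral>p. T (x * p) \<partial>L)\<bar> \<le> real b * c"
    proof (intro b_int T_int)
      fix p :: real assume p: "0 \<le> p" "p \<le> 1"
      have "\<bar>T (real n * p) - T (x * p)\<bar> \<le> c * \<bar>real n * p - x * p\<bar>" by (rule T_lip)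
      also have "\<dots> \<le> c * 1"
      proof (intro mult_left_mono c_nonneg)
        have "\<bar>real n - x\<bar> * p \<le> 1 * 1" using nx p by (intro mult_mono) auto
        then show "\<bar>real n * p - x * p\<bar> \<le> 1" using p by (simp add: abs_mult left_diff_distrib[symmetric])
      qed
      finally show "\<bar>T (real n * p) - T (x * p)\<bar> \<le> c" by simp
    qed
    have sx: "1 \<le> sqrt x" using x by simp
    have "c \<le> c * sqrt x" "real b * c \<le> real b * c * sqrt x"
      using mult_left_mono[OF sx, of c] mult_left_mono[OF sx, of "real b * c"] c_nonneg by auto
    then have "\<bar>T x - real b * (\<integral>p. T (x * p) \<partial>L)\<bar> \<le> c * sqrt x + c2 * sqrt x + real b * c3 * 2 * sqrt x + real b * c * sqrt x"
      using 1 2 3 4 by linarith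
    also have "\<dots> = (c2 + real b * c3 * 2 + c + real b * c) * sqrt x" by (simp add: algebra_simps)
    also have "\<dots> \<le> C * sqrt x" using c_nonneg x by (intro mult_right_mono) (auto simp: C_def)
    finally show ?thesis .
  qed
  show thesis
    by (rule that[OF _ T0 T_lip main]) (simp add: T S_def)
qed

end

subsection \<open>Asymptotics of the path length recursion\<close>

text \<open>A first-order Stirling estimate: induction with \<open>ln_tangent_le\<close> between
  \<open>n\<close> and \<open>Suc n\<close>, used in both directions.\<close>

lemma ln_fact_bounds:
  assumes "n \<ge> 1"
  shows "real n * ln (real n) - real n \<le> ln (fact n)"
    and "ln (fact n) \<le> real n * ln (real n) - real n + ln (real n) + 1"
  using assms
proof (induction n rule: dec_induct)
  case (step n)
  have n: "real n > 0" using step by simp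
  have fact: "ln (fact (Suc n)) = ln (fact n :: real) + ln (real (Suc n))"
    by (simp add: ln_mult del: of_nat_Suc)
  have "real n * ln (real (Suc n)) \<le> real n * (ln (real n) + 1 / real n)"
    using ln_tangent_le[of "real (Suc n)" "real n"] n by (intro mult_left_mono) auto
  then have up: "real n * ln (real (Suc n)) \<le> real n * ln (real n) + 1" using n by (simp add: distrib_left)
  have "real (Suc n) * ln (real n) \<le> real (Suc n) * (ln (real (Suc n)) + (real n - real (Suc n)) / real (Suc n))"
    using ln_tangent_le[of "real n" "real (Suc n)"] n by (intro mult_left_mono) auto
  also have "\<dots> = real (Suc n) * ln (real (Suc n)) - 1"
    by (simp add: distrib_left del: of_nat_Suc)
  finally have lo: "real (Suc n) * ln (real n) \<le> real (Suc n) * ln (real (Suc n)) - 1" .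
  have eq: "real (Suc n) * ln (real (Suc n)) = real n * ln (real (Suc n)) + ln (real (Suc n))"
    "real (Suc n) * ln (real n) = real n * ln (real n) + ln (real n)"
    by (simp_all add: algebra_simps)
  { case 1 then show ?case using step.IH(1) up unfolding fact eq by simp }
  { case 2 then show ?case using step.IH(2) lo unfolding fact eq by simp }
qed auto

lemma ln_fact_over_n: "(\<lambda>n. ln (fact n) / real n - ln (real n)) \<longlonglongrightarrow> -1"
proof -
  have "(\<lambda>n. (ln (fact n) / real n - ln (real n)) - (- 1)) \<longlonglongrightarrow> 0"
  proof (rule Lim_null_comparison[of _ "\<lambda>n. (ln (real n) + 1) / real n"])
    show "\<forall>\<^sub>F n in sequentially. norm (ln (fact n) / real n - ln (real n) - - 1) \<le> (ln (real n) + 1) / real n"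
      using eventually_ge_at_top[of 1]
    proof eventually_elim
      case (elim n)
      have "ln (fact n) / real n - ln (real n) - - 1 = (ln (fact n) - (real n * ln (real n) - real n)) / real n"
        using elim by (simp add: field_simps)
      moreover have "\<bar>ln (fact n) - (real n * ln (real n) - real n)\<bar> \<le> ln (real n) + 1"
        using ln_fact_bounds[OF elim] elim by (simp add: abs_le_iff)
      ultimately show ?case by (simp add: abs_divide divide_right_mono)
    qed
    show "(\<lambda>n. (ln (real n) + 1) / real n) \<longlonglongrightarrow> 0" by real_asymp
  qed
  then show ?thesis by (rule LIM_zero_cancel)
qed

section \<open>The size-biased step law and its lattice\<close>

context split_law
begin

text \<open>The law of \<open>- ln W\<close> for the size-biased component \<open>W\<close>. The
  density \<open>b * p\<close> removes a possible atom of \<open>L\<close> at 0, so the default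
  value \<open>ln 0 = 0\<close> is never seen.\<close>

definition increment_law :: "real measure" where
  "increment_law = distr (density L (\<lambda>p. ennreal (real b * p))) borel (\<lambda>p. - ln p)"

lemma AE_size_bias_nonneg: "AE p in L. 0 \<le> real b * p"
  using AE_unit by eventually_elim auto

lemma sets_increment_law[measurable_cong, simp]: "sets increment_law = sets borel"
  by (simp add: increment_law_def)

lemma prob_space_increment_law: "prob_space increment_law"
proof -
  have "(\<integral>\<^sup>+p. ennreal (real b * p) \<partial>L) = ennreal (\<integral>p. real b * p \<partial>L)"
    using AE_size_bias_nonneg integrable_id by (intro nn_integral_eq_integral) auto
  also have "\<dots> = 1" using mean by simp
  finally have "emeasure (density L (\<lambda>p. ennreal (real b * p))) UNIV = 1"
    by (subst emeasure_density) auto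
  then interpret W: prob_space "density L (\<lambda>p. ennreal (real b * p))"
    by (intro prob_spaceI) simp
  show ?thesis unfolding increment_law_def by (intro W.prob_space_distr) measurable
qed

lemma AE_increment_law:
  assumes "{x. Q x} \<in> sets borel"
  shows "(AE x in increment_law. Q x) \<longleftrightarrow> (AE p in L. 0 < p \<longrightarrow> Q (- ln p))"
proof -
  have "(AE x in increment_law. Q x) \<longleftrightarrow> (AE p in density L (\<lambda>p. ennreal (real b * p)). Q (- ln p))"
    unfolding increment_law_def using assms by (subst AE_distr_iff) auto
  also have "\<dots> \<longleftrightarrow> (AE p in L. 0 < p \<longrightarrow> Q (- ln p))"
    using b_ge2 by (subst AE_density) (auto simp: zero_less_mult_iff)
  finally show ?thesis .
qed

lemma integral_increment_law:
  assumes [measurable]: "f \<in> borel_measurable borel"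
  shows "(\<integral>x. f x \<partial>increment_law) = (\<integral>p. real b * p * f (- ln p) \<partial>L)"
    and "integrable increment_law f \<longleftrightarrow> integrable L (\<lambda>p. real b * p * f (- ln p))"
proof -
  show "(\<integral>x. f x \<partial>increment_law) = (\<integral>p. real b * p * f (- ln p) \<partial>L)"
    unfolding increment_law_def using AE_size_bias_nonneg
    by (subst integral_distr, simp, simp, subst integral_density) auto
  show "integrable increment_law f \<longleftrightarrow> integrable L (\<lambda>p. real b * p * f (- ln p))"
    unfolding increment_law_def using AE_size_bias_nonneg
    by (subst integrable_distr_eq, simp, simp, subst integrable_density) auto
qed

lemma log_lattice_sets: "{x. \<exists>k::int. x = a * real_of_int k} \<in> sets borel"
  by measurable

text \<open>The disjunct \<open>x = 0\<close> in \<open>log_spans\<close> corresponds to the mass at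
  0 that size-biasing removes. The value \<open>a = 0\<close> drops out because it would force
  almost every positive component to be 1, against \<open>nondegenerate\<close>.\<close>

lemma log_spans_iff:
  "a \<in> log_spans L \<longleftrightarrow> a > 0 \<and> (AE x in increment_law. \<exists>k::int. x = a * real_of_int k)"
proof -
  define Q where "Q x \<longleftrightarrow> x = 0 \<or> (\<exists>k::int. ln x = a * of_int k)" for x
  have [measurable]: "Measurable.pred borel Q" unfolding Q_def by measurable
  have "a \<in> log_spans L \<longleftrightarrow> a \<ge> 0 \<and> (AE x in L. Q x)"
    unfolding log_spans_def Q_def[symmetric] mem_Collect_eq by (subst prob_Collect_eq_1) auto
  also have "(AE x in L. Q x) \<longleftrightarrow> (AE p in L. 0 < p \<longrightarrow> (\<exists>k::int. - ln p = a * real_of_int k))"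
  proof
    assume "AE x in L. Q x"
    with AE_unit show "AE p in L. 0 < p \<longrightarrow> (\<exists>k::int. - ln p = a * real_of_int k)"
    proof eventually_elim
      case (elim p)
      show ?case
      proof
        assume "0 < p"
        then obtain k :: int where "ln p = a * of_int k" using elim by (auto simp: Q_def)
        then show "\<exists>k::int. - ln p = a * real_of_int k" by (intro exI[of _ "- k"]) simp
      qed
    qed
  next
    assume "AE p in L. 0 < p \<longrightarrow> (\<exists>k::int. - ln p = a * real_of_int k)"
    with AE_unit show "AE x in L. Q x"
    proof eventually_elim
      case (elim p)
      show ?case
      proof (cases "p = 0")
        case False
        then obtain k :: int where "- ln p = a * real_of_int k" using elim by auto
        then have "ln p = a * of_int (- k)" by simp
        then show ?thesis unfolding Q_def by blast
      qed (simp add: Q_def)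
    qed
  qed
  also have "\<dots> \<longleftrightarrow> (AE x in increment_law. \<exists>k::int. x = a * real_of_int k)"
    by (rule AE_increment_law[OF log_lattice_sets, symmetric])
  also have "a \<ge> 0 \<and> \<dots> \<longleftrightarrow> a > 0 \<and> \<dots>"
  proof -
    have False if "a = 0" "AE x in increment_law. \<exists>k::int. x = a * real_of_int k"
    proof -
      have "AE p in L. 0 < p \<longrightarrow> (\<exists>k::int. - ln p = a * real_of_int k)"
        using that(2) by (simp only: AE_increment_law[OF log_lattice_sets])
      with AE_unit have "AE p in L. p = 0 \<or> p = 1"
        by eventually_elim (use that(1) in auto)
      then show False using nondegenerate by simp
    qed
    then show ?thesis by (auto simp: less_le)
  qed
  finally show ?thesis .
qed

theorem path_recursion_asymptotics:
  fixes e :: "nat \<Rightarrow> real"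
  assumes e0: "\<And>n. n \<le> s \<Longrightarrow> e n = 0"
    and eS: "\<And>n. n > s \<Longrightarrow> e n = real n - real s0 + split_op e n"
  shows "\<exists>\<phi> :: real \<Rightarrow> real.
       continuous_on UNIV \<phi> \<and> has_period \<phi> (log_span L) \<and>
       (\<lambda>n. e n - (1 / mu * real n * ln (real n) + real n * \<phi> (ln (real n)))) \<in> o(\<lambda>n. real n) \<and>
       (\<not> log_lattice L \<longrightarrow> log_span L = 0 \<and> (\<exists>c. \<forall>x. \<phi> x = c))"
proof -
  obtain T c C where T: "\<And>n. e n = T (real n) + ln (fact n) / mu" "T 0 = 0"
    "\<And>x y. \<bar>T x - T y\<bar> \<le> c * \<bar>x - y\<bar>"
    "\<And>x. x \<ge> 1 \<Longrightarrow> \<bar>T x - real b * (\<integral>p. T (x * p) \<partial>L)\<bar> \<le> C * sqrt x"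
    using path_recursion_interpolation[OF e0 eS] by blast
  have c: "c \<ge> 0" using T(3)[of 1 0] by simp
  have T_le: "\<bar>T x\<bar> \<le> c * \<bar>x\<bar>" for x using T(3)[of x 0] T(2) by simp
  have "continuous_on UNIV T"
    by (rule lipschitz_on_continuous_on[of c]) (use T(3) c in \<open>auto simp: lipschitz_on_def dist_real_def\<close>)
  then have T_meas[measurable]: "T \<in> borel_measurable borel"
    by (intro borel_measurable_continuous_onI)
  define K where "K t = T (exp t) / exp t" for t
  have K_lip1: "\<bar>K t - K u\<bar> \<le> 2 * c * (t - u)" if "u \<le> t" for t u
  proof -
    define x y where "x = exp t" and "y = exp u"
    have xy: "0 < y" "y \<le> x" using that by (auto simp: x_def y_def)
    \<comment> \<open>Splitting off \<open>T y * (1 / x - 1 / y)\<close> leaves two quotients, each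
      at most \<open>c * (1 - y / x)\<close> in absolute value.\<close>
    have "K t - K u = (T x - T y) / x - T y * ((x - y) / (x * y))"
      using xy by (simp add: K_def x_def[symmetric] y_def[symmetric] field_simps)
    also have "\<bar>\<dots>\<bar> \<le> \<bar>T x - T y\<bar> / x + \<bar>T y\<bar> * ((x - y) / (x * y))"
      using xy by (intro abs_triangle_ineq4[THEN order.trans]) (auto simp: abs_mult)
    also have "\<dots> \<le> c * (x - y) / x + c * y * ((x - y) / (x * y))"
      using T(3)[of x y] T_le[of y] xy by (intro add_mono divide_right_mono mult_right_mono) auto
    also have "\<dots> = 2 * c * (1 - y / x)" using xy by (simp add: field_simps)
    also have "y / x = exp (u - t)" by (simp add: x_def y_def exp_diff)
    also have "2 * c * (1 - exp (u - t)) \<le> 2 * c * (t - u)"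
    proof (intro mult_left_mono)
      show "1 - exp (u - t) \<le> t - u" using exp_ge_add_one_self[of "u - t"] by linarith
    qed (use c in auto)
    finally show ?thesis .
  qed
  have lnp: "exp (t - - ln p) = exp t * p" if "p > 0" for t p :: real using that by (simp add: exp_add)
  interpret D: prob_space increment_law by (rule prob_space_increment_law)
  interpret renewal increment_law K c "2 * c" C
  proof
    show "AE x in increment_law. 0 \<le> x"
    proof (subst AE_increment_law)
      show "AE p in L. 0 < p \<longrightarrow> 0 \<le> - ln p" using AE_unit by eventually_elim auto
    qed simp
    have eq: "real b * p * - ln p = - real b * (p * ln p)" for p :: real by simp
    show "integrable increment_law (\<lambda>x. x)"
      using integrable_p_ln_p integral_increment_law(2)[of "\<lambda>x. x"] by (simp add: eq mult.assoc)
    show "0 < (\<integral>x. x \<partial>increment_law)"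
      using mu_pos integral_increment_law(1)[of "\<lambda>x. x"] by (simp add: mu_def eq mult.assoc)
    fix t u :: real
    show "\<bar>K t\<bar> \<le> c" using T_le[of "exp t"] by (simp add: K_def abs_divide divide_le_eq)
    show "\<bar>K t - K u\<bar> \<le> 2 * c * \<bar>t - u\<bar>"
      using K_lip1[of u t] K_lip1[of t u] by (cases "u \<le> t") (auto simp: abs_minus_commute)
    assume t: "t \<ge> 0"
    have "(\<integral>x. K (t - x) \<partial>increment_law) = (\<integral>p. real b * p * K (t - - ln p) \<partial>L)"
      unfolding K_def by (subst integral_increment_law) auto
    also have "\<dots> = (\<integral>p. real b / exp t * T (exp t * p) \<partial>L)"
    proof (rule integral_cong_AE)
      show "AE p in L. real b * p * K (t - - ln p) = real b / exp t * T (exp t * p)"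
        using AE_unit
      proof eventually_elim
        case (elim p)
        \<comment> \<open>At \<open>p = 0\<close> the left side has the factor \<open>p\<close>, and
          the right side vanishes because \<open>T 0 = 0\<close>.\<close>
        then show ?case by (cases "p = 0") (auto simp: K_def lnp T(2) exp_add)
      qed
    qed (auto simp: K_def)
    also have "\<dots> = real b * (\<integral>p. T (exp t * p) \<partial>L) / exp t" by simp
    finally have "\<bar>K t - (\<integral>x. K (t - x) \<partial>increment_law)\<bar> = \<bar>T (exp t) - real b * (\<integral>p. T (exp t * p) \<partial>L)\<bar> / exp t"
      by (simp add: K_def diff_divide_distrib[symmetric] abs_divide)
    also have "\<dots> \<le> C * sqrt (exp t) / exp t"
      using T(4)[of "exp t"] t by (intro divide_right_mono) auto
    also have "sqrt (exp t) = exp (t / 2)" by (intro real_sqrt_unique) (auto simp: power2_eq_square mult_exp_exp)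
    also have "C * exp (t / 2) / exp t = C * exp (- t / 2)"
      by (simp add: exp_minus field_simps mult_exp_exp)
    finally show "\<bar>K t - (\<integral>x. K (t - x) \<partial>increment_law)\<bar> \<le> C * exp (- t / 2)" .
  qed simp
  \<comment> \<open>The shift by \<open>1 / mu\<close> comes from
    \<open>ln (n!) / n = ln n - 1 + o(1)\<close>.\<close>
  have expansion: "(\<lambda>n. e n - (1 / mu * real n * ln (real n) + real n * (\<phi> (ln (real n)) - 1 / mu))) \<in> o(\<lambda>n. real n)"
    if \<phi>: "((\<lambda>t. K t - \<phi> t) \<longlongrightarrow> 0) at_top" for \<phi>
  proof (rule smalloI_tendsto)
    have "filterlim (\<lambda>n. ln (real n)) at_top sequentially" by real_asymp
    from filterlim_compose[OF \<phi> this]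
    have "(\<lambda>n. (K (ln (real n)) - \<phi> (ln (real n))) + ((ln (fact n) / real n - ln (real n)) + 1) / mu)
      \<longlonglongrightarrow> 0 + (- 1 + 1) / mu"
      by (intro tendsto_intros ln_fact_over_n) (use mu_pos in auto)
    moreover have "\<forall>\<^sub>F n in sequentially. (K (ln (real n)) - \<phi> (ln (real n))) + ((ln (fact n) / real n - ln (real n)) + 1) / mu
      = (e n - (1 / mu * real n * ln (real n) + real n * (\<phi> (ln (real n)) - 1 / mu))) / real n"
      using eventually_ge_at_top[of 1]
    proof eventually_elim
      case (elim n)
      then show ?case using mu_pos by (simp add: K_def T(1) field_simps)
    qed
    ultimately show "(\<lambda>n. (e n - (1 / mu * real n * ln (real n) + real n * (\<phi> (ln (real n)) - 1 / mu))) / real n) \<longlonglongrightarrow> 0"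
      by (simp add: tendsto_cong)
    show "\<forall>\<^sub>F n in sequentially. real n \<noteq> 0"
      using eventually_ge_at_top[of 1] by eventually_elim simp
  qed
  obtain m where m: "\<And>a::real. \<lbrakk>a > 0; AE x in increment_law. \<exists>k::int. x = a * k\<rbrakk> \<Longrightarrow> a \<le> m"
    using lattice_spans_bounded by blast
  have bdd: "bdd_above (log_spans L)"
    using m unfolding log_spans_iff[abs_def] by (intro bdd_aboveI[of _ m]) (auto simp: log_spans_iff)
  have span_nonneg: "log_span L \<ge> 0"
  proof (cases "log_spans L = {}")
    case False
    then obtain a where "a \<in> log_spans L" by blast
    then have "0 < a" "a \<le> Sup (log_spans L)" using bdd by (auto simp: log_spans_iff intro: cSup_upper)
    then show ?thesis using False by (simp add: log_span_def)
  qed (simp add: log_span_def)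
  then have not_lattice: "log_span L = 0" if "\<not> log_lattice L"
    using that by (simp add: log_lattice_def)
  show ?thesis
  proof (cases rule: renewal_limit)
    case (nonlattice k)
    \<comment> \<open>A constant has every period, so it may be used whatever the value of
      \<open>log_span L\<close> is.\<close>
    have "((\<lambda>t. K t - k) \<longlongrightarrow> 0) at_top" using tendsto_diff[OF nonlattice tendsto_const[of k]] by simp
    from expansion[OF this] show ?thesis using not_lattice
      by (intro exI[of _ "\<lambda>_. k - 1 / mu"]) (auto simp: has_period_def)
  next
    case (lattice g \<phi>)
    have "g \<in> log_spans L" using lattice by (simp add: log_spans_iff)
    moreover have "a \<le> g" if "a \<in> log_spans L" for a using lattice that by (simp add: log_spans_iff)
    ultimately have "log_span L = g" using cSup_eq_maximum[of g "log_spans L"] by (auto simp: log_span_def)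
    then show ?thesis using expansion[OF lattice(6)] lattice(1,4,5)
      by (intro exI[of _ "\<lambda>t. \<phi> t - 1 / mu"])
        (auto simp: has_period_def log_lattice_def intro!: continuous_intros)
  qed
qed

end

subsection \<open>Solving the path length recursion\<close>

context split_law
begin

text \<open>The expected number of children that receive exactly \<open>j\<close> of the
  \<open>k\<close> items to be distributed.\<close>

definition split_coeff :: "nat \<Rightarrow> nat \<Rightarrow> real" where
  "split_coeff k j = real b * (\<integral>p. Bernstein k j p \<partial>L)"

lemma integrable_Bernstein: "j \<le> k \<Longrightarrow> integrable L (Bernstein k j)"
proof (rule integrable_unit[of _ 1])
  fix p :: real assume "j \<le> k" and p: "0 \<le> p" "p \<le> 1"
  then have "Bernstein k j p \<le> (\<Sum>j\<le>k. Bernstein k j p)"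
    by (intro member_le_sum) (auto simp: Bernstein_nonneg)
  then show "\<bar>Bernstein k j p\<bar> \<le> 1" using p by (simp add: Bernstein_nonneg)
qed (simp add: Bernstein_def[abs_def])

lemma split_coeff_nonneg: "split_coeff k j \<ge> 0"
proof -
  have "AE p in L. 0 \<le> Bernstein k j p"
    using AE_unit by eventually_elim (simp add: Bernstein_nonneg)
  then show ?thesis unfolding split_coeff_def by (intro mult_nonneg_nonneg integral_nonneg_AE) auto
qed

lemma split_op_eq_sum: "split_op f m = (\<Sum>j\<le>rest m. split_coeff (rest m) j * f (s1 + j))"
  unfolding split_op_def bin_exp_def split_coeff_def
  by (subst Bochner_Integration.integral_sum)
    (auto simp: integrable_Bernstein sum_distrib_left mult.assoc intro!: integrable_mult_left)

text \<open>Isolates the coefficient \<open>q\<close> with which the recursion at \<open>m\<close>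
  refers to itself. It is nonzero only if one child can take all items, that is for
  \<open>s0 = s1 = 0\<close>, and \<open>self_loop\<close> then bounds it.\<close>

lemma split_op_decomp:
  assumes m: "m > s"
  obtains q where "0 \<le> q" "q < 1"
    "\<And>f. split_op f m = q * f m + (\<Sum>j | j \<le> rest m \<and> s1 + j < m. split_coeff (rest m) j * f (s1 + j))"
proof -
  have rm: "rest m + (s0 + b * s1) = m" by (rule rest_plus[OF m])
  have bs1: "2 * s1 \<le> b * s1" using b_ge2 by (rule mult_le_mono1)
  show thesis
  proof (cases "s1 + rest m = m")
    case True
    then have z: "s1 = 0" "s0 = 0" using rm bs1 by linarith+
    then have r: "rest m = m" using True by simp
    \<comment> \<open>With \<open>s0 = 0\<close> the condition \<open>not_both_zero\<close> gives
      \<open>s \<ge> 1\<close>. For \<open>m = 1\<close> the coefficient would be \<open>b\<close>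
      times the mean of \<open>L\<close>, which is 1: a single item would be passed on
      forever.\<close>
    have "m \<ge> 2" using m not_both_zero z by auto
    then obtain k where k: "m = Suc k" "k \<ge> 1" by (cases m) auto
    have "split_coeff m m = real b * (\<integral>p. p * p ^ k \<partial>L)"
      by (simp add: split_coeff_def Bernstein_def k)
    then have "split_coeff m m < 1" using self_loop[OF k(2)] by simp
    moreover have zz: "s1 + j = j" for j using z by simp
    then have "{..rest m} = insert m {j. j \<le> rest m \<and> s1 + j < m}" using r by auto
    then have "split_op f m = split_coeff m m * f m
        + (\<Sum>j | j \<le> rest m \<and> s1 + j < m. split_coeff (rest m) j * f (s1 + j))" for f
      unfolding split_op_eq_sum by (simp add: zz r)
    ultimately show thesis
      by (intro that[of "split_coeff m m"] split_coeff_nonneg)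
  next
    case False
    then have "s1 + rest m < m" using rm bs1 by linarith
    then have "{j. j \<le> rest m \<and> s1 + j < m} = {..rest m}" by auto
    then show thesis by (intro that[of 0]) (auto simp: split_op_eq_sum)
  qed
qed

text \<open>Unlike \<open>sized_op\<close> this operator is not an average, but the boundary value
  is 0, its coefficients are nonnegative and the self-reference is below 1, so the induction works
  in the same way.\<close>

lemma split_maximum_principle:
  assumes "\<And>m. m \<le> s \<Longrightarrow> f m \<le> 0" "\<And>m. m > s \<Longrightarrow> f m \<le> split_op f m"
  shows "f m \<le> 0"
proof (induction m rule: less_induct)
  case (less m)
  show ?case
  proof (cases "m \<le> s")
    case False
    then have m: "m > s" by simp
    obtain q where q: "0 \<le> q" "q < 1"
      "\<And>f. split_op f m = q * f m + (\<Sum>j | j \<le> rest m \<and> s1 + j < m. split_coeff (rest m) j * f (s1 + j))"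
      by (rule split_op_decomp[OF m], rule that)
    have "(\<Sum>j | j \<le> rest m \<and> s1 + j < m. split_coeff (rest m) j * f (s1 + j)) \<le> 0"
      using less by (intro sum_nonpos mult_nonneg_nonpos split_coeff_nonneg) auto
    then have "(1 - q) * f m \<le> 0" using assms(2)[OF m] q(3)[of f] by (simp add: algebra_simps)
    then show ?thesis using q by (simp add: mult_le_0_iff)
  qed (use assms in auto)
qed

text \<open>Nodes of cardinality at most \<open>s\<close> have only empty descendants, hence the
  value 0. For \<open>f 0 = 0\<close> the k-th iterate at \<open>n\<close> turns out to be the
  expected sum of \<open>f\<close> over the nodes of depth k.\<close>

definition level_op :: "(nat \<Rightarrow> real) \<Rightarrow> nat \<Rightarrow> real" where
  "level_op f m = (if m > s then split_op f m else 0)"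

lemma level_op_add: "level_op (\<lambda>j. f j + g j) m = level_op f m + level_op g m"
  by (simp add: level_op_def split_op_eq_sum distrib_left sum.distrib)

lemma level_op_sum: "level_op (\<lambda>j. \<Sum>k\<in>I. f k j) m = (\<Sum>k\<in>I. level_op (f k) m)"
proof (cases "m > s")
  case True
  have "(\<Sum>j\<le>rest m. \<Sum>k\<in>I. split_coeff (rest m) j * f k (s1 + j))
    = (\<Sum>k\<in>I. \<Sum>j\<le>rest m. split_coeff (rest m) j * f k (s1 + j))"
    by (rule sum.swap)
  then show ?thesis using True by (simp add: level_op_def split_op_eq_sum sum_distrib_left)
qed (simp add: level_op_def)

lemma level_op_cmult: "level_op (\<lambda>j. c * f j) m = c * level_op f m"
  by (simp add: level_op_def split_op_eq_sum sum_distrib_left mult.left_commute[of _ c])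

lemma level_op_mono: "(\<And>j. f j \<le> g j) \<Longrightarrow> level_op f m \<le> level_op g m"
  by (auto simp: level_op_def split_op_eq_sum intro!: sum_mono mult_left_mono split_coeff_nonneg)

lemma level_op_tendsto:
  assumes "\<And>j. (\<lambda>k. f k j) \<longlonglongrightarrow> g j"
  shows "(\<lambda>k. level_op (f k) m) \<longlonglongrightarrow> level_op g m"
  unfolding level_op_def split_op_eq_sum
  by (cases "m > s") (auto intro!: tendsto_intros assms)

lemma level_op_id: "m > s \<Longrightarrow> level_op real m = real m - real s0"
proof -
  assume m: "m > s"
  have "bin_exp (rest m) (\<lambda>j. real (s1 + j)) p = real s1 + real (rest m) * p" for p
    using bin_exp_affine[of "rest m" "real s1" 1 p] by simp
  then have "split_op real m = real b * (real s1 + real (rest m) * (\<integral>p. p \<partial>L))"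
    using integrable_id by (simp add: split_op_def)
  also have "\<dots> = real b * real s1 + real (rest m) * (real b * (\<integral>p. p \<partial>L))"
    by (simp add: distrib_left mult.left_commute)
  also have "\<dots> = real b * real s1 + real (rest m)" by (simp add: mean)
  also have "\<dots> = real m - real s0"
    using arg_cong[OF rest_plus[OF m], of real] by simp
  finally show ?thesis using m by (simp add: level_op_def)
qed

text \<open>The expected number of items stored \<open>k\<close> levels below a node of cardinality
  \<open>m\<close>; the iteration starts from the number stored at the node itself.\<close>

definition stored_level :: "nat \<Rightarrow> nat \<Rightarrow> real" where
  "stored_level k = (level_op ^^ k) (\<lambda>m. if m > s then real s0 else real m)"

lemma stored_level_0: "stored_level 0 m = (if m > s then real s0 else real m)"
  by (simp add: stored_level_def)

lemma stored_level_Suc: "stored_level (Suc k) = level_op (stored_level k)"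
  by (simp add: stored_level_def)

lemma stored_level_nonneg: "stored_level k m \<ge> 0"
proof (induction k arbitrary: m)
  case (Suc k)
  have "level_op (\<lambda>_. 0) m \<le> level_op (stored_level k) m" by (intro level_op_mono Suc)
  then show ?case by (simp add: stored_level_Suc level_op_def split_op_eq_sum split: if_splits)
qed (simp add: stored_level_0)

lemma sum_stored_level_le: "(\<Sum>k<K. stored_level k m) \<le> real m"
proof (induction K arbitrary: m)
  case (Suc K)
  have "(\<Sum>k<Suc K. stored_level k m) = stored_level 0 m + (\<Sum>k<K. stored_level (Suc k) m)"
    by (rule sum.lessThan_Suc_shift)
  also have "(\<Sum>k<K. stored_level (Suc k) m) = level_op (\<lambda>j. \<Sum>k<K. stored_level k j) m"
    by (simp add: stored_level_Suc level_op_sum)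
  also have "\<dots> \<le> level_op real m" by (intro level_op_mono Suc)
  finally show ?case using level_op_id[of m] by (auto simp: stored_level_0 level_op_def split: if_splits)
qed simp

text \<open>No item is lost at infinite depth. The limit \<open>z\<close> of the partial sums
  satisfies the same recursion as the identity, so the deficit \<open>j - z j\<close> solves the
  homogeneous equation and vanishes for \<open>j \<le> s\<close>; the maximum principle makes it
  nonpositive.\<close>

lemma stored_level_sums: "(\<lambda>k. stored_level k m) sums real m"
proof -
  have summable: "summable (\<lambda>k. stored_level k j)" for j
    by (intro bounded_imp_summable[of _ "real j"] stored_level_nonneg)
      (simp only: lessThan_Suc_atMost[symmetric] sum_stored_level_le)
  define z where "z j = (\<Sum>k. stored_level k j)" for j
  have z_rec: "z j = stored_level 0 j + level_op z j" for j
  proof -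
    have "(\<lambda>K. level_op (\<lambda>i. \<Sum>k<K. stored_level k i) j) \<longlonglongrightarrow> level_op z j"
      unfolding z_def by (intro level_op_tendsto summable_LIMSEQ summable)
    then have "(\<lambda>k. stored_level (Suc k) j) sums level_op z j"
      by (simp add: sums_def level_op_sum stored_level_Suc)
    then have "(\<lambda>k. stored_level k j) sums (level_op z j + stored_level 0 j)" by (rule sums_Suc)
    then show ?thesis unfolding z_def[of j] by (simp add: sums_unique[symmetric] add.commute)
  qed
  have "real j - z j \<le> 0" for j
  proof (rule split_maximum_principle[of "\<lambda>j. real j - z j"])
    show "real j - z j \<le> 0" if "j \<le> s" for j
      using z_rec[of j] that by (simp add: stored_level_0 level_op_def)
    show "real j - z j \<le> split_op (\<lambda>j. real j - z j) j" if "j > s" for j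
    proof -
      have "split_op (\<lambda>j. real j - z j) j = level_op real j - level_op z j"
        using that by (simp add: level_op_def split_op_eq_sum right_diff_distrib sum_subtractf)
      then show ?thesis using z_rec[of j] that by (simp add: stored_level_0 level_op_id)
    qed
  qed
  moreover have "z m \<le> real m"
    unfolding z_def by (intro suminf_le_const summable sum_stored_level_le)
  ultimately have "z m = real m" by (simp add: antisym)
  then show ?thesis using summable_sums[OF summable, of m] unfolding z_def by simp
qed

text \<open>An item at depth \<open>k\<close> below a child has depth \<open>k + 1\<close> below the
  node, which adds one copy of the storage sum to the path sum.\<close>

lemma sum_path_level_Suc:
  "(\<Sum>k<Suc K. real k * stored_level k m) =
    level_op (\<lambda>j. (\<Sum>k<K. real k * stored_level k j) + (\<Sum>k<K. stored_level k j)) m"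
proof -
  have "(\<Sum>k<Suc K. real k * stored_level k m) = (\<Sum>k<K. (real k + 1) * level_op (stored_level k) m)"
    by (subst sum.lessThan_Suc_shift) (simp add: stored_level_Suc add.commute)
  then show ?thesis
    by (simp add: level_op_add level_op_sum level_op_cmult sum.distrib distrib_right)
qed

text \<open>Induction on \<open>m\<close> with a bound uniform in the truncation \<open>K\<close>.
  Monotonicity in \<open>K\<close> puts the same truncated sum \<open>E K m\<close> on both sides of
  the recursion, so the self-reference with \<open>q < 1\<close> can be absorbed.\<close>

lemma sum_path_level_bounded: "\<exists>B. \<forall>K. (\<Sum>k<K. real k * stored_level k m) \<le> B"
proof (induction m rule: less_induct)
  case (less m)
  define E where "E K m = (\<Sum>k<K. real k * stored_level k m)" for K m
  have E_Suc: "E (Suc K) m \<le> level_op (E K) m + real m" for K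
  proof -
    have "E (Suc K) m \<le> level_op (E K) m + level_op real m"
      unfolding E_def sum_path_level_Suc level_op_add
      by (intro add_left_mono level_op_mono sum_stored_level_le)
    also have "level_op real m \<le> real m" using level_op_id[of m] by (cases "m > s") (auto simp: level_op_def)
    finally show ?thesis by simp
  qed
  have mono: "E K m \<le> E (Suc K) m" for K
    by (simp add: E_def stored_level_nonneg)
  have "\<forall>j. \<exists>B. \<forall>K. j < m \<longrightarrow> E K j \<le> B" using less unfolding E_def by blast
  from choice[OF this] obtain B where B: "\<And>j K. j < m \<Longrightarrow> E K j \<le> B j" by blast
  show ?case
  proof (cases "m > s")
    case True
    obtain q where q: "0 \<le> q" "q < 1"
      "\<And>f. split_op f m = q * f m + (\<Sum>j | j \<le> rest m \<and> s1 + j < m. split_coeff (rest m) j * f (s1 + j))"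
      by (rule split_op_decomp[OF True], rule that)
    define A where "A = real m + (\<Sum>j | j \<le> rest m \<and> s1 + j < m. split_coeff (rest m) j * B (s1 + j))"
    have "E K m \<le> A / (1 - q)" for K
    proof -
      have "(\<Sum>j | j \<le> rest m \<and> s1 + j < m. split_coeff (rest m) j * E K (s1 + j)) + real m \<le> A"
        unfolding A_def using B by (auto intro!: sum_mono mult_left_mono split_coeff_nonneg)
      moreover have "E K m \<le> split_op (E K) m + real m"
        using mono[of K] E_Suc[of K] True by (simp add: level_op_def)
      ultimately have "(1 - q) * E K m \<le> A" unfolding q(3) by (simp add: algebra_simps)
      then show ?thesis using q by (simp add: field_simps)
    qed
    then show ?thesis unfolding E_def by blast
  next
    case False
    then have "E K m \<le> real m" for K using mono[of K] E_Suc[of K] by (simp add: level_op_def)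
    then show ?thesis unfolding E_def by blast
  qed
qed

lemma path_level_summable: "summable (\<lambda>k. real k * stored_level k m)"
proof -
  obtain B where B: "\<And>K. (\<Sum>k<K. real k * stored_level k m) \<le> B" using sum_path_level_bounded by blast
  show ?thesis
  proof (rule bounded_imp_summable[of _ B])
    show "0 \<le> real k * stored_level k m" for k by (simp add: stored_level_nonneg)
    show "(\<Sum>k\<le>K. real k * stored_level k m) \<le> B" for K
      using B[of "Suc K"] by (simp only: lessThan_Suc_atMost)
  qed
qed

definition expected_path :: "nat \<Rightarrow> real" where
  "expected_path m = (\<Sum>k. real k * stored_level k m)"

lemma expected_path_eq: "expected_path m = level_op (\<lambda>j. expected_path j + real j) m"
proof (rule LIMSEQ_unique)
  show "(\<lambda>K. \<Sum>k<Suc K. real k * stored_level k m) \<longlonglongrightarrow> expected_path m"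
    unfolding expected_path_def by (rule LIMSEQ_Suc[OF summable_LIMSEQ[OF path_level_summable]])
  show "(\<lambda>K. \<Sum>k<Suc K. real k * stored_level k m) \<longlonglongrightarrow> level_op (\<lambda>j. expected_path j + real j) m"
    unfolding sum_path_level_Suc expected_path_def
    using stored_level_sums
    by (intro level_op_tendsto tendsto_add summable_LIMSEQ path_level_summable) (simp add: sums_def)
qed

lemma expected_path_0: "m \<le> s \<Longrightarrow> expected_path m = 0"
  by (subst expected_path_eq) (simp add: level_op_def)

lemma expected_path_rec:
  assumes "m > s"
  shows "expected_path m = real m - real s0 + split_op expected_path m"
  using expected_path_eq[of m] level_op_id[OF assms] assms
  unfolding level_op_add by (simp add: level_op_def)

end

subsection \<open>Multinomial splitting\<close>

text \<open>The condition off \<open>I\<close> makes each function determined by its values on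
  \<open>I\<close>, so the set is finite for finite \<open>I\<close>.\<close>

definition comps :: "'i set \<Rightarrow> nat \<Rightarrow> ('i \<Rightarrow> nat) set" where
  "comps I m = {k. (\<forall>i. i \<notin> I \<longrightarrow> k i = 0) \<and> sum k I = m}"

lemma comps_fiber:
  assumes "finite I" "x \<notin> I" "j \<le> m"
  shows "bij_betw (\<lambda>k. k(x := j)) (comps I (m - j)) {k \<in> comps (insert x I) m. k x = j}"
proof (rule bij_betw_byWitness[where f' = "\<lambda>k. k(x := 0)"])
  have upd: "(\<Sum>i\<in>I. if i = x then j else k i) = sum k I" for k :: "'a \<Rightarrow> nat" and j
    using assms by (intro sum.cong) auto
  show "(\<lambda>k. k(x := j)) ` comps I (m - j) \<subseteq> {k \<in> comps (insert x I) m. k x = j}"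
    using assms by (auto simp: comps_def upd)
  show "(\<lambda>k. k(x := 0)) ` {k \<in> comps (insert x I) m. k x = j} \<subseteq> comps I (m - j)"
    using assms by (auto simp: comps_def upd)
qed (use assms in \<open>auto simp: comps_def fun_eq_iff\<close>)

lemma comps_le: "\<lbrakk>finite I; k \<in> comps I m; x \<in> I\<rbrakk> \<Longrightarrow> k x \<le> m"
  by (auto simp: comps_def intro: member_le_sum)

lemma finite_comps: "finite I \<Longrightarrow> finite (comps I m)"
proof (induction I arbitrary: m rule: finite_induct)
  case empty
  have "comps {} m \<subseteq> {\<lambda>_::'a. 0}" by (auto simp: comps_def)
  then show ?case by (rule finite_subset) simp
next
  case (insert x I)
  have "comps (insert x I) m = (\<Union>j\<le>m. {k \<in> comps (insert x I) m. k x = j})"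
    using insert comps_le[of "insert x I" _ m x] by auto
  moreover have "finite {k \<in> comps (insert x I) m. k x = j}" if "j \<le> m" for j
    using bij_betw_finite[OF comps_fiber[OF insert(1,2) that]] insert.IH by simp
  then have "finite (\<Union>j\<le>m. {k \<in> comps (insert x I) m. k x = j})" by (intro finite_UN_I) auto
  ultimately show ?case by (simp only:)
qed

text \<open>Splits off the coordinate \<open>x\<close> with an extra weight \<open>g\<close> on it:
  \<open>g = 1\<close> yields the multinomial theorem, a general \<open>g\<close> the law of a
  single coordinate.\<close>

lemma sum_comps_insert:
  fixes \<phi> :: "'i \<Rightarrow> nat \<Rightarrow> real"
  assumes I: "finite I" "x \<notin> I"
  shows "(\<Sum>k\<in>comps (insert x I) m. g (k x) * (\<Prod>i\<in>insert x I. \<phi> i (k i)))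
    = (\<Sum>j\<le>m. g j * \<phi> x j * (\<Sum>k\<in>comps I (m - j). \<Prod>i\<in>I. \<phi> i (k i)))"
proof -
  define F where "F k = g (k x) * (\<Prod>i\<in>insert x I. \<phi> i (k i))" for k
  have "(\<Sum>k\<in>comps (insert x I) m. F k) = (\<Sum>j\<le>m. \<Sum>k | k \<in> comps (insert x I) m \<and> k x = j. F k)"
  proof (rule sum.group[symmetric])
    show "finite (comps (insert x I) m)" using I by (simp add: finite_comps)
    show "(\<lambda>k. k x) ` comps (insert x I) m \<subseteq> {..m}" using I comps_le[of "insert x I" _ m x] by auto
  qed simp
  also have "\<dots> = (\<Sum>j\<le>m. g j * \<phi> x j * (\<Sum>k\<in>comps I (m - j). \<Prod>i\<in>I. \<phi> i (k i)))"
  proof (intro sum.cong refl)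
    fix j assume "j \<in> {..m}"
    then have "(\<Sum>k | k \<in> comps (insert x I) m \<and> k x = j. F k) = (\<Sum>k\<in>comps I (m - j). F (k(x := j)))"
      using comps_fiber[OF I, of j m] by (intro sum.reindex_bij_betw[symmetric]) auto
    also have "\<dots> = (\<Sum>k\<in>comps I (m - j). g j * \<phi> x j * (\<Prod>i\<in>I. \<phi> i (k i)))"
    proof (intro sum.cong refl)
      fix k
      have "(\<Prod>i\<in>I. \<phi> i ((k(x := j)) i)) = (\<Prod>i\<in>I. \<phi> i (k i))"
        using I by (intro prod.cong) auto
      then show "F (k(x := j)) = g j * \<phi> x j * (\<Prod>i\<in>I. \<phi> i (k i))"
        using I by (simp add: F_def del: fun_upd_apply) simp
    qed
    finally show "(\<Sum>k | k \<in> comps (insert x I) m \<and> k x = j. F k)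
      = g j * \<phi> x j * (\<Sum>k\<in>comps I (m - j). \<Prod>i\<in>I. \<phi> i (k i))"
      by (simp add: sum_distrib_left)
  qed
  finally show ?thesis by (simp add: F_def)
qed

text \<open>Division by the factorials makes the summand a product over \<open>I\<close>, so
  splitting off a coordinate reduces the induction step to the binomial theorem.\<close>

lemma multinomial_theorem:
  fixes p :: "'i \<Rightarrow> real"
  assumes "finite I"
  shows "(\<Sum>k\<in>comps I m. \<Prod>i\<in>I. p i ^ k i / fact (k i)) = sum p I ^ m / fact m"
  using assms
proof (induction I arbitrary: m rule: finite_induct)
  case empty
  have "comps {} m = (if m = 0 then {\<lambda>_::'i. 0} else {})" by (auto simp: comps_def)
  then show ?case by simp
next
  case (insert x I)
  have "(\<Sum>k\<in>comps (insert x I) m. \<Prod>i\<in>insert x I. p i ^ k i / fact (k i))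
    = (\<Sum>j\<le>m. p x ^ j / fact j * (sum p I ^ (m - j) / fact (m - j)))"
    using sum_comps_insert[OF insert(1,2), where g = "\<lambda>_. 1" and m = m and \<phi> = "\<lambda>i j. p i ^ j / fact j"] insert.IH by simp
  also have "\<dots> = (\<Sum>j\<le>m. real (m choose j) * p x ^ j * sum p I ^ (m - j)) / fact m"
    unfolding sum_divide_distrib by (intro sum.cong refl) (simp add: binomial_fact)
  also have "\<dots> = sum p (insert x I) ^ m / fact m"
    using insert by (simp add: binomial_ring)
  finally show ?case .
qed

text \<open>All other coordinates merge into one of probability \<open>1 - p $ i\<close>, which
  leaves a binomial law.\<close>

lemma multinomial_marginal:
  fixes p :: "real ^ 'b::finite"
  assumes p: "(\<Sum>i\<in>UNIV. p $ i) = 1"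
  shows "(\<Sum>k\<in>comps UNIV m. f (k i) * multinomial_prob m p k) = bin_exp m f (p $ i)"
proof -
  let ?I = "UNIV - {i}"
  have ins: "insert i ?I = UNIV" by auto
  have "(\<Sum>k\<in>comps UNIV m. f (k i) * multinomial_prob m p k)
    = fact m * (\<Sum>k\<in>comps (insert i ?I) m. f (k i) * (\<Prod>i\<in>insert i ?I. (p $ i) ^ k i / fact (k i)))"
    unfolding ins sum_distrib_left
    by (intro sum.cong refl) (auto simp: multinomial_prob_def comps_def prod_dividef)
  also have "\<dots> = fact m * (\<Sum>j\<le>m. f j * ((p $ i) ^ j / fact j) * (sum (($) p) ?I ^ (m - j) / fact (m - j)))"
    by (subst sum_comps_insert) (auto simp: multinomial_theorem)
  also have "sum (($) p) ?I = 1 - p $ i"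
    using p by (simp add: sum_diff1)
  also have "fact m * (\<Sum>j\<le>m. f j * ((p $ i) ^ j / fact j) * ((1 - p $ i) ^ (m - j) / fact (m - j))) = bin_exp m f (p $ i)"
    unfolding bin_exp_def sum_distrib_left
    by (intro sum.cong refl) (simp add: Bernstein_def binomial_fact)
  finally show ?thesis .
qed

lemma sum_multinomial_prob:
  fixes p :: "real ^ 'b::finite"
  assumes "(\<Sum>i\<in>UNIV. p $ i) = 1"
  shows "(\<Sum>k\<in>comps UNIV m. multinomial_prob m p k) = 1"
  using multinomial_marginal[OF assms, of "\<lambda>_. 1"] by simp

lemma vec_nth_measurable[measurable]:
  fixes f :: "'c \<Rightarrow> real ^ 'b::finite"
  assumes "f \<in> borel_measurable M"
  shows "(\<lambda>x. f x $ i) \<in> borel_measurable M"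
  by (rule measurable_compose[OF assms]) (intro borel_measurable_continuous_onI continuous_intros)

lemma multinomial_prob_measurable[measurable]:
  "(\<lambda>p::real ^ 'b::finite. multinomial_prob m p k) \<in> borel_measurable borel"
  unfolding multinomial_prob_def by measurable

lemma component_measurable:
  fixes \<V> :: "'p \<Rightarrow> real ^ 'b::finite"
  assumes [measurable]: "\<V> \<in> borel_measurable P"
  shows "(\<lambda>(\<omega>, i). \<V> \<omega> $ i) \<in> borel_measurable (P \<Otimes>\<^sub>M measure_pmf (pmf_of_set (UNIV :: 'b set)))"
proof -
  have [measurable]: "(\<lambda>z. indicator {i} (snd z) :: real) \<in> borel_measurable (P \<Otimes>\<^sub>M count_space UNIV)" for i :: 'b
    by (rule measurable_compose[OF measurable_snd]) simp
  have "(\<lambda>z. \<Sum>i\<in>UNIV. \<V> (fst z) $ i * indicator {i} (snd z))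
    \<in> borel_measurable (P \<Otimes>\<^sub>M measure_pmf (pmf_of_set (UNIV :: 'b set)))"
    by measurable
  also have "(\<lambda>z. \<Sum>i\<in>UNIV. \<V> (fst z) $ i * indicator {i} (snd z)) = (\<lambda>(\<omega>, i). \<V> \<omega> $ i)"
    by (auto simp: indicator_def fun_eq_iff if_distrib[of "(*) _"] sum.delta cong: if_cong)
  finally show ?thesis .
qed

lemma component_law_integral:
  fixes \<V> :: "'p \<Rightarrow> real ^ 'b::finite"
  assumes "prob_space P" and [measurable]: "\<V> \<in> borel_measurable P" "h \<in> borel_measurable borel"
    and int: "integrable (component_law P \<V>) h" "\<And>i. integrable P (\<lambda>\<omega>. h (\<V> \<omega> $ i))"
  shows "(\<Sum>i\<in>UNIV. \<integral>\<omega>. h (\<V> \<omega> $ i) \<partial>P) = real CARD('b) * (\<integral>x. h x \<partial>component_law P \<V>)"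
proof -
  interpret P: prob_space P by fact
  interpret Q: pair_prob_space P "measure_pmf (pmf_of_set (UNIV :: 'b set))"
    by unfold_locales
  note component_measurable[OF assms(2), measurable]
  have "(\<integral>x. h x \<partial>component_law P \<V>) = (\<integral>z. h (\<V> (fst z) $ snd z) \<partial>(P \<Otimes>\<^sub>M measure_pmf (pmf_of_set (UNIV :: 'b set))))"
    unfolding component_law_def by (subst integral_distr) (simp_all add: split_beta')
  also have "\<dots> = (\<integral>\<omega>. \<integral>i. h (\<V> \<omega> $ i) \<partial>measure_pmf (pmf_of_set UNIV) \<partial>P)"
    using int(1) unfolding component_law_def
    by (subst Q.integral_fst'[symmetric]) (auto simp: integrable_distr_eq split_beta')
  also have "\<dots> = (\<integral>\<omega>. (\<Sum>i\<in>UNIV. h (\<V> \<omega> $ i)) / real CARD('b) \<partial>P)"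
    by (subst integral_pmf_of_set) auto
  finally show ?thesis using int(2) by simp
qed

section \<open>Conditional laws along the random tree\<close>

locale split_tree_simplex = split_tree M s s0 s1 P \<V> n V N +
    law: split_law "component_law P \<V>" "CARD('b)" s s0 s1
  for M :: "'a measure" and s s0 s1 :: nat and P :: "'p measure"
    and \<V> :: "'p \<Rightarrow> real ^ 'b::finite" and n V N +
  assumes prob_P: "prob_space P"
    and vector_measurable[measurable]: "\<V> \<in> borel_measurable P"
    and simplex: "AE \<omega> in P. (\<forall>i. \<V> \<omega> $ i \<ge> 0) \<and> (\<Sum>i\<in>UNIV. \<V> \<omega> $ i) = 1"
begin

lemma V_measurable[measurable]: "V u \<in> borel_measurable M"
  using indep_V by (auto simp: indep_vars_def)

lemma N_measurable[measurable]: "N u \<in> measurable M (count_space UNIV)"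
  by (rule measurable_N)

lemma indicator_N_measurable[measurable]: "(\<lambda>\<omega>. indicator A (N u \<omega>) :: real) \<in> borel_measurable M"
  by (rule measurable_compose[OF N_measurable]) simp

lemma multinomial_V_measurable[measurable]: "(\<lambda>\<omega>. multinomial_prob m (V u \<omega>) k) \<in> borel_measurable M"
  by (rule measurable_compose[OF V_measurable multinomial_prob_measurable])

lemma simplex_V: "AE \<omega> in M. (\<forall>i. V u \<omega> $ i \<ge> 0) \<and> (\<Sum>i\<in>UNIV. V u \<omega> $ i) = 1"
proof -
  define Q where "Q x \<longleftrightarrow> (\<forall>i. x $ i \<ge> 0) \<and> (\<Sum>i\<in>UNIV. x $ i) = 1" for x :: "real ^ 'b"
  have [measurable]: "Measurable.pred borel Q" unfolding Q_def by measurable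
  have "AE x in distr P borel \<V>. Q x"
    using simplex by (subst AE_distr_iff) (auto simp: Q_def)
  then have "AE x in distr M borel (V u). Q x" by (simp only: distr_V)
  then have "AE \<omega> in M. Q (V u \<omega>)" by (subst (asm) AE_distr_iff) auto
  then show ?thesis by (simp add: Q_def)
qed

lemma V_unit: "AE \<omega> in M. \<forall>i. 0 \<le> V u \<omega> $ i \<and> V u \<omega> $ i \<le> 1"
  using simplex_V[of u]
proof eventually_elim
  case (elim \<omega>)
  have "V u \<omega> $ i \<le> (\<Sum>i\<in>UNIV. V u \<omega> $ i)" for i using elim by (intro member_le_sum) auto
  then show ?case using elim by auto
qed

lemma integral_V:
  fixes h :: "real \<Rightarrow> real"
  assumes [measurable]: "h \<in> borel_measurable borel"
  shows "(\<integral>\<omega>. h (V u \<omega> $ i) \<partial>M) = (\<integral>\<omega>. h (\<V> \<omega> $ i) \<partial>P)"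
proof -
  have "(\<integral>\<omega>. h (V u \<omega> $ i) \<partial>M) = (\<integral>x. h (x $ i) \<partial>distr M borel (V u))"
    using integral_distr[of "V u" M borel "\<lambda>x. h (x $ i)"] by simp
  also have "\<dots> = (\<integral>\<omega>. h (\<V> \<omega> $ i) \<partial>P)"
    unfolding distr_V using integral_distr[of \<V> P borel "\<lambda>x. h (x $ i)"] by simp
  finally show ?thesis .
qed

abbreviation history :: "'b list \<Rightarrow> 'a measure" where
  "history v \<equiv> split_history M V N v"

lemma
  shows space_history: "space (history v) = space M"
    and sets_history: "sets (history v) = sigma_sets (space M)
     ({V u -` B \<inter> space M | u B. B \<in> sets borel} \<union>
      {N w -` B \<inter> space M | w B. \<not> strict_prefix v w})"
  unfolding split_history_def by (auto intro!: space_measure_of sets_measure_of)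

lemma subalgebra_history: "subalgebra M (history v)"
  unfolding subalgebra_def
proof (intro conjI)
  show "sets (history v) \<subseteq> sets M"
    unfolding sets_history
  proof (rule sets.sigma_sets_subset)
    have "N w -` B \<inter> space M \<in> sets M" for w B by (rule measurable_sets[OF N_measurable]) simp
    moreover have "V u -` B \<inter> space M \<in> sets M" if "B \<in> sets borel" for u B
      by (rule measurable_sets[OF V_measurable that])
    ultimately show "{V u -` B \<inter> space M |u B. B \<in> sets borel} \<union>
      {N w -` B \<inter> space M |w B. \<not> strict_prefix v w} \<subseteq> sets M" by auto
  qed
qed (rule space_history)

lemma V_history[measurable]: "V u \<in> measurable (history v) borel"
proof (rule measurableI)
  fix B :: "(real ^ 'b) set" assume "B \<in> sets borel"
  then show "V u -` B \<inter> space (history v) \<in> sets (history v)"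
    unfolding sets_history space_history by (intro sigma_sets.Basic) auto
qed simp

lemma N_history: "\<not> strict_prefix v w \<Longrightarrow> N w \<in> measurable (history v) (count_space UNIV)"
proof (rule measurableI)
  fix B :: "nat set"
  assume "\<not> strict_prefix v w"
  then have "N w -` B \<inter> space M \<in> {N w -` B \<inter> space M | w B. \<not> strict_prefix v w}" by blast
  then show "N w -` B \<inter> space (history v) \<in> sets (history v)"
    unfolding sets_history space_history by (intro sigma_sets.Basic UnI2)
qed simp

sublocale hist: finite_measure_subalgebra M "history v" for v
  by unfold_locales (rule subalgebra_history)

lemma integrable_bounded:
  assumes "f \<in> borel_measurable M" "AE \<omega> in M. \<bar>f \<omega>\<bar> \<le> (B :: real)"
  shows "integrable M f"
  using assms by (intro integrable_const_bound[of _ B]) auto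

definition child_event :: "'b list \<Rightarrow> ('b \<Rightarrow> nat) \<Rightarrow> 'a set" where
  "child_event v k = {\<omega> \<in> space M. \<forall>i. N (v @ [i]) \<omega> = k i + s1}"

lemma child_event_sets[measurable]: "child_event v k \<in> sets M"
  unfolding child_event_def by measurable

lemma multinomial_prob_bound: "AE \<omega> in M. \<forall>m k. 0 \<le> multinomial_prob m (V u \<omega>) k \<and> multinomial_prob m (V u \<omega>) k \<le> 1"
  using simplex_V[of u]
proof eventually_elim
  case (elim \<omega>)
  have nn: "0 \<le> multinomial_prob m (V u \<omega>) k" for m k
    using elim unfolding multinomial_prob_def by (auto intro!: mult_nonneg_nonneg divide_nonneg_nonneg prod_nonneg)
  have "multinomial_prob m (V u \<omega>) k \<le> 1" for m k
  proof (cases "k \<in> comps UNIV m")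
    case True
    then have "multinomial_prob m (V u \<omega>) k \<le> (\<Sum>k\<in>comps UNIV m. multinomial_prob m (V u \<omega>) k)"
      using nn by (intro member_le_sum) (auto simp: finite_comps)
    also have "\<dots> = 1" using elim by (intro sum_multinomial_prob) auto
    finally show ?thesis .
  next
    case False
    then show ?thesis by (simp add: multinomial_prob_def comps_def)
  qed
  then show ?case using nn by blast
qed

text \<open>The axiom \<open>split\<close> is tested against
  \<open>indicator {m} (N v \<omega>) * \<Phi> \<omega>\<close>, which belongs to the history
  because \<open>v\<close> is not a strict prefix of itself. The indicator fixes the cardinality, so
  the random parameter of the multinomial law becomes the number \<open>rest m\<close>.\<close>

lemma conditional_multinomial:
  assumes m: "m > s" and \<Phi>: "\<Phi> \<in> borel_measurable (history v)" "\<And>\<omega>. \<bar>\<Phi> \<omega>\<bar> \<le> (B :: real)"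
  shows "(\<integral>\<omega>. indicator {m} (N v \<omega>) * \<Phi> \<omega> * indicator (child_event v k) \<omega> \<partial>M)
    = (\<integral>\<omega>. indicator {m} (N v \<omega>) * \<Phi> \<omega> * multinomial_prob (law.rest m) (V v \<omega>) k \<partial>M)"
proof -
  define f where "f \<omega> = indicator {m} (N v \<omega>) * \<Phi> \<omega>" for \<omega>
  define g :: "'a \<Rightarrow> real" where "g = indicator (child_event v k)"
  have f_hist[measurable]: "f \<in> borel_measurable (history v)"
    unfolding f_def
    by (intro borel_measurable_times \<Phi>(1) measurable_compose[OF N_history[of v v]]) auto
  then have f_M[measurable]: "f \<in> borel_measurable M" by (rule measurable_from_subalg[OF subalgebra_history])
  have g_M[measurable]: "g \<in> borel_measurable M" unfolding g_def by measurable
  have f_bound: "\<bar>f \<omega>\<bar> \<le> \<bar>B\<bar>" for \<omega>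
    using \<Phi>(2)[of \<omega>] by (auto simp: f_def indicator_def)
  have "integrable M (\<lambda>\<omega>. f \<omega> * g \<omega>)"
    using f_bound by (intro integrable_bounded[of _ "\<bar>B\<bar>"]) (auto simp: g_def indicator_def)
  from hist.real_cond_exp_intg(2)[OF this f_hist g_M]
  have "(\<integral>\<omega>. f \<omega> * g \<omega> \<partial>M) = (\<integral>\<omega>. f \<omega> * real_cond_exp M (history v) g \<omega> \<partial>M)" by simp
  also have "\<dots> = (\<integral>\<omega>. f \<omega> * multinomial_prob (law.rest m) (V v \<omega>) k \<partial>M)"
  proof (rule integral_cong_AE)
    show "AE \<omega> in M. f \<omega> * real_cond_exp M (history v) g \<omega> = f \<omega> * multinomial_prob (law.rest m) (V v \<omega>) k"
      using split[of v k]
    proof eventually_elim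
      case (elim \<omega>)
      then show ?case using m by (auto simp: f_def g_def child_event_def law.rest_def indicator_def)
    qed
  qed auto
  finally show ?thesis by (simp add: f_def g_def)
qed

lemma sum_child_event:
  assumes "\<omega> \<in> space M" "finite K" "k0 \<in> K" "\<forall>i. N (v @ [i]) \<omega> = k0 i + s1"
  shows "(\<Sum>k\<in>K. h k * indicator (child_event v k) \<omega>) = (h k0 :: real)"
proof -
  have "indicator (child_event v k) \<omega> = (if k = k0 then 1 else 0 :: real)" for k
  proof (cases "k = k0")
    case False
    then obtain i where "k i \<noteq> k0 i" by (auto simp: fun_eq_iff)
    then have "N (v @ [i]) \<omega> \<noteq> k i + s1" using assms(4) by simp
    then have "\<omega> \<notin> child_event v k" by (auto simp: child_event_def)
    then show ?thesis using False by simp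
  qed (use assms in \<open>simp add: child_event_def\<close>)
  then show ?thesis using assms by (simp add: if_distrib[of "(*) _"] sum.delta cong: if_cong)
qed

text \<open>The axiom speaks about single child vectors. Their conditional probabilities add up to 1
  over \<open>comps\<close>, so the event that \<open>N v = m\<close> and none of them occurs, whose
  indicator is \<open>h\<close>, has probability 0.\<close>

lemma children_composition:
  assumes m: "m > s"
  shows "AE \<omega> in M. N v \<omega> = m \<longrightarrow> (\<exists>k\<in>comps UNIV (law.rest m). \<forall>i. N (v @ [i]) \<omega> = k i + s1)"
proof -
  define K where "K = (comps UNIV (law.rest m) :: ('b \<Rightarrow> nat) set)"
  have K: "finite K" unfolding K_def by (simp add: finite_comps)
  define h :: "'a \<Rightarrow> real" where "h \<omega> = indicator {m} (N v \<omega>) * (1 - (\<Sum>k\<in>K. indicator (child_event v k) \<omega>))" for \<omega>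
  have int1: "integrable M (\<lambda>\<omega>. indicator {m} (N v \<omega>) :: real)"
    by (rule integrable_bounded[of _ 1]) (auto simp: indicator_def)
  have int2: "integrable M (\<lambda>\<omega>. indicator {m} (N v \<omega>) * indicator (child_event v k) \<omega> :: real)" for k
    by (rule integrable_bounded[of _ 1]) (auto simp: indicator_def)
  have int3: "integrable M (\<lambda>\<omega>. indicator {m} (N v \<omega>) * multinomial_prob (law.rest m) (V v \<omega>) k)" for k
  proof (rule integrable_bounded[of _ 1])
    show "AE \<omega> in M. \<bar>indicator {m} (N v \<omega>) * multinomial_prob (law.rest m) (V v \<omega>) k\<bar> \<le> 1"
      using multinomial_prob_bound[of v] by eventually_elim (auto simp: indicator_def)
  qed measurable
  have sum_prob: "(\<Sum>k\<in>K. \<integral>\<omega>. indicator {m} (N v \<omega>) * indicator (child_event v k) \<omega> \<partial>M)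
    = (\<integral>\<omega>. indicator {m} (N v \<omega>) \<partial>M :: real)"
  proof -
    have "(\<integral>\<omega>. indicator {m} (N v \<omega>) * indicator (child_event v k) \<omega> \<partial>M)
      = (\<integral>\<omega>. indicator {m} (N v \<omega>) * multinomial_prob (law.rest m) (V v \<omega>) k \<partial>M)" for k
      using conditional_multinomial[OF m, of "\<lambda>_. 1" v 1 k] by simp
    then have "(\<Sum>k\<in>K. \<integral>\<omega>. indicator {m} (N v \<omega>) * indicator (child_event v k) \<omega> \<partial>M)
      = (\<integral>\<omega>. (\<Sum>k\<in>K. indicator {m} (N v \<omega>) * multinomial_prob (law.rest m) (V v \<omega>) k) \<partial>M)"
      using int3 by simp
    also have "\<dots> = (\<integral>\<omega>. indicator {m} (N v \<omega>) \<partial>M)"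
    proof (rule integral_cong_AE)
      show "AE \<omega> in M. (\<Sum>k\<in>K. indicator {m} (N v \<omega>) * multinomial_prob (law.rest m) (V v \<omega>) k) = indicator {m} (N v \<omega>)"
        using simplex_V[of v]
      proof eventually_elim
        case (elim \<omega>)
        then show ?case unfolding K_def by (simp add: sum_distrib_left[symmetric] sum_multinomial_prob)
      qed
    qed measurable
    finally show ?thesis .
  qed
  have disj: "(\<Sum>k\<in>K. indicator (child_event v k) \<omega>) = (if \<exists>k\<in>K. \<forall>i. N (v @ [i]) \<omega> = k i + s1 then 1 else 0 :: real)"
    if "\<omega> \<in> space M" for \<omega>
  proof (cases "\<exists>k\<in>K. \<forall>i. N (v @ [i]) \<omega> = k i + s1")
    case True
    then show ?thesis using sum_child_event[OF that K, of _ v "\<lambda>_. 1"] by auto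
  next
    case False
    then show ?thesis using that by (auto simp: child_event_def indicator_def intro!: sum.neutral)
  qed
  have h_int: "integrable M h"
    unfolding h_def right_diff_distrib sum_distrib_left using int1 int2 by simp
  have h_nonneg: "AE \<omega> in M. 0 \<le> h \<omega>" by (rule AE_I2) (simp add: h_def disj)
  have "(\<integral>\<omega>. h \<omega> \<partial>M) = 0"
    unfolding h_def right_diff_distrib sum_distrib_left using int1 int2 sum_prob
    by simp
  then have "AE \<omega> in M. h \<omega> = 0" using integral_nonneg_eq_0_iff_AE[OF h_int h_nonneg] by simp
  then show ?thesis
  proof (rule AE_mp, intro AE_I2 impI)
    fix \<omega> assume "\<omega> \<in> space M" "h \<omega> = 0" "N v \<omega> = m"
    then show "\<exists>k\<in>comps UNIV (law.rest m). \<forall>i. N (v @ [i]) \<omega> = k i + s1"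
      using disj[of \<omega>] by (auto simp: h_def K_def split: if_splits)
  qed
qed

text \<open>Clipping the argument to the unit interval makes \<open>kernel m f\<close> bounded on the whole line.\<close>

definition kernel :: "nat \<Rightarrow> (nat \<Rightarrow> real) \<Rightarrow> real \<Rightarrow> real" where
  "kernel m f p = (if m \<le> s then f 0 else bin_exp (law.rest m) (\<lambda>j. f (s1 + j)) (max 0 (min 1 p)))"

lemma kernel_measurable[measurable]: "kernel m f \<in> borel_measurable borel"
  unfolding kernel_def by measurable

lemma kernel_bound:
  assumes "\<And>j. \<bar>f j\<bar> \<le> F"
  shows "\<bar>kernel m f p\<bar> \<le> F"
proof (cases "m \<le> s")
  case False
  have "\<bar>bin_exp (law.rest m) (\<lambda>j. f (s1 + j)) (max 0 (min 1 p))\<bar> \<le> bin_exp (law.rest m) (\<lambda>j. F) (max 0 (min 1 p))"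
    using assms by (intro bin_exp_abs_le[THEN order.trans] bin_exp_mono) auto
  then show ?thesis using False by (simp add: kernel_def)
qed (use assms in \<open>simp add: kernel_def\<close>)

text \<open>On \<open>N v = m > s\<close> the children realise exactly one composition, so
  \<open>f\<close> at a child is a finite sum over compositions. After inserting the conditional
  probabilities, the marginal of coordinate \<open>i\<close> is the binomial average in
  \<open>kernel\<close>.\<close>

lemma child_expectation:
  assumes \<Phi>: "\<Phi> \<in> borel_measurable (history v)" "\<And>\<omega>. \<bar>\<Phi> \<omega>\<bar> \<le> B"
    and f: "\<And>j. \<bar>f j\<bar> \<le> (F :: real)"
  shows "(\<integral>\<omega>. indicator {m} (N v \<omega>) * \<Phi> \<omega> * f (N (v @ [i]) \<omega>) \<partial>M)
    = (\<integral>\<omega>. indicator {m} (N v \<omega>) * \<Phi> \<omega> * kernel m f (V v \<omega> $ i) \<partial>M)"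
proof -
  have \<Phi>M[measurable]: "\<Phi> \<in> borel_measurable M" by (rule measurable_from_subalg[OF subalgebra_history \<Phi>(1)])
  have fN[measurable]: "(\<lambda>\<omega>. f (N u \<omega>)) \<in> borel_measurable M" for u
    by (rule measurable_compose[OF N_measurable]) simp
  show ?thesis
  proof (cases "m \<le> s")
    case True
    show ?thesis
    proof (rule integral_cong_AE)
      show "AE \<omega> in M. indicator {m} (N v \<omega>) * \<Phi> \<omega> * f (N (v @ [i]) \<omega>)
        = indicator {m} (N v \<omega>) * \<Phi> \<omega> * kernel m f (V v \<omega> $ i)"
        using leaf[of v]
      proof eventually_elim
        case (elim \<omega>)
        have "strict_prefix v (v @ [i])" by (simp add: strict_prefix_def)
        then have "N (v @ [i]) \<omega> = 0" if "N v \<omega> = m" using elim that True by blast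
        then show ?case using True by (cases "N v \<omega> = m") (simp_all add: kernel_def)
      qed
    qed measurable
  next
    case False
    then have m: "m > s" by simp
    define K where "K = (comps UNIV (law.rest m) :: ('b \<Rightarrow> nat) set)"
    have K: "finite K" unfolding K_def by (simp add: finite_comps)
    have B0: "\<bar>\<Phi> \<omega>\<bar> \<le> \<bar>B\<bar>" for \<omega> using \<Phi>(2)[of \<omega>] by linarith
    have int1: "integrable M (\<lambda>\<omega>. indicator {m} (N v \<omega>) * \<Phi> \<omega> * indicator (child_event v k) \<omega>)" for k
      using B0 by (intro integrable_bounded[of _ "\<bar>B\<bar>"]) (auto simp: indicator_def)
    have int2: "integrable M (\<lambda>\<omega>. indicator {m} (N v \<omega>) * \<Phi> \<omega> * multinomial_prob (law.rest m) (V v \<omega>) k)" for k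
    proof (rule integrable_bounded[of _ "\<bar>B\<bar>"])
      show "AE \<omega> in M. \<bar>indicator {m} (N v \<omega>) * \<Phi> \<omega> * multinomial_prob (law.rest m) (V v \<omega>) k\<bar> \<le> \<bar>B\<bar>"
        using multinomial_prob_bound[of v]
      proof eventually_elim
        case (elim \<omega>)
        have "\<bar>\<Phi> \<omega>\<bar> * \<bar>multinomial_prob (law.rest m) (V v \<omega>) k\<bar> \<le> \<bar>B\<bar> * 1"
          using elim B0 by (intro mult_mono) auto
        then show ?case by (auto simp: indicator_def abs_mult)
      qed
    qed measurable
    have "(\<integral>\<omega>. indicator {m} (N v \<omega>) * \<Phi> \<omega> * f (N (v @ [i]) \<omega>) \<partial>M)
      = (\<integral>\<omega>. (\<Sum>k\<in>K. f (k i + s1) * (indicator {m} (N v \<omega>) * \<Phi> \<omega> * indicator (child_event v k) \<omega>)) \<partial>M)"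
    proof (rule integral_cong_AE)
      show "AE \<omega> in M. indicator {m} (N v \<omega>) * \<Phi> \<omega> * f (N (v @ [i]) \<omega>)
        = (\<Sum>k\<in>K. f (k i + s1) * (indicator {m} (N v \<omega>) * \<Phi> \<omega> * indicator (child_event v k) \<omega>))"
        using children_composition[OF m, of v]
      proof (rule AE_mp, intro AE_I2 impI)
        fix \<omega> assume \<omega>: "\<omega> \<in> space M"
          and ex: "N v \<omega> = m \<longrightarrow> (\<exists>k\<in>comps UNIV (law.rest m). \<forall>i. N (v @ [i]) \<omega> = k i + s1)"
        show "indicator {m} (N v \<omega>) * \<Phi> \<omega> * f (N (v @ [i]) \<omega>)
          = (\<Sum>k\<in>K. f (k i + s1) * (indicator {m} (N v \<omega>) * \<Phi> \<omega> * indicator (child_event v k) \<omega>))"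
        proof (cases "N v \<omega> = m")
          case True
          then obtain k0 where k0: "k0 \<in> K" "\<forall>i. N (v @ [i]) \<omega> = k0 i + s1"
            using ex unfolding K_def by blast
          have "(\<Sum>k\<in>K. f (k i + s1) * (\<Phi> \<omega> * indicator (child_event v k) \<omega>))
            = (\<Sum>k\<in>K. f (k i + s1) * \<Phi> \<omega> * indicator (child_event v k) \<omega>)"
            by (simp add: mult.assoc)
          also have "\<dots> = f (k0 i + s1) * \<Phi> \<omega>" by (rule sum_child_event[OF \<omega> K k0])
          finally show ?thesis using True k0 by (simp add: mult.commute)
        qed simp
      qed
    qed measurable
    also have "\<dots> = (\<Sum>k\<in>K. f (k i + s1) * (\<integral>\<omega>. indicator {m} (N v \<omega>) * \<Phi> \<omega> * indicator (child_event v k) \<omega> \<partial>M))"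
      using int1 by (subst Bochner_Integration.integral_sum) auto
    also have "\<dots> = (\<Sum>k\<in>K. f (k i + s1) * (\<integral>\<omega>. indicator {m} (N v \<omega>) * \<Phi> \<omega> * multinomial_prob (law.rest m) (V v \<omega>) k \<partial>M))"
      by (simp only: conditional_multinomial[OF m \<Phi>])
    also have "\<dots> = (\<integral>\<omega>. (\<Sum>k\<in>K. f (k i + s1) * (indicator {m} (N v \<omega>) * \<Phi> \<omega> * multinomial_prob (law.rest m) (V v \<omega>) k)) \<partial>M)"
      using int2 by (subst Bochner_Integration.integral_sum) auto
    also have "\<dots> = (\<integral>\<omega>. indicator {m} (N v \<omega>) * \<Phi> \<omega> * kernel m f (V v \<omega> $ i) \<partial>M)"
    proof (rule integral_cong_AE)
      show "AE \<omega> in M. (\<Sum>k\<in>K. f (k i + s1) * (indicator {m} (N v \<omega>) * \<Phi> \<omega> * multinomial_prob (law.rest m) (V v \<omega>) k))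
        = indicator {m} (N v \<omega>) * \<Phi> \<omega> * kernel m f (V v \<omega> $ i)"
        using simplex_V[of v] V_unit[of v]
      proof eventually_elim
        case (elim \<omega>)
        have "(\<Sum>k\<in>K. f (k i + s1) * multinomial_prob (law.rest m) (V v \<omega>) k) = bin_exp (law.rest m) (\<lambda>j. f (j + s1)) (V v \<omega> $ i)"
          unfolding K_def using elim by (intro multinomial_marginal) auto
        also have "\<dots> = kernel m f (V v \<omega> $ i)" using m elim by (simp add: kernel_def add.commute)
        finally have "indicator {m} (N v \<omega>) * \<Phi> \<omega> * kernel m f (V v \<omega> $ i)
          = indicator {m} (N v \<omega>) * \<Phi> \<omega> * (\<Sum>k\<in>K. f (k i + s1) * multinomial_prob (law.rest m) (V v \<omega>) k)" by simp
        then show ?case by (simp add: sum_distrib_left mult_ac)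
      qed
    qed measurable
    finally show ?thesis .
  qed
qed

text \<open>The cardinality at \<open>v\<close> depends only on the split vectors at the strict ancestors of \<open>v\<close>.\<close>

definition free_nodes :: "'b list \<Rightarrow> 'b list set" where
  "free_nodes v = {u. \<not> strict_prefix u v}"

definition free_vectors :: "'b list \<Rightarrow> 'a \<Rightarrow> 'b list \<Rightarrow> real ^ 'b" where
  "free_vectors v \<omega> = (\<lambda>u\<in>free_nodes v. V u \<omega>)"

lemma free_nodes_snoc: "free_nodes (v @ [i]) = free_nodes v - {v}"
  by (auto simp: free_nodes_def strict_prefix_def)

lemma self_free: "v \<in> free_nodes v"
  by (simp add: free_nodes_def)

lemma free_vectors_snoc: "restrict (free_vectors v \<omega>) (free_nodes (v @ [i])) = free_vectors (v @ [i]) \<omega>"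
  by (auto simp: free_vectors_def free_nodes_snoc restrict_def fun_eq_iff)

lemma free_vectors_history[measurable]: "free_vectors v \<in> measurable (history w) (\<Pi>\<^sub>M u\<in>free_nodes v. borel)"
  unfolding free_vectors_def[abs_def] by (intro measurable_restrict V_history)

lemma free_vectors_measurable[measurable]: "free_vectors v \<in> measurable M (\<Pi>\<^sub>M u\<in>free_nodes v. borel)"
  unfolding free_vectors_def[abs_def] by (intro measurable_restrict V_measurable)

lemma free_vectors_indep:
  fixes G :: "('b list \<Rightarrow> real ^ 'b) \<Rightarrow> real" and h :: "real \<Rightarrow> real"
  assumes G[measurable]: "G \<in> borel_measurable (\<Pi>\<^sub>M u\<in>free_nodes (v @ [i]). borel)" "\<And>x. \<bar>G x\<bar> \<le> B"
    and h[measurable]: "h \<in> borel_measurable borel" "\<And>x. \<bar>h x\<bar> \<le> H"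
  shows "(\<integral>\<omega>. G (free_vectors (v @ [i]) \<omega>) * h (V v \<omega> $ j) \<partial>M)
    = (\<integral>\<omega>. G (free_vectors (v @ [i]) \<omega>) \<partial>M) * (\<integral>\<omega>. h (\<V> \<omega> $ j) \<partial>P)"
proof -
  have "indep_var (\<Pi>\<^sub>M u\<in>free_nodes (v @ [i]). borel) (\<lambda>\<omega>. restrict (\<lambda>u. V u \<omega>) (free_nodes (v @ [i])))
     (\<Pi>\<^sub>M u\<in>{v}. borel) (\<lambda>\<omega>. restrict (\<lambda>u. V u \<omega>) {v})"
    by (rule indep_var_restrict[OF indep_V]) (auto simp: free_nodes_snoc)
  moreover have "(\<lambda>x. h (x v $ j)) \<in> borel_measurable (\<Pi>\<^sub>M u\<in>{v}. (borel :: (real ^ 'b) measure))"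
    by measurable
  ultimately have "indep_var borel (G \<circ> (\<lambda>\<omega>. restrict (\<lambda>u. V u \<omega>) (free_nodes (v @ [i]))))
      borel ((\<lambda>x. h (x v $ j)) \<circ> (\<lambda>\<omega>. restrict (\<lambda>u. V u \<omega>) {v}))"
    using G(1) by (intro indep_var_compose)
  then have ind: "indep_var borel (\<lambda>\<omega>. G (free_vectors (v @ [i]) \<omega>)) borel (\<lambda>\<omega>. h (V v \<omega> $ j))"
    by (simp add: o_def free_vectors_def)
  have "(\<integral>\<omega>. G (free_vectors (v @ [i]) \<omega>) * h (V v \<omega> $ j) \<partial>M)
    = (\<integral>\<omega>. G (free_vectors (v @ [i]) \<omega>) \<partial>M) * (\<integral>\<omega>. h (V v \<omega> $ j) \<partial>M)"
  proof (rule indep_var_lebesgue_integral[OF ind])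
    show "integrable M (\<lambda>\<omega>. G (free_vectors (v @ [i]) \<omega>))"
      using G(2) by (intro integrable_bounded[of _ B]) auto
    show "integrable M (\<lambda>\<omega>. h (V v \<omega> $ j))"
      using h(2) by (intro integrable_bounded[of _ H]) auto
  qed
  then show ?thesis by (simp only: integral_V[OF h(1)])
qed

text \<open>Independence of \<open>N v\<close> from the split vectors at free nodes, among them
  \<open>v\<close> itself, expressed through bounded test functions. The bound by \<open>n\<close>
  is carried along so that conditioning on \<open>N v\<close> is a finite sum.\<close>

definition cardinality_indep :: "'b list \<Rightarrow> bool" where
  "cardinality_indep v \<longleftrightarrow> (AE \<omega> in M. N v \<omega> \<le> n) \<and>
    (\<forall>G B m. G \<in> borel_measurable (\<Pi>\<^sub>M u\<in>free_nodes v. borel) \<longrightarrow> (\<forall>x. \<bar>G x :: real\<bar> \<le> B) \<longrightarrow>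
      (\<integral>\<omega>. indicator {m} (N v \<omega>) * G (free_vectors v \<omega>) \<partial>M)
        = (\<integral>\<omega>. indicator {m} (N v \<omega>) \<partial>M) * (\<integral>\<omega>. G (free_vectors v \<omega>) \<partial>M))"

text \<open>Given \<open>N v = m\<close>, the child enters through a function of \<open>V v\<close>.
  As \<open>v\<close> is free for itself but not for its child, the hypothesis separates
  \<open>N v\<close>, and independence of the split vectors separates \<open>V v\<close> from
  \<open>G\<close>. The remaining factor does not involve \<open>G\<close>, which is independence
  for the child.\<close>

lemma child_step:
  fixes G :: "('b list \<Rightarrow> real ^ 'b) \<Rightarrow> real"
  assumes v: "cardinality_indep v"
    and G[measurable]: "G \<in> borel_measurable (\<Pi>\<^sub>M u\<in>free_nodes (v @ [i]). borel)" "\<And>x. \<bar>G x\<bar> \<le> B"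
    and f: "\<And>j. \<bar>f j\<bar> \<le> (F :: real)"
  shows "(\<integral>\<omega>. G (free_vectors (v @ [i]) \<omega>) * f (N (v @ [i]) \<omega>) \<partial>M)
    = (\<integral>\<omega>. G (free_vectors (v @ [i]) \<omega>) \<partial>M)
      * (\<Sum>m\<le>n. (\<integral>\<omega>. indicator {m} (N v \<omega>) \<partial>M) * (\<integral>\<omega>. kernel m f (\<V> \<omega> $ i) \<partial>P))"
proof -
  define \<Phi> where "\<Phi> \<omega> = G (free_vectors (v @ [i]) \<omega>)" for \<omega>
  have \<Phi>_hist: "\<Phi> \<in> borel_measurable (history v)"
    unfolding \<Phi>_def[abs_def] by (rule measurable_compose[OF free_vectors_history G(1)])
  then have \<Phi>_M[measurable]: "\<Phi> \<in> borel_measurable M"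
    by (rule measurable_from_subalg[OF subalgebra_history])
  have fN[measurable]: "(\<lambda>\<omega>. f (N u \<omega>)) \<in> borel_measurable M" for u
    by (rule measurable_compose[OF N_measurable]) simp
  have \<Phi>_bound: "\<bar>\<Phi> \<omega>\<bar> \<le> B" for \<omega> by (simp add: \<Phi>_def G(2))
  have B: "B \<ge> 0" using \<Phi>_bound[of undefined] by linarith
  have F: "F \<ge> 0" using f[of 0] by linarith
  have int: "integrable M (\<lambda>\<omega>. indicator {m} (N v \<omega>) * \<Phi> \<omega> * f (N (v @ [i]) \<omega>))" for m
  proof (rule integrable_bounded[of _ "B * F"])
    have "\<bar>\<Phi> \<omega> * f (N (v @ [i]) \<omega>)\<bar> \<le> B * F" for \<omega>
      unfolding abs_mult using \<Phi>_bound f B by (intro mult_mono) auto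
    then show "AE \<omega> in M. \<bar>indicator {m} (N v \<omega>) * \<Phi> \<omega> * f (N (v @ [i]) \<omega>)\<bar> \<le> B * F"
      using B F by (auto simp: indicator_def)
  qed measurable
  have "(\<integral>\<omega>. \<Phi> \<omega> * f (N (v @ [i]) \<omega>) \<partial>M)
    = (\<integral>\<omega>. (\<Sum>m\<le>n. indicator {m} (N v \<omega>) * \<Phi> \<omega> * f (N (v @ [i]) \<omega>)) \<partial>M)"
  proof (rule integral_cong_AE)
    have "AE \<omega> in M. N v \<omega> \<le> n" using v by (simp add: cardinality_indep_def)
    then show "AE \<omega> in M. \<Phi> \<omega> * f (N (v @ [i]) \<omega>) = (\<Sum>m\<le>n. indicator {m} (N v \<omega>) * \<Phi> \<omega> * f (N (v @ [i]) \<omega>))"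
    proof eventually_elim
      case (elim \<omega>)
      have "(\<Sum>m\<le>n. indicator {m} (N v \<omega>) * \<Phi> \<omega> * f (N (v @ [i]) \<omega>))
        = (\<Sum>m\<le>n. if m = N v \<omega> then \<Phi> \<omega> * f (N (v @ [i]) \<omega>) else 0)"
        by (intro sum.cong) (auto simp: indicator_def)
      then show ?case using elim by simp
    qed
  qed measurable
  also have "\<dots> = (\<Sum>m\<le>n. \<integral>\<omega>. indicator {m} (N v \<omega>) * \<Phi> \<omega> * f (N (v @ [i]) \<omega>) \<partial>M)"
    using int by (intro Bochner_Integration.integral_sum)
  also have "\<dots> = (\<Sum>m\<le>n. (\<integral>\<omega>. \<Phi> \<omega> \<partial>M) * ((\<integral>\<omega>. indicator {m} (N v \<omega>) \<partial>M) * (\<integral>\<omega>. kernel m f (\<V> \<omega> $ i) \<partial>P)))"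
  proof (intro sum.cong refl)
    fix m
    define G' where "G' x = G (restrict x (free_nodes (v @ [i]))) * kernel m f (x v $ i)" for x
    have vf[measurable]: "(\<lambda>x. x v) \<in> measurable (\<Pi>\<^sub>M u\<in>free_nodes v. borel) (borel :: (real ^ 'b) measure)"
      by (rule measurable_component_singleton[OF self_free])
    have rf[measurable]: "(\<lambda>x. restrict x (free_nodes (v @ [i])))
      \<in> measurable (\<Pi>\<^sub>M u\<in>free_nodes v. (borel :: (real ^ 'b) measure)) (\<Pi>\<^sub>M u\<in>free_nodes (v @ [i]). borel)"
      by (rule measurable_restrict_subset) (auto simp: free_nodes_snoc)
    have G'_meas: "G' \<in> borel_measurable (\<Pi>\<^sub>M u\<in>free_nodes v. borel)"
      unfolding G'_def by measurable
    have G'_bound: "\<bar>G' x\<bar> \<le> B * F" for x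
      unfolding G'_def abs_mult using G(2) kernel_bound[OF f] B by (intro mult_mono) auto
    have G'_eq: "G' (free_vectors v \<omega>) = \<Phi> \<omega> * kernel m f (V v \<omega> $ i)" for \<omega>
      using self_free[of v] by (simp add: G'_def free_vectors_snoc \<Phi>_def) (simp add: free_vectors_def)
    have "(\<integral>\<omega>. indicator {m} (N v \<omega>) * \<Phi> \<omega> * f (N (v @ [i]) \<omega>) \<partial>M)
      = (\<integral>\<omega>. indicator {m} (N v \<omega>) * \<Phi> \<omega> * kernel m f (V v \<omega> $ i) \<partial>M)"
      by (rule child_expectation[OF \<Phi>_hist \<Phi>_bound f])
    also have "\<dots> = (\<integral>\<omega>. indicator {m} (N v \<omega>) * G' (free_vectors v \<omega>) \<partial>M)"
      by (simp add: G'_eq mult.assoc)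
    also have "\<dots> = (\<integral>\<omega>. indicator {m} (N v \<omega>) \<partial>M) * (\<integral>\<omega>. G' (free_vectors v \<omega>) \<partial>M)"
      using v G'_meas G'_bound unfolding cardinality_indep_def by blast
    also have "(\<integral>\<omega>. G' (free_vectors v \<omega>) \<partial>M) = (\<integral>\<omega>. \<Phi> \<omega> \<partial>M) * (\<integral>\<omega>. kernel m f (\<V> \<omega> $ i) \<partial>P)"
      unfolding G'_eq \<Phi>_def by (rule free_vectors_indep[OF G kernel_measurable kernel_bound[OF f]])
    finally show "(\<integral>\<omega>. indicator {m} (N v \<omega>) * \<Phi> \<omega> * f (N (v @ [i]) \<omega>) \<partial>M)
      = (\<integral>\<omega>. \<Phi> \<omega> \<partial>M) * ((\<integral>\<omega>. indicator {m} (N v \<omega>) \<partial>M) * (\<integral>\<omega>. kernel m f (\<V> \<omega> $ i) \<partial>P))" by simp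
  qed
  finally show ?thesis by (simp add: \<Phi>_def sum_distrib_left)
qed

lemma child_le: "\<lbrakk>m > s; j \<le> law.rest m\<rbrakk> \<Longrightarrow> s1 + j \<le> m"
  using law.rest_plus[of m] mult_le_mono1[of 1 "CARD('b)" s1] law.b_ge2 by linarith

lemma cardinality_indep: "cardinality_indep v"
proof (induction v rule: rev_induct)
  case Nil
  have ind: "AE \<omega> in M. indicator {m} (N [] \<omega>) = (indicator {m} n :: real)" for m
    using root by eventually_elim simp
  have "(\<integral>\<omega>. indicator {m} (N [] \<omega>) * G (free_vectors [] \<omega>) \<partial>M)
        = (\<integral>\<omega>. indicator {m} (N [] \<omega>) \<partial>M) * (\<integral>\<omega>. G (free_vectors [] \<omega>) \<partial>M)"
    if [measurable]: "G \<in> borel_measurable (\<Pi>\<^sub>M u\<in>free_nodes []. borel)" for G :: "_ \<Rightarrow> real" and m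
  proof -
    have "(\<integral>\<omega>. indicator {m} (N [] \<omega>) * G (free_vectors [] \<omega>) \<partial>M) = (\<integral>\<omega>. indicator {m} n * G (free_vectors [] \<omega>) \<partial>M)"
    proof (rule integral_cong_AE)
      show "AE \<omega> in M. indicator {m} (N [] \<omega>) * G (free_vectors [] \<omega>) = indicator {m} n * G (free_vectors [] \<omega>)"
        using ind[of m] by eventually_elim simp
    qed measurable
    moreover have "(\<integral>\<omega>. indicator {m} (N [] \<omega>) \<partial>M) = (\<integral>\<omega>. indicator {m} n \<partial>M :: real)"
      using ind[of m] by (intro integral_cong_AE) auto
    ultimately show ?thesis by (simp add: prob_space)
  qed
  moreover have "AE \<omega> in M. N [] \<omega> \<le> n" using root by eventually_elim simp
  ultimately show ?case by (simp add: cardinality_indep_def)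
next
  case (snoc i v)
  define \<kappa> where "\<kappa> f = (\<Sum>m\<le>n. (\<integral>\<omega>. indicator {m} (N v \<omega>) \<partial>M) * (\<integral>\<omega>. kernel m f (\<V> \<omega> $ i) \<partial>P))" for f
  have step: "(\<integral>\<omega>. G (free_vectors (v @ [i]) \<omega>) * f (N (v @ [i]) \<omega>) \<partial>M) = (\<integral>\<omega>. G (free_vectors (v @ [i]) \<omega>) \<partial>M) * \<kappa> f"
    if "G \<in> borel_measurable (\<Pi>\<^sub>M u\<in>free_nodes (v @ [i]). borel)" "\<And>x. \<bar>G x\<bar> \<le> B" "\<And>j. \<bar>f j\<bar> \<le> 1"
    for G :: "_ \<Rightarrow> real" and f B
    unfolding \<kappa>_def by (rule child_step[OF snoc that])
  have one: "(\<integral>\<omega>. f (N (v @ [i]) \<omega>) \<partial>M) = \<kappa> f" if "\<And>j. \<bar>f j\<bar> \<le> 1" for f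
    using step[of "\<lambda>_. 1" 1 f] that by (simp add: prob_space)
  have "(\<integral>\<omega>. indicator {m} (N (v @ [i]) \<omega>) * G (free_vectors (v @ [i]) \<omega>) \<partial>M)
        = (\<integral>\<omega>. indicator {m} (N (v @ [i]) \<omega>) \<partial>M) * (\<integral>\<omega>. G (free_vectors (v @ [i]) \<omega>) \<partial>M)"
    if "G \<in> borel_measurable (\<Pi>\<^sub>M u\<in>free_nodes (v @ [i]). borel)" "\<And>x. \<bar>G x\<bar> \<le> B" for G :: "_ \<Rightarrow> real" and B m
    using step[OF that, of "indicator {m}"] one[of "indicator {m}"] by (simp add: mult.commute)
  moreover have "AE \<omega> in M. N (v @ [i]) \<omega> \<le> n"
  proof -
    \<comment> \<open>Testing with the indicator of cardinalities above \<open>n\<close>: a node of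
      cardinality at most \<open>n\<close> has only children of cardinality at most
      \<open>n\<close>, so its kernel vanishes.\<close>
    define f :: "nat \<Rightarrow> real" where "f = indicator {n<..}"
    have "kernel m f p = 0" if "m \<le> n" for m p
    proof (cases "m \<le> s")
      case True
      then show ?thesis by (simp add: kernel_def f_def)
    next
      case False
      have "bin_exp (law.rest m) (\<lambda>j. f (s1 + j)) p = 0" for p
        unfolding bin_exp_def
      proof (intro sum.neutral ballI)
        fix j assume "j \<in> {..law.rest m}"
        then have "s1 + j \<le> n" using child_le[of m j] False that by auto
        then show "Bernstein (law.rest m) j p * f (s1 + j) = 0" by (simp add: f_def)
      qed
      then show ?thesis by (simp add: kernel_def False)
    qed
    then have "\<kappa> f = 0" by (simp add: \<kappa>_def)
    then have "(\<integral>\<omega>. f (N (v @ [i]) \<omega>) \<partial>M) = 0" using one[of f] by (simp add: f_def indicator_def)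
    moreover have fN: "(\<lambda>\<omega>. f (N (v @ [i]) \<omega>)) \<in> borel_measurable M" by (simp add: f_def)
    moreover have "integrable M (\<lambda>\<omega>. f (N (v @ [i]) \<omega>))"
      by (rule integrable_bounded[OF fN, of 1]) (auto simp: f_def indicator_def)
    ultimately have "AE \<omega> in M. f (N (v @ [i]) \<omega>) = 0"
      by (subst (asm) integral_nonneg_eq_0_iff_AE) (auto simp: f_def)
    then show ?thesis by eventually_elim (auto simp: f_def indicator_def split: if_splits)
  qed
  ultimately show ?case by (auto simp: cardinality_indep_def)
qed

lemma N_le: "AE \<omega> in M. N v \<omega> \<le> n"
  using cardinality_indep[of v] by (simp add: cardinality_indep_def)

lemma fN_measurable[measurable]: "(\<lambda>\<omega>. (f (N u \<omega>) :: real)) \<in> borel_measurable M"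
  by (rule measurable_compose[OF N_measurable]) simp

lemma fN_integrable: "integrable M (\<lambda>\<omega>. f (N u \<omega>) :: real)"
proof (rule integrable_bounded[of _ "\<Sum>j\<le>n. \<bar>f j\<bar>"])
  show "AE \<omega> in M. \<bar>f (N u \<omega>)\<bar> \<le> (\<Sum>j\<le>n. \<bar>f j\<bar>)"
    using N_le[of u] by eventually_elim (intro member_le_sum, auto)
qed simp

lemma fN_integral_sum:
  fixes f :: "nat \<Rightarrow> real"
  shows "(\<integral>\<omega>. f (N u \<omega>) \<partial>M) = (\<Sum>m\<le>n. (\<integral>\<omega>. indicator {m} (N u \<omega>) \<partial>M) * f m)"
proof -
  have "(\<integral>\<omega>. f (N u \<omega>) \<partial>M) = (\<integral>\<omega>. (\<Sum>m\<le>n. indicator {m} (N u \<omega>) * f m) \<partial>M)"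
  proof (rule integral_cong_AE)
    show "AE \<omega> in M. f (N u \<omega>) = (\<Sum>m\<le>n. indicator {m} (N u \<omega>) * f m)"
      using N_le[of u]
    proof eventually_elim
      case (elim \<omega>)
      have "(\<Sum>m\<le>n. indicator {m} (N u \<omega>) * f m) = (\<Sum>m\<le>n. if m = N u \<omega> then f m else 0)"
        by (intro sum.cong) (auto simp: indicator_def)
      then show ?case using elim by simp
    qed
  qed measurable
  also have "\<dots> = (\<Sum>m\<le>n. \<integral>\<omega>. indicator {m} (N u \<omega>) * f m \<partial>M)"
    by (intro Bochner_Integration.integral_sum fN_integrable)
  finally show ?thesis by simp
qed

text \<open>Summing over the components amounts to \<open>b\<close> times integration against
  \<open>component_law\<close>. The clipping has no effect there because this law lives on the unit
  interval, and \<open>f 0 = 0\<close> lets nodes that do not split contribute nothing.\<close>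

lemma kernel_level:
  assumes "f 0 = 0" "\<And>j. \<bar>f j\<bar> \<le> F"
  shows "(\<Sum>i\<in>UNIV. \<integral>\<omega>. kernel m f (\<V> \<omega> $ i) \<partial>P) = law.level_op f m"
proof -
  interpret P: prob_space P by (rule prob_P)
  have "(\<Sum>i\<in>UNIV. \<integral>\<omega>. kernel m f (\<V> \<omega> $ i) \<partial>P) = real CARD('b) * (\<integral>p. kernel m f p \<partial>component_law P \<V>)"
    using kernel_bound[OF assms(2)]
    by (intro component_law_integral prob_P vector_measurable kernel_measurable
        law.integrable_unit[of _ F] P.integrable_const_bound[of _ F]) auto
  also have "\<dots> = law.level_op f m"
  proof (cases "m \<le> s")
    case False
    have "(\<integral>p. kernel m f p \<partial>component_law P \<V>) = (\<integral>p. bin_exp (law.rest m) (\<lambda>j. f (s1 + j)) p \<partial>component_law P \<V>)"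
    proof (rule integral_cong_AE)
      show "AE p in component_law P \<V>. kernel m f p = bin_exp (law.rest m) (\<lambda>j. f (s1 + j)) p"
        using law.AE_unit by eventually_elim (use False in \<open>simp add: kernel_def\<close>)
    qed auto
    then show ?thesis using False by (simp add: law.level_op_def law.split_op_def)
  qed (simp add: kernel_def law.level_op_def assms)
  finally show ?thesis .
qed

lemma level_children:
  assumes f0: "f 0 = 0"
  shows "(\<Sum>i\<in>UNIV. \<integral>\<omega>. f (N (v @ [i]) \<omega>) \<partial>M) = (\<integral>\<omega>. law.level_op f (N v \<omega>) \<partial>M)"
proof -
  \<comment> \<open>Truncation makes the function bounded, as \<open>child_step\<close> requires;
    cardinalities exceed \<open>n\<close> only on a null set.\<close>
  define g where "g j = (if j \<le> n then f j else 0)" for j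
  define F where "F = (\<Sum>j\<le>n. \<bar>f j\<bar>)"
  have gF: "\<bar>g j\<bar> \<le> F" for j
    by (cases "j \<le> n") (auto simp: g_def F_def intro: member_le_sum sum_nonneg)
  have "(\<integral>\<omega>. f (N (v @ [i]) \<omega>) \<partial>M) = (\<Sum>m\<le>n. (\<integral>\<omega>. indicator {m} (N v \<omega>) \<partial>M) * (\<integral>\<omega>. kernel m g (\<V> \<omega> $ i) \<partial>P))" for i
  proof -
    have "(\<integral>\<omega>. f (N (v @ [i]) \<omega>) \<partial>M) = (\<integral>\<omega>. g (N (v @ [i]) \<omega>) \<partial>M)"
    proof (rule integral_cong_AE)
      show "AE \<omega> in M. f (N (v @ [i]) \<omega>) = g (N (v @ [i]) \<omega>)"
        using N_le[of "v @ [i]"] by eventually_elim (simp add: g_def)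
    qed measurable
    then show ?thesis
      using child_step[OF cardinality_indep, of "\<lambda>_. 1" v i 1 g F] gF by (simp add: prob_space)
  qed
  then have "(\<Sum>i\<in>UNIV. \<integral>\<omega>. f (N (v @ [i]) \<omega>) \<partial>M)
    = (\<Sum>i\<in>UNIV. \<Sum>m\<le>n. (\<integral>\<omega>. indicator {m} (N v \<omega>) \<partial>M) * (\<integral>\<omega>. kernel m g (\<V> \<omega> $ i) \<partial>P))" by simp
  also have "\<dots> = (\<Sum>m\<le>n. \<Sum>i\<in>UNIV. (\<integral>\<omega>. indicator {m} (N v \<omega>) \<partial>M) * (\<integral>\<omega>. kernel m g (\<V> \<omega> $ i) \<partial>P))"
    by (rule sum.swap)
  also have "\<dots> = (\<Sum>m\<le>n. (\<integral>\<omega>. indicator {m} (N v \<omega>) \<partial>M) * law.level_op f m)"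
  proof (intro sum.cong refl)
    fix m assume m: "m \<in> {..n}"
    have "(\<Sum>i\<in>UNIV. \<integral>\<omega>. kernel m g (\<V> \<omega> $ i) \<partial>P) = law.level_op g m"
      by (rule kernel_level[OF _ gF]) (simp add: g_def f0)
    also have "\<dots> = law.level_op f m"
    proof (cases "m > s")
      case True
      have "g (s1 + j) = f (s1 + j)" if "j \<le> law.rest m" for j
        using child_le[OF True that] m by (simp add: g_def)
      then show ?thesis
        unfolding law.level_op_def law.split_op_eq_sum by (auto intro!: sum.cong)
    qed (simp add: law.level_op_def)
    finally show "(\<Sum>i\<in>UNIV. (\<integral>\<omega>. indicator {m} (N v \<omega>) \<partial>M) * (\<integral>\<omega>. kernel m g (\<V> \<omega> $ i) \<partial>P))
      = (\<integral>\<omega>. indicator {m} (N v \<omega>) \<partial>M) * law.level_op f m"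
      by (simp add: sum_distrib_left[symmetric])
  qed
  also have "\<dots> = (\<integral>\<omega>. law.level_op f (N v \<omega>) \<partial>M)" by (rule fN_integral_sum[symmetric])
  finally show ?thesis .
qed

section \<open>Summation over the levels of the tree\<close>

definition level_nodes :: "nat \<Rightarrow> 'b list set" where
  "level_nodes k = {u. length u = k}"

lemma finite_level_nodes: "finite (level_nodes k)"
  using finite_lists_length_eq[of "UNIV :: 'b set" k] by (simp add: level_nodes_def)

lemma sum_level_nodes_Suc: "(\<Sum>u\<in>level_nodes (Suc k). g u) = (\<Sum>v\<in>level_nodes k. \<Sum>i\<in>UNIV. g (v @ [i]) :: real)"
proof -
  have "bij_betw (\<lambda>(v, i). v @ [i]) (level_nodes k \<times> UNIV) (level_nodes (Suc k))"
  proof (rule bij_betw_byWitness[where f' = "\<lambda>u. (butlast u, last u)"])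
    show "\<forall>u\<in>level_nodes (Suc k). (\<lambda>(v, i). v @ [i]) (butlast u, last u) = u"
      by (auto simp: level_nodes_def intro!: append_butlast_last_id)
  qed (auto simp: level_nodes_def)
  from sum.reindex_bij_betw[OF this, of g] show ?thesis
    by (simp add: sum.cartesian_product split_beta')
qed

text \<open>Induction on the depth for all \<open>f\<close> at once: the last level is folded into
  \<open>level_op f\<close>, evaluated one level higher.\<close>

lemma level_sum:
  assumes "f 0 = 0"
  shows "(\<Sum>u\<in>level_nodes k. \<integral>\<omega>. f (N u \<omega>) \<partial>M) = (law.level_op ^^ k) f n"
  using assms
proof (induction k arbitrary: f)
  case 0
  have "(\<integral>\<omega>. f (N [] \<omega>) \<partial>M) = (\<integral>\<omega>. f n \<partial>M)"
    using root by (intro integral_cong_AE) auto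
  then show ?case by (simp add: level_nodes_def prob_space)
next
  case (Suc k)
  have "(\<Sum>u\<in>level_nodes (Suc k). \<integral>\<omega>. f (N u \<omega>) \<partial>M) = (\<Sum>v\<in>level_nodes k. \<integral>\<omega>. law.level_op f (N v \<omega>) \<partial>M)"
    unfolding sum_level_nodes_Suc using level_children[of f, OF Suc.prems] by simp
  also have "\<dots> = (law.level_op ^^ k) (law.level_op f) n"
    by (rule Suc.IH) (simp add: law.level_op_def)
  finally show ?case by (simp only: funpow_Suc_right o_apply)
qed

text \<open>The first \<open>K\<close> levels form finite sets that exhaust all nodes, and nodes
  outside the tree contribute 0, so these sets are cofinal for the unordered sum. An increasing
  sequence is the form that monotone convergence requires.\<close>

lemma total_path_length_SUP:
  "total_path_length s s0 c
    = (SUP K. \<Sum>k<K. \<Sum>u\<in>level_nodes k. ennreal (real k * (if c u > s then real s0 else real (c u))))"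
proof -
  define g :: "'b list \<Rightarrow> ennreal" where "g u = of_nat (length u) * of_nat (stored_items s s0 c u)" for u
  have g: "g u = ennreal (real (length u) * (if c u > s then real s0 else real (c u)))" for u
    by (simp add: g_def stored_items_def ennreal_mult ennreal_of_nat_eq_real_of_nat)
  have g0: "g u = 0" if "u \<notin> tree_nodes c" for u using that by (simp add: g tree_nodes_def)
  define D where "D K = (\<Union>k<K. level_nodes k)" for K
  have D: "finite (D K)" for K by (simp add: D_def finite_level_nodes)
  have sum_D: "(\<Sum>k<K. \<Sum>u\<in>level_nodes k. ennreal (real k * (if c u > s then real s0 else real (c u)))) = sum g (D K)" for K
  proof -
    have "sum g (D K) = (\<Sum>k<K. sum g (level_nodes k))"
      unfolding D_def by (intro sum.UNION_disjoint) (simp_all add: finite_level_nodes, auto simp: level_nodes_def)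
    then show ?thesis by (simp add: g level_nodes_def)
  qed
  have "total_path_length s s0 c = (SUP F\<in>{F. finite F \<and> F \<subseteq> tree_nodes c}. sum g F)"
    unfolding total_path_length_def g_def by (intro nonneg_infsum_complete) auto
  also have "\<dots> = (SUP K. sum g (D K))"
  proof (rule SUP_eq)
    fix F assume F: "F \<in> {F. finite F \<and> F \<subseteq> tree_nodes c}"
    have "F \<subseteq> D (Suc (Max (length ` F)))"
      using F by (auto simp: D_def level_nodes_def less_Suc_eq_le intro!: Max_ge)
    then show "\<exists>K\<in>UNIV. sum g F \<le> sum g (D K)" using D by (intro bexI[OF _ UNIV_I] sum_mono2) auto
  next
    fix K
    have "sum g (D K) = sum g (D K \<inter> tree_nodes c)"
      using D g0 by (intro sum.mono_neutral_right) auto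
    then show "\<exists>F\<in>{F. finite F \<and> F \<subseteq> tree_nodes c}. sum g (D K) \<le> sum g F"
      using D by (intro bexI[of _ "D K \<inter> tree_nodes c"]) auto
  qed
  finally show ?thesis by (simp only: sum_D)
qed

theorem expected_path_length_eq: "expected_path_length s s0 M N = ennreal (law.expected_path n)"
proof -
  define \<sigma> where "\<sigma> m = (if m > s then real s0 else real m)" for m
  have \<sigma>: "\<sigma> m \<ge> 0" "\<sigma> 0 = 0" for m by (auto simp: \<sigma>_def)
  define S :: "nat \<Rightarrow> 'a \<Rightarrow> ennreal" where "S K \<omega> = (\<Sum>k<K. \<Sum>u\<in>level_nodes k. ennreal (real k * \<sigma> (N u \<omega>)))" for K \<omega>
  have S_int: "(\<integral>\<^sup>+\<omega>. S K \<omega> \<partial>M) = (\<Sum>k<K. ennreal (real k * law.stored_level k n))" for K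
  proof -
    have "(\<integral>\<^sup>+\<omega>. S K \<omega> \<partial>M) = (\<Sum>k<K. \<Sum>u\<in>level_nodes k. \<integral>\<^sup>+\<omega>. ennreal (real k * \<sigma> (N u \<omega>)) \<partial>M)"
      unfolding S_def by (simp add: nn_integral_sum)
    also have "\<dots> = (\<Sum>k<K. ennreal (real k * law.stored_level k n))"
    proof (intro sum.cong refl)
      fix k
      have "(\<integral>\<^sup>+\<omega>. ennreal (real k * \<sigma> (N u \<omega>)) \<partial>M) = ennreal (real k * (\<integral>\<omega>. \<sigma> (N u \<omega>) \<partial>M))" for u
        using \<sigma>(1) fN_integrable[of \<sigma> u] by (subst nn_integral_eq_integral) auto
      then have "(\<Sum>u\<in>level_nodes k. \<integral>\<^sup>+\<omega>. ennreal (real k * \<sigma> (N u \<omega>)) \<partial>M)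
        = (\<Sum>u\<in>level_nodes k. ennreal (real k * (\<integral>\<omega>. \<sigma> (N u \<omega>) \<partial>M)))" by simp
      also have "\<dots> = ennreal (\<Sum>u\<in>level_nodes k. real k * (\<integral>\<omega>. \<sigma> (N u \<omega>) \<partial>M))"
        using \<sigma>(1) by (intro sum_ennreal mult_nonneg_nonneg integral_nonneg_AE) auto
      also have "(\<Sum>u\<in>level_nodes k. real k * (\<integral>\<omega>. \<sigma> (N u \<omega>) \<partial>M)) = real k * law.stored_level k n"
        using level_sum[of \<sigma> k, OF \<sigma>(2)] by (simp add: sum_distrib_left[symmetric] law.stored_level_def \<sigma>_def[abs_def])
      finally show "(\<Sum>u\<in>level_nodes k. \<integral>\<^sup>+\<omega>. ennreal (real k * \<sigma> (N u \<omega>)) \<partial>M) = ennreal (real k * law.stored_level k n)" .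
    qed
    finally show ?thesis .
  qed
  have "expected_path_length s s0 M N = (\<integral>\<^sup>+\<omega>. (SUP K. S K \<omega>) \<partial>M)"
    unfolding expected_path_length_def total_path_length_SUP S_def \<sigma>_def ..
  also have "\<dots> = (SUP K. \<integral>\<^sup>+\<omega>. S K \<omega> \<partial>M)"
    by (rule nn_integral_monotone_convergence_SUP)
      (auto simp: S_def incseq_Suc_iff le_fun_def)
  also have "\<dots> = (SUP K. \<Sum>k<K. ennreal (real k * law.stored_level k n))"
    by (simp only: S_int)
  also have "\<dots> = (\<Sum>k. ennreal (real k * law.stored_level k n))"
    by (rule suminf_eq_SUP[symmetric])
  also have "\<dots> = ennreal (law.expected_path n)"
    unfolding law.expected_path_def
    by (rule suminf_ennreal2) (auto simp: law.stored_level_nonneg law.path_level_summable)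
  finally show ?thesis .
qed

end

subsection \<open>The law of the components\<close>

lemma prob_space_component_law:
  fixes \<V> :: "'p \<Rightarrow> real ^ 'b::finite"
  assumes "prob_space P" "\<V> \<in> borel_measurable P"
  shows "prob_space (component_law P \<V>)"
proof -
  interpret P: prob_space P by fact
  interpret Q: pair_prob_space P "measure_pmf (pmf_of_set (UNIV :: 'b set))"
    by unfold_locales
  show ?thesis
    unfolding component_law_def by (rule Q.prob_space_distr[OF component_measurable[OF assms(2)]])
qed

text \<open>Both sides say that the indicator \<open>h\<close> of the exceptional set has integral
  0; by nonnegativity the average over the components vanishes iff every component does.\<close>

lemma AE_component_law:
  fixes \<V> :: "'p \<Rightarrow> real ^ 'b::finite"
  assumes P: "prob_space P" and \<V>[measurable]: "\<V> \<in> borel_measurable P" and Q: "{x. Q x} \<in> sets borel"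
  shows "(AE x in component_law P \<V>. Q x) \<longleftrightarrow> (\<forall>i. AE \<omega> in P. Q (\<V> \<omega> $ i))"
proof -
  interpret P: prob_space P by fact
  interpret L: prob_space "component_law P \<V>" by (rule prob_space_component_law[OF P \<V>])
  have sets_L[measurable_cong]: "sets (component_law P \<V>) = sets borel" by (simp add: component_law_def)
  define h :: "real \<Rightarrow> real" where "h = indicator {x. \<not> Q x}"
  have "{x. \<not> Q x} = UNIV - {x. Q x}" by auto
  then have [measurable]: "h \<in> borel_measurable borel"
    using Q unfolding h_def by (intro borel_measurable_indicator) (metis sets.compl_sets space_borel)
  have h01: "0 \<le> h x" "h x \<le> 1" for x by (auto simp: h_def indicator_def)
  have int_L: "integrable (component_law P \<V>) h"
    using h01 by (intro L.integrable_const_bound[of _ 1]) auto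
  have int_P: "integrable P (\<lambda>\<omega>. h (\<V> \<omega> $ i))" for i
    using h01 by (intro P.integrable_const_bound[of _ 1]) auto
  have "(AE x in component_law P \<V>. Q x) \<longleftrightarrow> (AE x in component_law P \<V>. h x = 0)"
    by (simp add: h_def indicator_def)
  also have "\<dots> \<longleftrightarrow> (\<integral>x. h x \<partial>component_law P \<V>) = 0"
    using int_L h01 by (subst integral_nonneg_eq_0_iff_AE) auto
  also have "\<dots> \<longleftrightarrow> (\<Sum>i\<in>UNIV. \<integral>\<omega>. h (\<V> \<omega> $ i) \<partial>P) = 0"
    using component_law_integral[OF P \<V> _ int_L int_P] by simp
  also have "\<dots> \<longleftrightarrow> (\<forall>i. (\<integral>\<omega>. h (\<V> \<omega> $ i) \<partial>P) = 0)"
    using h01 by (subst sum_nonneg_eq_0_iff) (auto intro!: integral_nonneg_AE)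
  also have "\<dots> \<longleftrightarrow> (\<forall>i. AE \<omega> in P. h (\<V> \<omega> $ i) = 0)"
    using int_P h01 by (subst integral_nonneg_eq_0_iff_AE) auto
  also have "\<dots> \<longleftrightarrow> (\<forall>i. AE \<omega> in P. Q (\<V> \<omega> $ i))"
    by (simp add: h_def indicator_def)
  finally show ?thesis .
qed

lemma split_law_component_law:
  fixes \<V> :: "'p \<Rightarrow> real ^ 'b::finite"
  assumes b: "CARD('b) \<ge> 2" and capacity: "CARD('b) * s1 + s0 \<le> s + 1" and nz: "(s, s0) \<noteq> (0, 0)"
    and P: "prob_space P" and \<V>[measurable]: "\<V> \<in> borel_measurable P"
    and simplex: "AE \<omega> in P. (\<forall>i. \<V> \<omega> $ i \<ge> 0) \<and> (\<Sum>i\<in>UNIV. \<V> \<omega> $ i) = 1"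
    and nondegenerate: "\<P>(\<omega> in P. \<exists>i. \<V> \<omega> $ i = 1) < 1"
  shows "split_law (component_law P \<V>) CARD('b) s s0 s1"
proof -
  interpret P: prob_space P by fact
  interpret L: prob_space "component_law P \<V>" by (rule prob_space_component_law[OF P \<V>])
  have sets_L[measurable_cong]: "sets (component_law P \<V>) = sets borel" by (simp add: component_law_def)
  have unit: "AE \<omega> in P. 0 \<le> \<V> \<omega> $ i \<and> \<V> \<omega> $ i \<le> 1" for i
    using simplex
  proof eventually_elim
    case (elim \<omega>)
    have "\<V> \<omega> $ i \<le> (\<Sum>i\<in>UNIV. \<V> \<omega> $ i)" using elim by (intro member_le_sum) auto
    then show ?case using elim by auto
  qed
  have unit_L: "AE p in component_law P \<V>. 0 \<le> p \<and> p \<le> 1"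
    using unit by (subst AE_component_law[OF P \<V>]) auto
  have int_P: "integrable P (\<lambda>\<omega>. \<V> \<omega> $ i)" for i
  proof (rule P.integrable_const_bound[of _ 1])
    show "AE \<omega> in P. norm (\<V> \<omega> $ i) \<le> 1" using unit[of i] by eventually_elim simp
  qed simp
  have int_L: "integrable (component_law P \<V>) (\<lambda>p. p)"
  proof (rule L.integrable_const_bound[of _ 1])
    show "AE p in component_law P \<V>. norm p \<le> 1" using unit_L by eventually_elim simp
  qed simp
  have "real CARD('b) * (\<integral>p. p \<partial>component_law P \<V>) = (\<Sum>i\<in>UNIV. \<integral>\<omega>. \<V> \<omega> $ i \<partial>P)"
    by (rule component_law_integral[where h = "\<lambda>p. p", OF P \<V> _ int_L int_P, symmetric]) simp
  also have "\<dots> = (\<integral>\<omega>. (\<Sum>i\<in>UNIV. \<V> \<omega> $ i) \<partial>P)"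
    using int_P by simp
  also have "\<dots> = (\<integral>\<omega>. 1 \<partial>P)"
  proof (rule integral_cong_AE)
    show "AE \<omega> in P. (\<Sum>i\<in>UNIV. \<V> \<omega> $ i) = 1" using simplex by eventually_elim simp
  qed auto
  also have "\<dots> = 1" by (simp add: P.prob_space)
  finally have mean: "real CARD('b) * (\<integral>p. p \<partial>component_law P \<V>) = 1" .
  \<comment> \<open>Components in {0, 1} that sum to 1 include one equal to 1; if this happened
    almost surely, the probability assumed to be below 1 would be 1.\<close>
  have nondeg: "\<not> (AE p in component_law P \<V>. p = 0 \<or> p = 1)"
  proof
    assume "AE p in component_law P \<V>. p = 0 \<or> p = 1"
    then have "\<forall>i. AE \<omega> in P. \<V> \<omega> $ i = 0 \<or> \<V> \<omega> $ i = 1"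
      by (subst (asm) AE_component_law[OF P \<V>]) auto
    then have "AE \<omega> in P. \<forall>i. \<V> \<omega> $ i = 0 \<or> \<V> \<omega> $ i = 1"
      by (simp add: AE_all_countable)
    with simplex have "AE \<omega> in P. \<exists>i. \<V> \<omega> $ i = 1"
    proof eventually_elim
      case (elim \<omega>)
      show ?case
      proof (rule ccontr)
        assume "\<not> ?thesis"
        then have "(\<Sum>i\<in>UNIV. \<V> \<omega> $ i) = 0" using elim by (intro sum.neutral) auto
        then show False using elim by simp
      qed
    qed
    then have "\<P>(\<omega> in P. \<exists>i. \<V> \<omega> $ i = 1) = 1"
      by (subst P.prob_Collect_eq_1) auto
    then show False using nondegenerate by simp
  qed
  show ?thesis
    by unfold_locales (use b capacity nz unit_L mean nondeg sets_L in auto)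
qed

theorem theorem3p1:
  fixes s s0 s1 :: nat
    and P :: "'p measure" and \<V> :: "'p \<Rightarrow> real ^ 'b::finite"
    and M :: "nat \<Rightarrow> 'a measure"
    and V :: "nat \<Rightarrow> 'b list \<Rightarrow> 'a \<Rightarrow> real ^ 'b"
    and N :: "nat \<Rightarrow> 'b list \<Rightarrow> 'a \<Rightarrow> nat"
  assumes "CARD('b) \<ge> 2"
    and "CARD('b) * s1 + s0 \<le> s + 1"
    and "(s, s0) \<noteq> (0, 0)"
    and "prob_space P"
    and "\<V> \<in> borel_measurable P"
    and "AE \<omega> in P. (\<forall>i. \<V> \<omega> $ i \<ge> 0) \<and> (\<Sum>i\<in>UNIV. \<V> \<omega> $ i) = 1"
    and "\<P>(\<omega> in P. \<exists>i. \<V> \<omega> $ i = 1) < 1"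
    and "\<And>n. split_tree (M n) s s0 s1 P \<V> n (V n) (N n)"
  defines "\<mu> \<equiv> split_mu P \<V>"
    and "L \<equiv> component_law P \<V>"
    and "E\<Psi> \<equiv> \<lambda>n. expected_path_length s s0 (M n) (N n)"
  shows "(\<forall>n. E\<Psi> n < \<infinity>) \<and>
    (\<exists>\<phi> :: real \<Rightarrow> real.
       continuous_on UNIV \<phi> \<and> has_period \<phi> (log_span L) \<and>
       (\<lambda>n. enn2real (E\<Psi> n) - (1 / \<mu> * real n * ln (real n) + real n * \<phi> (ln (real n))))
         \<in> o(\<lambda>n. real n) \<and>
       (\<not> log_lattice L \<longrightarrow> log_span L = 0 \<and> (\<exists>c. \<forall>x. \<phi> x = c)))"
proof -
  interpret law: split_law L "CARD('b)" s s0 s1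
    unfolding L_def by (rule split_law_component_law) fact+
  have "split_tree_simplex (M n) s s0 s1 P \<V> n (V n) (N n)" for n
    using assms(4,5,6,8) law.split_law_axioms
    by (intro split_tree_simplex.intro split_tree_simplex_axioms.intro) (simp_all add: L_def)
  then have E\<Psi>: "E\<Psi> n = ennreal (law.expected_path n)" for n
    unfolding E\<Psi>_def L_def by (rule split_tree_simplex.expected_path_length_eq)
  have nonneg: "law.expected_path n \<ge> 0" for n
    unfolding law.expected_path_def
    by (intro suminf_nonneg law.path_level_summable mult_nonneg_nonneg law.stored_level_nonneg) simp
  have \<mu>: "\<mu> = law.mu" unfolding law.mu_def unfolding \<mu>_def split_mu_def L_def by (rule refl)
  have "enn2real (E\<Psi> n) = law.expected_path n" for n by (simp add: E\<Psi> nonneg)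
  moreover have "E\<Psi> n < \<infinity>" for n by (simp add: E\<Psi>)
  ultimately show ?thesis
    unfolding \<mu> using law.path_recursion_asymptotics[OF law.expected_path_0 law.expected_path_rec]
    by (simp only: simp_thms)
qed

end
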